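(* Let $f,\mu,u_0$ satisfy assumptions (A1)–(A4) listed in the context, and assume that the density $\Theta$ of $\mu$ is bounded in $\mathbb{R}^n$. Suppose there exists $\overline h\in\mathbb{R}$ such that $f(\overline h,\mu(D_{\overline h}(0)))\le 0\le f(\overline h,\mu(E_{\overline h}(0)))$. Assume that $f(\overline h,\cdot)$ is locally Lipschitz on $[0,\infty)$, that $$\mu(\{x\in\mathbb{R}^n:u_0(x)<\overline h\})=\mu(\{x\in\mathbb{R}^n:u_0(x)\le\overline h\}),$$ and that there exist constants $C,s_0>0$ such that $$\mathrm{Per}(D_{\overline h}(-s))+\mathrm{Per}(E_{\overline h}(s))\le C\quad\text{for }0<s\le s_0.$$ Then $\delta_D(t,\overline h)=\delta_E(t,\overline h)=0$ for all $t\ge0$; in other words, for the unique continuous viscosity solution $u$ of the Cauchy problem in the context satisfying the growth condition stated there, for any $t\ge0$, $$\{u(\cdot,t)<\overline h\}=\{u_0<\overline h\},\qquad \{u(\cdot,t)\le\overline h\}=\{u_0\le\overline h\}.$$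
   Context: Setting. $\mathcal{B}$ is the family of Lebesgue measurable subsets of $\mathbb{R}^n$; $f:\mathbb{R}\times[0,\infty)\to\mathbb{R}$, $\mu:\mathcal{B}\to[0,\infty)$, $u_0:\mathbb{R}^n\to\mathbb{R}$. $\mathrm{Per}(A)$ is the perimeter of $A\subset\mathbb{R}^n$. (A1) $f$ is bounded and continuous, and there is a modulus of continuity $\omega_f$ with $|f(r,q_1)-f(r,q_2)|\le\omega_f(|q_1-q_2|)$ for all $r\in\mathbb{R}$, $q_1,q_2\ge0$. (A2) $f(r_1,q)\le f(r_2,q)$ for $r_1<r_2$, $q\ge0$; and $f(r,q_1)<f(r,q_2)$ for $r\in\mathbb{R}$, $0\le q_1<q_2$. (A3) $\mu(A)=\int_A\Theta(x)\,dx$ for $A\in\mathcal{B}$, where $\Theta\in L^1(\mathbb{R}^n)$, $\Theta>0$ in $\mathbb{R}^n$. (A4) $u_0$ is uniformly continuous and $\lim_{R\to\infty}\inf\{u_0(y):|y|\ge R\}>u_0(x)$ for every $x\in\mathbb{R}^n$. Cauchy problem: $u_t(x,t)+|\nabla u(x,t)|f(u(x,t),\mu(\{u(\cdot,t)<u(x,t)\}))=0$ in $\mathbb{R}^n\times(0,\infty)$, $u(\cdot,0)=u_0$. Growth condition: for any $T>0$ there is $M_T>0$ with $|u(x,t)|\le M_T(|x|+1)$ on $\mathbb{R}^n\times[0,T]$. Viscosity solution: a locally bounded upper semicontinuous $u$ is a subsolution if whenever $\varphi\in C^1$ and $u-\varphi$ has a local maximum at $(x_0,t_0)$, $t_0>0$,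 then $\varphi_t+|\nabla\varphi|f(u,\mu(\{u(\cdot,t_0)<u(x_0,t_0)\}))\le0$ at $(x_0,t_0)$; a locally bounded lower semicontinuous $u$ is a supersolution if whenever $u-\varphi$ has a local minimum at $(x_0,t_0)$, then $\varphi_t+|\nabla\varphi|f(u,\mu(\{u(\cdot,t_0)\le u(x_0,t_0)\}))\ge0$ at $(x_0,t_0)$; a continuous function that is both is a solution. Under (A1)–(A4) and existence of $\overline h$, a unique continuous solution $u\in C(\mathbb{R}^n\times[0,\infty))$ with the growth condition exists. Parallel sets. For $h\in\mathbb{R}$: $D_h(0)=\{u_0<h\}$, $E_h(0)=\{u_0\le h\}$, and for $s\in\mathbb{R}$, $D_h(s)=\{x:\mathrm{sd}(x,D_h(0))<s\}$, $E_h(s)=\{x:\mathrm{sd}(x,E_h(0))\le s\}$, with $\mathrm{sd}(x,A)=\mathrm{dist}(x,A)-\mathrm{dist}(x,\mathbb{R}^n\setminus A)$ and $\mathrm{dist}(x,\emptyset)=+\infty$. Functions $\delta_D,\delta_E$. For $W\in\{D,E\}$ and $h\in\mathbb{R}$ consider Lipschitz $\delta:[0,\infty)\to\mathbb{R}$ with $\delta(0)=0$ and $f(h,\mu(\mathrm{int}\,W_h(\delta(t))))\le\delta'(t)\le f(h,\mu(\mathrm{cl}\,W_h(\delta(t))))$ for a.e. $t\ge0$. $\delta_D(\cdot,h)$ is the (pointwise) minimal such function for $W=D$, and $\delta_E(\cdot,h)$ the maximal such function for $W=E$ (these exist). *)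

theory Defs
  imports "HOL-Analysis.Analysis"
begin

section \<open>Standing assumptions\<close>

text \<open>
  The space \<open>R^n\<close> is \<open>real^'n\<close>. The velocity \<open>f r q\<close> matters only for \<open>q \<ge> 0\<close>, the set function
  \<open>mu\<close> only on \<open>sets lebesgue\<close>, and \<open>u x t\<close> only for \<open>t \<ge> 0\<close>; no definition below
  depends on the other values.
\<close>

definition modulus_of_continuity :: "(real \<Rightarrow> real) \<Rightarrow> bool" where
  "modulus_of_continuity \<omega> \<longleftrightarrow>
     mono_on {0..} \<omega> \<and> \<omega> 0 = 0 \<and> (\<omega> \<longlongrightarrow> 0) (at_right 0)"

definition A1 :: "(real \<Rightarrow> real \<Rightarrow> real) \<Rightarrow> bool" where
  "A1 f \<longleftrightarrow>
     bounded ((\<lambda>(r, q). f r q) ` (UNIV \<times> {0..})) \<and>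
     continuous_on (UNIV \<times> {0..}) (\<lambda>(r, q). f r q) \<and>
     (\<exists>\<omega>. modulus_of_continuity \<omega> \<and>
       (\<forall>r. \<forall>q1\<ge>0. \<forall>q2\<ge>0. \<bar>f r q1 - f r q2\<bar> \<le> \<omega> \<bar>q1 - q2\<bar>))"

definition A2 :: "(real \<Rightarrow> real \<Rightarrow> real) \<Rightarrow> bool" where
  "A2 f \<longleftrightarrow>
     (\<forall>r1 r2 q. r1 < r2 \<and> 0 \<le> q \<longrightarrow> f r1 q \<le> f r2 q) \<and>
     (\<forall>r q1 q2. 0 \<le> q1 \<and> q1 < q2 \<longrightarrow> f r q1 < f r q2)"

definition A3 :: "(real^'n \<Rightarrow> real) \<Rightarrow> ((real^'n) set \<Rightarrow> real) \<Rightarrow> bool" where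
  "A3 \<Theta> mu \<longleftrightarrow>
     integrable lebesgue \<Theta> \<and> (\<forall>x. 0 < \<Theta> x) \<and>
     (\<forall>A\<in>sets lebesgue. mu A = set_lebesgue_integral lebesgue A \<Theta>)"

text \<open>The infimum and its limit are taken in \<open>ereal\<close>, since the limit may be \<open>\<infinity>\<close>.\<close>

definition A4 :: "(real^'n \<Rightarrow> real) \<Rightarrow> bool" where
  "A4 u0 \<longleftrightarrow>
     uniformly_continuous_on UNIV u0 \<and>
     (\<exists>l. ((\<lambda>R::real. INF y\<in>{y. R \<le> norm y}. ereal (u0 y)) \<longlongrightarrow> l) at_top \<and>
          (\<forall>x. ereal (u0 x) < l))"

section \<open>Perimeter\<close>

definition C1_on :: "'a::real_normed_vector set \<Rightarrow> ('a \<Rightarrow> 'b::real_normed_vector) \<Rightarrow> bool" where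
  "C1_on S \<phi> \<longleftrightarrow>
     (\<exists>D. (\<forall>x\<in>S. (\<phi> has_derivative blinfun_apply (D x)) (at x)) \<and> continuous_on S D)"

definition divergence :: "(real^'n \<Rightarrow> real^'n) \<Rightarrow> real^'n \<Rightarrow> real" where
  "divergence \<phi> x = trace (jacobian \<phi> (at x))"

text \<open>The variational definition (De Giorgi), with value \<open>\<infinity>\<close> for sets of infinite perimeter.\<close>

definition perimeter :: "(real^'n) set \<Rightarrow> ereal" where
  "perimeter A =
     (SUP \<phi>\<in>{\<phi>. C1_on UNIV \<phi> \<and> compact (closure {x. \<phi> x \<noteq> 0}) \<and> (\<forall>x. norm (\<phi> x) \<le> 1)}.
        ereal (set_lebesgue_integral lebesgue A (divergence \<phi>)))"

section \<open>Parallel sets\<close>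

definition edist_set :: "'a::metric_space \<Rightarrow> 'a set \<Rightarrow> ereal" where
  "edist_set x A = (if A = {} then \<infinity> else ereal (infdist x A))"

definition sdist :: "'a::metric_space \<Rightarrow> 'a set \<Rightarrow> ereal" where
  "sdist x A = edist_set x A - edist_set x (- A)"

definition parD :: "(real^'n \<Rightarrow> real) \<Rightarrow> real \<Rightarrow> real \<Rightarrow> (real^'n) set" where
  "parD u0 h s = {x. sdist x {y. u0 y < h} < ereal s}"

definition parE :: "(real^'n \<Rightarrow> real) \<Rightarrow> real \<Rightarrow> real \<Rightarrow> (real^'n) set" where
  "parE u0 h s = {x. sdist x {y. u0 y \<le> h} \<le> ereal s}"

text \<open>For continuous \<open>u0\<close>, the case \<open>s = 0\<close> gives back the sub-level sets themselves.\<close>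

lemma parD_0:
  assumes "continuous_on UNIV u0"
  shows "parD u0 h 0 = {x. u0 x < h}"
proof -
  let ?A = "{x. u0 x < h}"
  have cl: "closed (- ?A)"
    using assms by (simp add: open_Collect_less closed_def)
  have "sdist x ?A < 0 \<longleftrightarrow> x \<in> ?A" for x
  proof (cases "- ?A = {}")
    case True
    then have "?A = UNIV" by blast
    then show ?thesis by (simp add: sdist_def edist_set_def)
  next
    case False
    show ?thesis
    proof
      assume "x \<in> ?A"
      then have "infdist x ?A = 0" "infdist x (- ?A) > 0"
        using in_closed_iff_infdist_zero[OF cl False, of x] infdist_nonneg[of x "- ?A"]
        by (auto simp del: in_closed_iff_infdist_zero)
      then show "sdist x ?A < 0"
        using \<open>x \<in> ?A\<close> False by (auto simp: sdist_def edist_set_def)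
    next
      assume "sdist x ?A < 0"
      then show "x \<in> ?A"
        using False infdist_nonneg[of x ?A]
        by (cases "x \<in> ?A") (auto simp: sdist_def edist_set_def split: if_splits)
    qed
  qed
  then show ?thesis by (simp add: parD_def zero_ereal_def[symmetric])
qed

lemma parE_0:
  assumes "continuous_on UNIV u0"
  shows "parE u0 h 0 = {x. u0 x \<le> h}"
proof -
  let ?A = "{x. u0 x \<le> h}"
  have cl: "closed ?A"
    using assms by (simp add: closed_Collect_le)
  have "sdist x ?A \<le> 0 \<longleftrightarrow> x \<in> ?A" for x
  proof (cases "?A = {}")
    case True
    then have "- ?A = UNIV" by blast
    then show ?thesis using True by (simp add: sdist_def edist_set_def)
  next
    case False
    show ?thesis
    proof
      assume "x \<in> ?A"
      then show "sdist x ?A \<le> 0"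
        using infdist_nonneg[of x "- ?A"] by (auto simp: sdist_def edist_set_def)
    next
      assume le: "sdist x ?A \<le> 0"
      show "x \<in> ?A"
      proof (rule ccontr)
        assume nin: "x \<notin> ?A"
        then have "infdist x ?A > 0" "infdist x (- ?A) = 0"
          using in_closed_iff_infdist_zero[OF cl False, of x] infdist_nonneg[of x ?A]
          by auto
        moreover have "- ?A \<noteq> {}" using nin by blast
        ultimately show False using le False
          by (auto simp: sdist_def edist_set_def split: if_splits)
      qed
    qed
  qed
  then show ?thesis by (simp add: parE_def zero_ereal_def[symmetric])
qed

section \<open>The functions \<open>\<delta>\<^sub>D\<close> and \<open>\<delta>\<^sub>E\<close>\<close>

text \<open>Here \<open>W\<close> stands for \<open>s \<mapsto> W\<^sub>h(s)\<close>.\<close>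

definition delta_admissible ::
  "(real \<Rightarrow> real \<Rightarrow> real) \<Rightarrow> ((real^'n) set \<Rightarrow> real) \<Rightarrow> real \<Rightarrow>
   (real \<Rightarrow> (real^'n) set) \<Rightarrow> (real \<Rightarrow> real) \<Rightarrow> bool" where
  "delta_admissible f mu h W \<delta> \<longleftrightarrow>
     (\<exists>L. L-lipschitz_on {0..} \<delta>) \<and> \<delta> 0 = 0 \<and>
     (AE t in lebesgue. 0 \<le> t \<longrightarrow>
       (\<exists>d. (\<delta> has_real_derivative d) (at t within {0..}) \<and>
            f h (mu (interior (W (\<delta> t)))) \<le> d \<and> d \<le> f h (mu (closure (W (\<delta> t))))))"

definition is_delta_D ::
  "(real \<Rightarrow> real \<Rightarrow> real) \<Rightarrow> ((real^'n) set \<Rightarrow> real) \<Rightarrow> (real^'n \<Rightarrow> real) \<Rightarrow> real \<Rightarrow>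
   (real \<Rightarrow> real) \<Rightarrow> bool" where
  "is_delta_D f mu u0 h \<delta> \<longleftrightarrow>
     delta_admissible f mu h (parD u0 h) \<delta> \<and>
     (\<forall>\<delta>'. delta_admissible f mu h (parD u0 h) \<delta>' \<longrightarrow> (\<forall>t\<ge>0. \<delta> t \<le> \<delta>' t))"

definition is_delta_E ::
  "(real \<Rightarrow> real \<Rightarrow> real) \<Rightarrow> ((real^'n) set \<Rightarrow> real) \<Rightarrow> (real^'n \<Rightarrow> real) \<Rightarrow> real \<Rightarrow>
   (real \<Rightarrow> real) \<Rightarrow> bool" where
  "is_delta_E f mu u0 h \<delta> \<longleftrightarrow>
     delta_admissible f mu h (parE u0 h) \<delta> \<and>
     (\<forall>\<delta>'. delta_admissible f mu h (parE u0 h) \<delta>' \<longrightarrow> (\<forall>t\<ge>0. \<delta>' t \<le> \<delta> t))"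

text \<open>
  The choice is immaterial: extremal functions are unique on \<open>t \<ge> 0\<close>, see
  \<open>delta_D_eq\<close> and \<open>delta_E_eq\<close>.
\<close>

definition delta_D ::
  "(real \<Rightarrow> real \<Rightarrow> real) \<Rightarrow> ((real^'n) set \<Rightarrow> real) \<Rightarrow> (real^'n \<Rightarrow> real) \<Rightarrow> real \<Rightarrow> real \<Rightarrow> real" where
  "delta_D f mu u0 t h = (SOME \<delta>. is_delta_D f mu u0 h \<delta>) t"

definition delta_E ::
  "(real \<Rightarrow> real \<Rightarrow> real) \<Rightarrow> ((real^'n) set \<Rightarrow> real) \<Rightarrow> (real^'n \<Rightarrow> real) \<Rightarrow> real \<Rightarrow> real \<Rightarrow> real" where
  "delta_E f mu u0 t h = (SOME \<delta>. is_delta_E f mu u0 h \<delta>) t"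

lemma delta_D_eq:
  assumes "is_delta_D f mu u0 h \<delta>" "0 \<le> t"
  shows "delta_D f mu u0 t h = \<delta> t"
proof -
  have "is_delta_D f mu u0 h (SOME \<delta>. is_delta_D f mu u0 h \<delta>)"
    using assms(1) by (rule someI[where P = "is_delta_D f mu u0 h"])
  with assms show ?thesis
    unfolding delta_D_def is_delta_D_def by (meson order_antisym)
qed

lemma delta_E_eq:
  assumes "is_delta_E f mu u0 h \<delta>" "0 \<le> t"
  shows "delta_E f mu u0 t h = \<delta> t"
proof -
  have "is_delta_E f mu u0 h (SOME \<delta>. is_delta_E f mu u0 h \<delta>)"
    using assms(1) by (rule someI[where P = "is_delta_E f mu u0 h"])
  with assms show ?thesis
    unfolding delta_E_def is_delta_E_def by (meson order_antisym)
qed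

section \<open>Viscosity solutions of the Cauchy problem\<close>

definition locally_bounded_on :: "'a::metric_space set \<Rightarrow> ('a \<Rightarrow> real) \<Rightarrow> bool" where
  "locally_bounded_on S g \<longleftrightarrow> (\<forall>z\<in>S. \<exists>e>0. bounded (g ` (ball z e \<inter> S)))"

definition usc_on :: "'a::topological_space set \<Rightarrow> ('a \<Rightarrow> real) \<Rightarrow> bool" where
  "usc_on S g \<longleftrightarrow> (\<forall>z\<in>S. \<forall>c>g z. \<forall>\<^sub>F w in at z within S. g w < c)"

definition lsc_on :: "'a::topological_space set \<Rightarrow> ('a \<Rightarrow> real) \<Rightarrow> bool" where
  "lsc_on S g \<longleftrightarrow> (\<forall>z\<in>S. \<forall>c<g z. \<forall>\<^sub>F w in at z within S. c < g w)"

text \<open>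
  The gradient of a test function \<open>\<phi>\<close> with respect to \<open>(x, t)\<close> is the pair \<open>(p, a)\<close>
  of \<open>p = \<nabla>\<phi>\<close> (in \<open>x\<close> only) and \<open>a = \<phi>\<^sub>t\<close>.
\<close>

definition viscosity_subsolution ::
  "(real \<Rightarrow> real \<Rightarrow> real) \<Rightarrow> ((real^'n) set \<Rightarrow> real) \<Rightarrow> (real^'n \<Rightarrow> real \<Rightarrow> real) \<Rightarrow> bool" where
  "viscosity_subsolution f mu u \<longleftrightarrow>
     locally_bounded_on (UNIV \<times> {0..}) (\<lambda>(x, t). u x t) \<and>
     usc_on (UNIV \<times> {0..}) (\<lambda>(x, t). u x t) \<and>
     (\<forall>\<phi> x0 t0 p a.
        C1_on (UNIV \<times> {0<..}) \<phi> \<and> 0 < t0 \<and>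
        (\<forall>\<^sub>F (x, t) in nhds (x0, t0). u x t - \<phi> (x, t) \<le> u x0 t0 - \<phi> (x0, t0)) \<and>
        GDERIV \<phi> (x0, t0) :> (p, a) \<longrightarrow>
        a + norm p * f (u x0 t0) (mu {x. u x t0 < u x0 t0}) \<le> 0)"

definition viscosity_supersolution ::
  "(real \<Rightarrow> real \<Rightarrow> real) \<Rightarrow> ((real^'n) set \<Rightarrow> real) \<Rightarrow> (real^'n \<Rightarrow> real \<Rightarrow> real) \<Rightarrow> bool" where
  "viscosity_supersolution f mu u \<longleftrightarrow>
     locally_bounded_on (UNIV \<times> {0..}) (\<lambda>(x, t). u x t) \<and>
     lsc_on (UNIV \<times> {0..}) (\<lambda>(x, t). u x t) \<and>
     (\<forall>\<phi> x0 t0 p a.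
        C1_on (UNIV \<times> {0<..}) \<phi> \<and> 0 < t0 \<and>
        (\<forall>\<^sub>F (x, t) in nhds (x0, t0). u x t - \<phi> (x, t) \<ge> u x0 t0 - \<phi> (x0, t0)) \<and>
        GDERIV \<phi> (x0, t0) :> (p, a) \<longrightarrow>
        a + norm p * f (u x0 t0) (mu {x. u x t0 \<le> u x0 t0}) \<ge> 0)"

definition cauchy_solution ::
  "(real \<Rightarrow> real \<Rightarrow> real) \<Rightarrow> ((real^'n) set \<Rightarrow> real) \<Rightarrow> (real^'n \<Rightarrow> real) \<Rightarrow>
   (real^'n \<Rightarrow> real \<Rightarrow> real) \<Rightarrow> bool" where
  "cauchy_solution f mu u0 u \<longleftrightarrow>
     continuous_on (UNIV \<times> {0..}) (\<lambda>(x, t). u x t) \<and>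
     viscosity_subsolution f mu u \<and> viscosity_supersolution f mu u \<and>
     (\<forall>x. u x 0 = u0 x)"

definition linear_growth :: "(real^'n \<Rightarrow> real \<Rightarrow> real) \<Rightarrow> bool" where
  "linear_growth u \<longleftrightarrow>
     (\<forall>T>0. \<exists>M>0. \<forall>x. \<forall>t\<in>{0..T}. \<bar>u x t\<bar> \<le> M * (norm x + 1))"

end

theory Submission
  imports Defs
begin

text \<open>
  At the level \<open>hb\<close> the speed \<open>f hb (mu {u0 < hb})\<close> vanishes, so the front \<open>{u = hb}\<close> stays put unless it
  moves and thereby changes the measure it encloses. If it has moved by at most \<open>\<rho>\<close>, the measure has
  changed by at most that of a one-sided layer of width \<open>\<rho>\<close> around it. The coarea formula and the perimeter
  bound make this \<open>O(\<rho>)\<close>, hence by the Lipschitz bound for \<open>f hb\<close> the speed is \<open>O(\<rho>)\<close> too, and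
  a Gronwall argument gives \<open>\<rho> = 0\<close>. For \<open>\<delta>\<^sub>D\<close> and \<open>\<delta>\<^sub>E\<close> this is an argument about Lipschitz
  functions of time; for a viscosity solution \<open>u\<close>, a speed bound keeps shrinking balls inside
  \<open>{u < hb}\<close> and \<open>{u > hb}\<close>, and it is improved iteratively. Once the enclosed measure is known to be
  constant, the same barriers at levels near \<open>hb\<close>, now with speed zero, give the opposite inclusions.

  The coarea inequality needs no differentiability theorem for Lipschitz functions: the distance to a
  closed set has one-sided directional derivatives wherever the nearest point is unique, and the
  points where it is not are covered by countably many closed sets, each meeting every line in some
  coordinate direction at most once.
\<close>

section \<open>Erosions and nearest points\<close>

text \<open>The sign conditions and the absence of fattening pinch the speed: \<open>f hb\<close>
  vanishes at the common measure of \<open>{u0 < hb}\<close> and \<open>{u0 \<le> hb}\<close>. The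
  gain that matters is a speed bound linear in \<rho>: with a mere modulus \<omega>, the inequality
  \<rho>' \<le> \<omega>(\<rho>) can have positive solutions starting from 0.

  Perimeters are controlled on one side only, for inward parallel sets of \<open>{u0 < hb}\<close>
  and outward ones of \<open>{u0 \<le> hb}\<close>. The latter are complements of inward parallel
  sets of \<open>{hb < u0}\<close>, so both sides become erosions of an open set. One side is
  enough: the zero function is admissible, so only a negative \<delta> for D and a positive one for
  E must be excluded, and for \<open>u\<close> only a loss of points from \<open>{u < hb}\<close> or
  \<open>{u > hb}\<close>.

  The coarea inequality is extracted from the variational perimeter. Let d be the distance to the
  complement of the open set. Summing the bounds on the integrals of div \<phi> over {d > r} for 0 <
  r < s bounds the integral of min(d, s) div \<phi> by C s. Integrating by parts, with \<phi> close
  to minus the gradient of d, turns that integral into the volume of {0 < d < s}.\<close>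

definition erosion :: "'a::metric_space set \<Rightarrow> real \<Rightarrow> 'a set" where
  "erosion U r = {x. \<exists>s>r. ball x s \<subseteq> U}"

lemma le_infdist_iff:
  assumes "F \<noteq> {}"
  shows "s \<le> infdist x F \<longleftrightarrow> (\<forall>y\<in>F. s \<le> dist x y)"
proof
  assume "\<forall>y\<in>F. s \<le> dist x y"
  then show "s \<le> infdist x F"
    unfolding infdist_notempty[OF assms] by (intro cINF_greatest) (use assms in auto)
qed (use infdist_le order_trans in blast)

lemma ball_subset_iff_le_infdist:
  assumes "- U \<noteq> {}"
  shows "ball x s \<subseteq> U \<longleftrightarrow> s \<le> infdist x (- U)"
  unfolding le_infdist_iff[OF assms] by (force simp: not_less)

text \<open>The hypothesis excludes \<open>U = UNIV\<close>, where \<open>infdist x {} = 0\<close>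
  would make the right-hand side empty for \<open>r \<ge> 0\<close>. The definition by balls follows
  the convention that the distance to the empty set is infinite. Its strict radius makes erosions
  open.\<close>

lemma erosion_eq_infdist:
  assumes "- U \<noteq> {}"
  shows "erosion U r = {x. r < infdist x (- U)}"
  unfolding erosion_def ball_subset_iff_le_infdist[OF assms] by auto

lemma erosion_UNIV [simp]: "erosion UNIV r = UNIV"
  unfolding erosion_def using gt_ex by auto

lemma open_erosion [simp]: "open (erosion U r)"
proof (cases "- U = {}")
  case True
  then have "U = UNIV" by blast
  then show ?thesis by simp
next
  case False
  then show ?thesis
    unfolding erosion_eq_infdist[OF False]
    by (intro open_Collect_less continuous_intros)
qed

lemma erosion_0: "open U \<Longrightarrow> erosion U 0 = U"
  unfolding erosion_def by (fastforce simp: open_contains_ball)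

lemma erosion_antimono: "r \<le> r' \<Longrightarrow> erosion U r' \<subseteq> erosion U r"
  unfolding erosion_def by force

lemma erosion_subset: "0 \<le> r \<Longrightarrow> erosion U r \<subseteq> U"
  unfolding erosion_def by auto

text \<open>On \<open>U\<close> the distance to \<open>U\<close> vanishes, so only the distance to
  the complement remains. Off \<open>U\<close> the signed distance is nonnegative and, as
  \<open>s > 0\<close>, the erosion has no point.\<close>

lemma sdist_less_iff:
  fixes U :: "'a::metric_space set"
  assumes "0 < s"
  shows "sdist x U < ereal (- s) \<longleftrightarrow> x \<in> erosion U s"
proof (cases "- U = {}")
  case True
  then have "U = UNIV" by blast
  then show ?thesis by (simp add: sdist_def edist_set_def)
next
  case F: False
  show ?thesis
  proof (cases "x \<in> U")
    case True
    then have "U \<noteq> {}" by auto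
    then show ?thesis
      using True F by (auto simp: sdist_def edist_set_def erosion_eq_infdist)
  next
    case False
    then have "infdist x (- U) = 0" by simp
    moreover have "0 \<le> infdist x U" by (rule infdist_nonneg)
    ultimately show ?thesis
      using assms F by (auto simp: sdist_def edist_set_def erosion_eq_infdist)
  qed
qed

lemma sdist_uminus: "sdist x (- U) = - sdist x U"
  by (cases "U = {}"; cases "- U = {}") (auto simp: sdist_def edist_set_def)

lemma parD_eq_erosion: "0 < s \<Longrightarrow> parD u0 h (- s) = erosion {x. u0 x < h} s"
  unfolding parD_def using sdist_less_iff[of s] by auto

text \<open>The signed distance changes sign under complements, which turns outward parallel sets of
  \<open>{u0 \<le> h}\<close> into inward ones of the open set \<open>{h < u0}\<close>.\<close>

lemma parE_eq_erosion:
  assumes "0 < s"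
  shows "parE u0 h s = - erosion {x. h < u0 x} s"
proof -
  have eq: "{y. u0 y \<le> h} = - {x. h < u0 x}" by auto
  have "sdist x (- {x. h < u0 x}) \<le> ereal s \<longleftrightarrow> \<not> sdist x {x. h < u0 x} < ereal (- s)" for x
    unfolding sdist_uminus by (cases "sdist x {x. h < u0 x}") auto
  then show ?thesis
    unfolding parE_def eq using sdist_less_iff[OF assms] by auto
qed

text \<open>The translates of a bounded piece of \<open>A\<close> by \<open>e / (n + 1)\<close> are
  pairwise disjoint, have equal measure and lie in one ball. Infinitely many of them fit only if
  that measure is 0.\<close>

lemma disjoint_translates_negligible:
  fixes A :: "'a::euclidean_space set"
  assumes A: "closed A" and tr: "\<And>x t. x \<in> A \<Longrightarrow> 0 < t \<Longrightarrow> x + t *\<^sub>R e \<notin> A"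
  shows "negligible A"
proof -
  have bdd: "negligible B" if B: "bounded B" "closed B" "B \<subseteq> A" for B
  proof -
    have Bm: "B \<in> lmeasurable" using B lmeasurable_compact compact_eq_bounded_closed by blast
    define T where "T n = (+) ((1 / real (Suc n)) *\<^sub>R e) ` B" for n
    obtain R where R: "\<And>x. x \<in> B \<Longrightarrow> norm x \<le> R" using B(1) bounded_iff by blast
    have Tm: "T n \<in> lmeasurable" for n unfolding T_def using measurable_translation[OF Bm] .
    have meas: "measure lebesgue (T n) = measure lebesgue B" for n
      unfolding T_def by (rule measure_translation)
    have sub: "T n \<subseteq> cball 0 (R + norm e)" for n
    proof
      fix x assume "x \<in> T n"
      then obtain y where y: "y \<in> B" "x = (1 / real (Suc n)) *\<^sub>R e + y" unfolding T_def by auto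
      have "norm x \<le> (1 / real (Suc n)) * norm e + norm y"
        unfolding y(2) by (rule norm_triangle_le) simp
      also have "\<dots> \<le> norm e + R"
        by (intro add_mono R y(1) mult_left_le_one_le) auto
      finally show "x \<in> cball 0 (R + norm e)" by simp
    qed
    have lt: "T m \<inter> T n = {}" if "m < n" for m n
    proof (rule ccontr)
      assume "T m \<inter> T n \<noteq> {}"
      then obtain y z where yz: "y \<in> B" "z \<in> B"
        "(1 / real (Suc m)) *\<^sub>R e + y = (1 / real (Suc n)) *\<^sub>R e + z" unfolding T_def by auto
      have "z = y + (1 / real (Suc m) - 1 / real (Suc n)) *\<^sub>R e"
        using yz(3) by (simp add: algebra_simps)
      moreover have "1 / real (Suc m) - 1 / real (Suc n) > 0"
        using that by (simp add: frac_less2)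
      ultimately show False using tr[of y] yz B(3) by blast
    qed
    have disj: "disjoint_family T"
      unfolding disjoint_family_on_def using lt by (metis Int_commute linorder_neqE_nat)
    have bound: "real N * measure lebesgue B \<le> measure lebesgue (cball 0 (R + norm e) :: 'a set)" for N
    proof -
      have "real N * measure lebesgue B = (\<Sum>n<N. measure lebesgue (T n))" by (simp add: meas)
      also have "\<dots> = measure lebesgue (\<Union>n<N. T n)"
        using disj fmeasurableD[OF Tm] fmeasurableD2[OF Tm]
        by (intro measure_finite_Union[symmetric]) (auto simp: disjoint_family_on_def top_unique)
      also have "\<dots> \<le> measure lebesgue (cball 0 (R + norm e) :: 'a set)"
        using sub Tm by (intro measure_mono_fmeasurable) (auto simp: fmeasurableD intro!: sets.finite_UN)
      finally show ?thesis .
    qed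
    have "measure lebesgue B = 0"
    proof (rule ccontr)
      assume "measure lebesgue B \<noteq> 0"
      then have "0 < measure lebesgue B" by (simp add: zero_less_measure_iff)
      then obtain N where "measure lebesgue (cball 0 (R + norm e) :: 'a set) < real N * measure lebesgue B"
        using reals_Archimedean3 by blast
      with bound[of N] show False by simp
    qed
    then show ?thesis using Bm by (simp add: negligible_iff_measure)
  qed
  have "A = (\<Union>n. A \<inter> cball 0 (real n))" using real_arch_simple by fastforce
  moreover have "negligible (\<Union>n. A \<inter> cball 0 (real n))"
    using A by (intro negligible_countable_Union bdd countable_image) (auto intro!: bdd)
  ultimately show ?thesis by simp
qed

section \<open>Nearest points and one-sided derivatives of the distance function\<close>

lemma infdist_attains:
  fixes F :: "'a::heine_borel set"
  assumes "closed F" "F \<noteq> {}"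
  obtains y where "y \<in> F" "infdist x F = dist x y"
  using infdist_attains_inf[OF assms] by metis

text \<open>Monotonicity of the nearest-point relation: square both inequalities, expand and
  add.\<close>

lemma nearest_points_monotone:
  fixes x x' y y' :: "'a::real_inner"
  assumes "dist x y \<le> dist x y'" "dist x' y' \<le> dist x' y"
  shows "0 \<le> (x' - x) \<bullet> (y' - y)"
proof -
  have "(dist x y)\<^sup>2 \<le> (dist x y')\<^sup>2" "(dist x' y')\<^sup>2 \<le> (dist x' y)\<^sup>2"
    using assms by (auto intro: power_mono)
  then show ?thesis
    unfolding dist_norm power2_norm_eq_inner by (simp add: algebra_simps inner_commute)
qed

text \<open>Two distinct nearest points differ in some coordinate \<open>i\<close>, and rationals
  \<open>p < q\<close> separate these coordinates. So \<open>x\<close> lies in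
  \<open>A i p q\<close>, the points with a nearest point in each of the halves \<open>L i p\<close>
  and \<open>G i q\<close>. By monotonicity, moving \<open>x\<close> forward along axis
  \<open>i\<close> cannot take a nearest point from \<open>G i q\<close> back to
  \<open>L i p\<close>, hence \<open>A i p q\<close> meets each line in that direction at most
  once.\<close>

lemma negligible_nonunique_nearest:
  fixes F :: "(real^'n) set"
  assumes F: "closed F"
  shows "negligible {x. \<exists>y\<in>F. \<exists>z\<in>F. y \<noteq> z \<and> dist x y = infdist x F \<and> dist x z = infdist x F}"
    (is "negligible ?N")
proof -
  define L where "L i p = F \<inter> {y. y $ i \<le> p}" for i :: 'n and p :: real
  define G where "G i q = F \<inter> {y. q \<le> y $ i}" for i :: 'n and q :: real
  \<comment> \<open>\<open>infdist\<close> to the empty set is 0, so without the case distinction an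
    empty half would satisfy its inequality everywhere.\<close>
  define A where "A i p q = (if L i p = {} \<or> G i q = {} then {} else
     {x. infdist x (L i p) \<le> infdist x F} \<inter> {x. infdist x (G i q) \<le> infdist x F})"
    for i :: 'n and p q :: real
  have clL: "closed (L i p)" and clG: "closed (G i p)" for i p
    unfolding L_def G_def using F by (auto intro!: closed_Int closed_Collect_le continuous_intros)
  have negA: "negligible (A i p q)" if "p < q" for i p q
  proof (rule disjoint_translates_negligible[where e = "axis i 1"])
    show "closed (A i p q)"
      unfolding A_def by (auto intro!: closed_Int closed_Collect_le continuous_intros)
    fix x t assume x: "x \<in> A i p q" and t: "0 < (t::real)"
    show "x + t *\<^sub>R axis i 1 \<notin> A i p q"
    proof
      assume x': "x + t *\<^sub>R axis i 1 \<in> A i p q"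
      have ne: "L i p \<noteq> {}" "G i q \<noteq> {}" using x unfolding A_def by (auto split: if_splits)
      obtain y where y: "y \<in> G i q" "infdist x (G i q) = dist x y"
        using infdist_attains[OF clG ne(2)] .
      obtain z where z: "z \<in> L i p" "infdist (x + t *\<^sub>R axis i 1) (L i p) = dist (x + t *\<^sub>R axis i 1) z"
        using infdist_attains[OF clL ne(1)] .
      have yF: "y \<in> F" and zF: "z \<in> F" using y z unfolding L_def G_def by auto
      have "dist x y \<le> infdist x F" using x y ne unfolding A_def by (auto split: if_splits)
      also have "\<dots> \<le> dist x z" using zF by (rule infdist_le)
      finally have 1: "dist x y \<le> dist x z" .
      have "dist (x + t *\<^sub>R axis i 1) z \<le> infdist (x + t *\<^sub>R axis i 1) F"
        using x' z ne unfolding A_def by (auto split: if_splits)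
      also have "\<dots> \<le> dist (x + t *\<^sub>R axis i 1) y" using yF by (rule infdist_le)
      finally have "dist (x + t *\<^sub>R axis i 1) z \<le> dist (x + t *\<^sub>R axis i 1) y" .
      from nearest_points_monotone[OF 1 this] have "0 \<le> t * (z $ i - y $ i)"
        by (simp add: inner_axis inner_axis' algebra_simps)
      with t have "y $ i \<le> z $ i" by (simp add: zero_le_mult_iff)
      moreover have "q \<le> y $ i" "z $ i \<le> p" using y z unfolding L_def G_def by auto
      ultimately show False using that by simp
    qed
  qed
  have "?N \<subseteq> (\<Union>i. \<Union>p\<in>\<rat>. \<Union>q\<in>\<rat> \<inter> {p<..}. A i p q)"
  proof
    fix x assume "x \<in> ?N"
    then obtain y z where yz: "y \<in> F" "z \<in> F" "y \<noteq> z" "dist x y = infdist x F" "dist x z = infdist x F"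
      by blast
    then obtain i where "y $ i \<noteq> z $ i" by (auto simp: vec_eq_iff)
    then have "\<exists>y z. y \<in> F \<and> z \<in> F \<and> y $ i < z $ i \<and> dist x y = infdist x F \<and> dist x z = infdist x F"
      using yz by (metis linorder_neqE_linordered_idom)
    then obtain y z where yz: "y \<in> F" "z \<in> F" "y $ i < z $ i" "dist x y = infdist x F" "dist x z = infdist x F"
      by blast
    obtain p where p: "p \<in> \<rat>" "y $ i < p" "p < z $ i" using Rats_dense_in_real[OF yz(3)] by blast
    obtain q where q: "q \<in> \<rat>" "p < q" "q < z $ i" using Rats_dense_in_real[OF p(3)] by blast
    have "y \<in> L i p" "z \<in> G i q" using yz p q unfolding L_def G_def by auto
    moreover from this have "infdist x (L i p) \<le> dist x y" "infdist x (G i q) \<le> dist x z"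
      by (auto intro: infdist_le)
    ultimately have "x \<in> A i p q" using yz unfolding A_def by auto
    then show "x \<in> (\<Union>i. \<Union>p\<in>\<rat>. \<Union>q\<in>\<rat> \<inter> {p<..}. A i p q)" using p q by blast
  qed
  moreover have "negligible (\<Union>i. \<Union>p\<in>\<rat>. \<Union>q\<in>\<rat> \<inter> {p<..}. A i p q)"
    using negA countable_rat by (auto intro!: negligible_countable_Union countable_image
        intro: countable_subset[OF Int_lower1])
  ultimately show ?thesis using negligible_subset by blast
qed

text \<open>The lower bound is the subgradient inequality for the norm at \<open>x - z\<close>, where \<open>z\<close> is
  a nearest point of the displaced point; uniqueness of the nearest point forces \<open>z\<close> to converge to it.\<close>

lemma infdist_directional_derivative:
  fixes F :: "'a::euclidean_space set"
  assumes F: "closed F" and y: "y \<in> F" "dist x y = infdist x F"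
    and uniq: "\<And>z. z \<in> F \<Longrightarrow> dist x z = infdist x F \<Longrightarrow> z = y"
    and d: "0 < infdist x F" and h: "h \<longlonglongrightarrow> 0" "\<And>n. 0 < h n"
  shows "(\<lambda>n. (infdist (x + h n *\<^sub>R e) F - infdist x F) / h n) \<longlonglongrightarrow> e \<bullet> ((x - y) /\<^sub>R infdist x F)"
proof -
  have ne: "F \<noteq> {}" using y by auto
  define z where "z n = (SOME z. z \<in> F \<and> infdist (x + h n *\<^sub>R e) F = dist (x + h n *\<^sub>R e) z)" for n
  have z: "z n \<in> F" "infdist (x + h n *\<^sub>R e) F = dist (x + h n *\<^sub>R e) (z n)" for n
    unfolding z_def by (rule someI2_ex; use infdist_attains[OF F ne] in metis)+
  have xh: "(\<lambda>n. x + h n *\<^sub>R e) \<longlonglongrightarrow> x"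
    using h(1) by (auto intro!: tendsto_eq_intros)
  have dz: "(\<lambda>n. dist x (z n)) \<longlonglongrightarrow> infdist x F"
  proof (rule tendsto_sandwich[OF _ _ tendsto_const])
    show "\<forall>\<^sub>F n in sequentially. infdist x F \<le> dist x (z n)"
      using z(1) by (simp add: infdist_le)
    have "dist x (z n) \<le> dist x (x + h n *\<^sub>R e) + infdist (x + h n *\<^sub>R e) F" for n
      unfolding z(2) by (rule dist_triangle)
    then show "\<forall>\<^sub>F n in sequentially. dist x (z n) \<le> dist x (x + h n *\<^sub>R e) + infdist (x + h n *\<^sub>R e) F"
      by simp
    have "(\<lambda>n. dist x (x + h n *\<^sub>R e) + infdist (x + h n *\<^sub>R e) F) \<longlonglongrightarrow> dist x x + infdist x F"
      by (intro tendsto_intros xh)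
    then show "(\<lambda>n. dist x (x + h n *\<^sub>R e) + infdist (x + h n *\<^sub>R e) F) \<longlonglongrightarrow> infdist x F" by simp
  qed
  have zy: "z \<longlonglongrightarrow> y"
  proof (rule ccontr)
    assume "\<not> z \<longlonglongrightarrow> y"
    then obtain r where r: "0 < r" "\<And>N. \<exists>n\<ge>N. r \<le> dist (z n) y"
      unfolding lim_sequentially by (meson not_less)
    then have "\<not> (\<forall>\<^sub>F n in sequentially. \<not> r \<le> dist (z n) y)"
      unfolding eventually_sequentially by blast
    from not_eventually_sequentiallyD[OF this]
    obtain k :: "nat \<Rightarrow> nat" where k: "strict_mono k" "\<And>n. r \<le> dist (z (k n)) y" by auto
    have "bounded (range (\<lambda>n. dist x (z n)))"
      using dz convergent_imp_bounded by blast
    then have "bounded (range z)"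
      unfolding bounded_any_center[where a = x] by (auto simp: bounded_iff)
    then have "bounded (range (z \<circ> k))" by (rule bounded_subset) auto
    then obtain l j where lj: "strict_mono j" "((z \<circ> k) \<circ> j) \<longlonglongrightarrow> l"
      using bounded_imp_convergent_subsequence by blast
    have "l \<in> F" by (rule closed_sequentially[OF F _ lj(2)]) (simp add: z(1))
    moreover have "(\<lambda>n. dist x (((z \<circ> k) \<circ> j) n)) \<longlonglongrightarrow> dist x l" by (intro tendsto_intros lj)
    moreover have "(\<lambda>n. dist x (((z \<circ> k) \<circ> j) n)) \<longlonglongrightarrow> infdist x F"
      using LIMSEQ_subseq_LIMSEQ[OF dz strict_mono_o[OF k(1) lj(1)]] by (simp add: o_def)
    ultimately have "l = y" using uniq LIMSEQ_unique by blast
    moreover have "r \<le> dist l y"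
      by (rule tendsto_lowerbound[OF tendsto_dist[OF lj(2) tendsto_const]]) (use k(2) in auto)
    ultimately show False using r by simp
  qed
  have nxy: "norm (x - y) = infdist x F" using y by (simp add: dist_norm)
  have sub: "norm v + w \<bullet> v /\<^sub>R norm v \<le> norm (v + w)" for v w :: 'a
  proof (cases "v = 0")
    case False
    have "norm v * (norm v + w \<bullet> v /\<^sub>R norm v) = (v + w) \<bullet> v"
      using False by (simp add: algebra_simps norm_eq_sqrt_inner inner_add_left)
    also have "\<dots> \<le> norm v * norm (v + w)" by (metis norm_cauchy_schwarz mult.commute)
    finally show ?thesis using False by simp
  qed simp
  show ?thesis
  proof (rule tendsto_sandwich)
    have lower: "e \<bullet> ((x - z n) /\<^sub>R norm (x - z n)) \<le> (infdist (x + h n *\<^sub>R e) F - infdist x F) / h n" for n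
    proof -
      have "infdist x F + h n * (e \<bullet> ((x - z n) /\<^sub>R norm (x - z n))) \<le> norm (x - z n) + (h n *\<^sub>R e) \<bullet> (x - z n) /\<^sub>R norm (x - z n)"
        using infdist_le[OF z(1), of x n] by (simp add: dist_norm)
      also have "\<dots> \<le> norm ((x - z n) + h n *\<^sub>R e)" by (rule sub)
      also have "\<dots> = infdist (x + h n *\<^sub>R e) F" by (simp add: z(2) dist_norm algebra_simps)
      finally show ?thesis using h(2)[of n] by (simp add: field_simps)
    qed
    then show "\<forall>\<^sub>F n in sequentially. e \<bullet> ((x - z n) /\<^sub>R norm (x - z n)) \<le> (infdist (x + h n *\<^sub>R e) F - infdist x F) / h n"
      by simp
    have "(\<lambda>n. e \<bullet> ((x - z n) /\<^sub>R norm (x - z n))) \<longlonglongrightarrow> e \<bullet> ((x - y) /\<^sub>R norm (x - y))"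
      using d nxy by (intro tendsto_intros zy) auto
    then show "(\<lambda>n. e \<bullet> ((x - z n) /\<^sub>R norm (x - z n))) \<longlonglongrightarrow> e \<bullet> ((x - y) /\<^sub>R infdist x F)"
      by (simp add: nxy)
    \<comment> \<open>For the upper bound the competitor stays \<open>y\<close>, and the same
      subgradient inequality is applied at the displaced point with the displacement undone.\<close>
    define v where "v n = (x + h n *\<^sub>R e) - y" for n
    have vl: "v \<longlonglongrightarrow> x - y" unfolding v_def by (intro tendsto_intros xh)
    have upper: "(infdist (x + h n *\<^sub>R e) F - infdist x F) / h n \<le> e \<bullet> (v n /\<^sub>R norm (v n))" for n
    proof -
      have "infdist (x + h n *\<^sub>R e) F \<le> norm (v n)"
        unfolding v_def using infdist_le[OF y(1)] by (simp add: dist_norm)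
      moreover have "norm (v n) + (- (h n *\<^sub>R e)) \<bullet> v n /\<^sub>R norm (v n) \<le> norm (v n + (- (h n *\<^sub>R e)))"
        by (rule sub)
      moreover have "v n + (- (h n *\<^sub>R e)) = x - y" unfolding v_def by simp
      ultimately have "infdist (x + h n *\<^sub>R e) F - infdist x F \<le> h n * (e \<bullet> (v n /\<^sub>R norm (v n)))"
        using nxy by (simp add: mult_ac)
      then show ?thesis using h(2)[of n] by (simp add: field_simps)
    qed
    then show "\<forall>\<^sub>F n in sequentially. (infdist (x + h n *\<^sub>R e) F - infdist x F) / h n \<le> e \<bullet> (v n /\<^sub>R norm (v n))"
      by simp
    have "(\<lambda>n. e \<bullet> (v n /\<^sub>R norm (v n))) \<longlonglongrightarrow> e \<bullet> ((x - y) /\<^sub>R norm (x - y))"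
      using d nxy by (intro tendsto_intros vl) auto
    then show "(\<lambda>n. e \<bullet> (v n /\<^sub>R norm (v n))) \<longlonglongrightarrow> e \<bullet> ((x - y) /\<^sub>R infdist x F)"
      by (simp add: nxy)
  qed
qed

section \<open>Integration by parts\<close>

lemma C1_on_const: "C1_on S (\<lambda>x. c)"
  unfolding C1_on_def by (intro exI[of _ "\<lambda>x. 0"]) (auto simp: zero_blinfun.rep_eq)

lemma C1_on_bounded_linear: "bounded_linear f \<Longrightarrow> C1_on S f"
  unfolding C1_on_def
  by (intro exI[of _ "\<lambda>x. Blinfun f"])
    (auto simp: bounded_linear_Blinfun_apply bounded_linear_imp_has_derivative)

lemma C1_on_imp_continuous_on: "C1_on S f \<Longrightarrow> continuous_on S f"
  unfolding C1_on_def
  by (meson has_derivative_continuous continuous_at_imp_continuous_on)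

lemma C1_on_bilinear:
  fixes pr :: "'a::real_normed_vector \<Rightarrow> 'b::real_normed_vector \<Rightarrow> 'c::real_normed_vector"
  assumes "bounded_bilinear pr" "C1_on S f" "C1_on S g"
  shows "C1_on S (\<lambda>x. pr (f x) (g x))"
proof -
  interpret bounded_bilinear pr by fact
  obtain D where D: "\<And>x. x \<in> S \<Longrightarrow> (f has_derivative blinfun_apply (D x)) (at x)" "continuous_on S D"
    using assms(2) unfolding C1_on_def by blast
  obtain E where E: "\<And>x. x \<in> S \<Longrightarrow> (g has_derivative blinfun_apply (E x)) (at x)" "continuous_on S E"
    using assms(3) unfolding C1_on_def by blast
  have f: "continuous_on S f" and g: "continuous_on S g"
    using assms C1_on_imp_continuous_on by blast+
  define G where "G x = (prod_left (g x) o\<^sub>L D x) + (prod_right (f x) o\<^sub>L E x)" for x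
  have "((\<lambda>x. pr (f x) (g x)) has_derivative blinfun_apply (G x)) (at x)" if "x \<in> S" for x
    by (rule has_derivative_eq_rhs[OF FDERIV[OF D(1)[OF that] E(1)[OF that]]])
      (auto simp: G_def blinfun.add_left prod_left.rep_eq prod_right.rep_eq add.commute)
  moreover have "continuous_on S G"
    unfolding G_def
    by (intro continuous_intros D(2) E(2) f g
        bounded_linear.continuous_on[OF bounded_linear_prod_left]
        bounded_linear.continuous_on[OF bounded_linear_prod_right])
  ultimately show ?thesis unfolding C1_on_def by blast
qed

lemmas C1_on_scaleR = C1_on_bilinear[OF bounded_bilinear_scaleR]
lemmas C1_on_mult = C1_on_bilinear[OF bounded_bilinear_mult]

lemma C1_on_add:
  assumes "C1_on S f" "C1_on S g"
  shows "C1_on S (\<lambda>x. f x + g x)"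
proof -
  obtain D where D: "\<And>x. x \<in> S \<Longrightarrow> (f has_derivative blinfun_apply (D x)) (at x)" "continuous_on S D"
    using assms(1) unfolding C1_on_def by blast
  obtain E where E: "\<And>x. x \<in> S \<Longrightarrow> (g has_derivative blinfun_apply (E x)) (at x)" "continuous_on S E"
    using assms(2) unfolding C1_on_def by blast
  show ?thesis
    unfolding C1_on_def using D E
    by (intro exI[of _ "\<lambda>x. D x + E x"])
      (auto intro!: continuous_intros has_derivative_add simp: plus_blinfun.rep_eq)
qed

lemma C1_on_sum: "(\<And>i. i \<in> I \<Longrightarrow> C1_on S (f i)) \<Longrightarrow> C1_on S (\<lambda>x. \<Sum>i\<in>I. f i x)"
  by (induction I rule: infinite_finite_induct) (auto intro: C1_on_const C1_on_add)

lemma C1_on_compose_real: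
  fixes g :: "'a::real_normed_vector \<Rightarrow> real"
  assumes g: "C1_on S g" and f: "\<And>t. (f has_real_derivative f' t) (at t)" "continuous_on UNIV f'"
  shows "C1_on S (\<lambda>x. f (g x))"
proof -
  obtain D where D: "\<And>x. x \<in> S \<Longrightarrow> (g has_derivative blinfun_apply (D x)) (at x)" "continuous_on S D"
    using g unfolding C1_on_def by blast
  have "((\<lambda>x. f (g x)) has_derivative blinfun_apply (f' (g x) *\<^sub>R D x)) (at x)" if "x \<in> S" for x
    using DERIV_compose_FDERIV[OF f(1) D(1)[OF that]]
    by (rule has_derivative_eq_rhs) (auto simp: scaleR_blinfun.rep_eq mult.commute)
  moreover have "continuous_on S (\<lambda>x. f' (g x) *\<^sub>R D x)"
    by (intro continuous_intros D(2) continuous_on_compose2[OF f(2)] C1_on_imp_continuous_on[OF g]) auto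
  ultimately show ?thesis unfolding C1_on_def by (intro exI conjI ballI)
qed

lemma C1_on_real_polynomial_function: "real_polynomial_function p \<Longrightarrow> C1_on S p"
  by (induction rule: real_polynomial_function.induct)
    (auto intro: C1_on_bounded_linear C1_on_const C1_on_add C1_on_mult)

lemma C1_on_polynomial_function:
  fixes p :: "'a::euclidean_space \<Rightarrow> 'b::euclidean_space"
  assumes "polynomial_function p"
  shows "C1_on S p"
proof -
  have "C1_on S (\<lambda>x. \<Sum>b\<in>Basis. (p x \<bullet> b) *\<^sub>R b)"
    using assms unfolding polynomial_function_iff_Basis_inner
    by (intro C1_on_sum C1_on_scaleR C1_on_const C1_on_real_polynomial_function) auto
  then show ?thesis by (simp add: euclidean_representation)
qed

lemma C1_on_gradient:
  assumes "\<And>x. x \<in> S \<Longrightarrow> GDERIV f x :> g x" "continuous_on S g"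
  shows "C1_on S f"
  unfolding C1_on_def
proof (intro exI conjI ballI)
  show "continuous_on S (\<lambda>x. blinfun_inner_left (g x))"
    by (rule bounded_linear.continuous_on[OF bounded_linear_blinfun_inner_left assms(2)])
qed (use assms(1) in \<open>auto simp: gderiv_def blinfun_inner_left.rep_eq\<close>)

text \<open>The competitors in the supremum that defines \<open>perimeter\<close>.\<close>

definition test_field :: "(real^'n \<Rightarrow> real^'n) \<Rightarrow> bool" where
  "test_field \<phi> \<longleftrightarrow> C1_on UNIV \<phi> \<and> compact (closure {x. \<phi> x \<noteq> 0}) \<and> (\<forall>x. norm (\<phi> x) \<le> 1)"

lemma divergence_eq:
  assumes "(\<phi> has_derivative D) (at x)"
  shows "divergence \<phi> x = (\<Sum>i\<in>UNIV. D (axis i 1) $ i)"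
  unfolding divergence_def jacobian_def trace_def matrix_def
  by (simp add: frechet_derivative_at[OF assms, symmetric])

lemma lborel_integral_translation:
  fixes f :: "'a::euclidean_space \<Rightarrow> 'b::{banach, second_countable_topology}"
  assumes "f \<in> borel_measurable borel"
  shows "(\<integral>x. f (x + c) \<partial>lborel) = (\<integral>x. f x \<partial>lborel)"
proof -
  have "(\<integral>x. f x \<partial>lborel) = (\<integral>x. f x \<partial>distr lborel borel ((+) c))"
    by (simp add: lborel_distr_plus)
  also have "\<dots> = (\<integral>x. f (c + x) \<partial>lborel)"
    by (rule integral_distr) (use assms in auto)
  finally show ?thesis by (simp add: add.commute)
qed

lemma integrable_continuous_compact_support:
  fixes g :: "'a::euclidean_space \<Rightarrow> 'b::{banach, second_countable_topology}"
  assumes "continuous_on UNIV g" "\<And>x. R < norm x \<Longrightarrow> g x = 0"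
  shows "integrable lborel g"
proof -
  have "integrable lborel (\<lambda>x. indicator (cball 0 R) x *\<^sub>R g x)"
    by (intro borel_integrable_compact) (use assms(1) continuous_on_subset in auto)
  moreover have "(\<lambda>x. indicator (cball 0 R) x *\<^sub>R g x) = g"
    using assms(2) by (auto simp: indicator_def fun_eq_iff)
  ultimately show ?thesis by simp
qed

text \<open>Supplies the dominating constant for difference quotients. Either the segment from
  \<open>x - v\<close> to \<open>x\<close> lies in the ball of radius \<open>R + 2\<close>, where
  the derivative is bounded, or both ends lie outside the support.\<close>

lemma C1_compact_support_difference_bound:
  fixes \<phi> :: "'a::euclidean_space \<Rightarrow> 'b::real_normed_vector"
  assumes \<phi>: "C1_on UNIV \<phi>" "\<And>x. R < norm x \<Longrightarrow> \<phi> x = 0"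
  obtains B where "\<And>x v. norm v \<le> 1 \<Longrightarrow> norm (\<phi> x - \<phi> (x - v)) \<le> B * norm v"
proof -
  obtain D where D: "\<And>x. (\<phi> has_derivative blinfun_apply (D x)) (at x)" "continuous_on UNIV D"
    using \<phi>(1) unfolding C1_on_def by auto
  have "compact (D ` cball 0 (R + 2))"
    by (intro compact_continuous_image continuous_on_subset[OF D(2)]) auto
  then obtain B where B: "\<And>x. x \<in> cball 0 (R + 2) \<Longrightarrow> norm (D x) \<le> B"
    using compact_imp_bounded bounded_iff by (metis imageI)
  show ?thesis
  proof
    fix x v :: 'a assume v: "norm v \<le> 1"
    have nx: "norm x \<le> norm (x - v) + norm v" by (metis diff_add_cancel norm_triangle_ineq)
    have nv: "norm (x - v) \<le> norm x + norm v" by (rule norm_triangle_ineq4)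
    show "norm (\<phi> x - \<phi> (x - v)) \<le> max B 0 * norm v"
    proof (cases "norm x \<le> R + 1")
      case True
      have "norm (\<phi> x - \<phi> (x - v)) \<le> max B 0 * norm (x - (x - v))"
      proof (rule differentiable_bound)
        show "convex (cball (0::'a) (R + 2))" by simp
        show "(\<phi> has_derivative blinfun_apply (D y)) (at y within cball 0 (R + 2))" for y
          using D(1) has_derivative_at_withinI by blast
        show "onorm (blinfun_apply (D y)) \<le> max B 0" if "y \<in> cball 0 (R + 2)" for y
          using B[OF that] by (simp add: norm_blinfun.rep_eq)
      qed (use True v nv in auto)
      then show ?thesis by simp
    next
      case False
      then have "R < norm x" "R < norm (x - v)" using nx v by auto
      then show ?thesis using \<phi>(2) by simp
    qed
  qed
qed

lemma compact_support_bound: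
  fixes \<phi> :: "'a::real_normed_vector \<Rightarrow> 'b::zero"
  assumes "compact (closure {x. \<phi> x \<noteq> 0})"
  obtains R where "0 < R" "\<And>x. R < norm x \<Longrightarrow> \<phi> x = 0"
proof -
  have "bounded {x. \<phi> x \<noteq> 0}"
    using assms compact_imp_bounded bounded_subset closure_subset by blast
  then obtain R where "0 < R" "\<forall>x\<in>{x. \<phi> x \<noteq> 0}. norm x \<le> R" unfolding bounded_pos by blast
  then show ?thesis using that[of R] by fastforce
qed

lemma continuous_divergence:
  assumes "C1_on UNIV \<phi>"
  shows "continuous_on UNIV (divergence \<phi>)"
proof -
  obtain D where D: "\<And>x. (\<phi> has_derivative blinfun_apply (D x)) (at x)" "continuous_on UNIV D"
    using assms unfolding C1_on_def by auto
  have "divergence \<phi> = (\<lambda>x. \<Sum>i\<in>UNIV. D x (axis i 1) $ i)"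
    using divergence_eq[OF D(1)] by (simp add: fun_eq_iff)
  moreover have "continuous_on UNIV (\<lambda>x. \<Sum>i\<in>UNIV. D x (axis i 1) $ i)"
    by (intro continuous_intros D(2))
  ultimately show ?thesis by simp
qed

lemma has_derivative_outside_support:
  fixes \<phi> :: "'a::real_normed_vector \<Rightarrow> 'b::real_normed_vector"
  assumes "\<And>y. R < norm y \<Longrightarrow> \<phi> y = 0" "R < norm x"
  shows "(\<phi> has_derivative (\<lambda>y. 0)) (at x)"
proof -
  have "((\<lambda>y. 0) has_derivative (\<lambda>y. 0)) (at x)" by simp
  then show ?thesis
  proof (rule has_derivative_transform_within_open)
    show "open (- cball (0::'a) R)" by auto
  qed (use assms in auto)
qed

lemma divergence_outside_support:
  assumes "\<And>y. R < norm y \<Longrightarrow> \<phi> y = 0" "R < norm x"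
  shows "divergence \<phi> x = 0"
  using divergence_eq[OF has_derivative_outside_support[OF assms]] by simp

text \<open>Integration by parts against a merely continuous weight \<open>w\<close>. For each step
  size, translating the integral moves the difference quotient from \<open>w\<close> onto \<phi>,
  where dominated convergence applies. The forward quotient of \<open>w\<close> becomes a backward
  quotient of \<phi>, which gives the sign.\<close>

lemma divergence_integral_limit:
  fixes \<phi> :: "real^'n \<Rightarrow> real^'n" and w :: "real^'n \<Rightarrow> real"
  assumes \<phi>: "C1_on UNIV \<phi>" "compact (closure {x. \<phi> x \<noteq> 0})" and w: "continuous_on UNIV w"
    and h: "h \<longlonglongrightarrow> 0" "\<And>n. 0 < h n" "\<And>n. h n \<le> 1"
  shows "(\<lambda>n. \<integral>x. (\<Sum>i\<in>UNIV. \<phi> x $ i * ((w x - w (x + h n *\<^sub>R axis i 1)) / h n)) \<partial>lborel)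
           \<longlonglongrightarrow> (\<integral>x. w x * divergence \<phi> x \<partial>lborel)"
proof -
  obtain D where D: "\<And>x. (\<phi> has_derivative blinfun_apply (D x)) (at x)" "continuous_on UNIV D"
    using \<phi>(1) unfolding C1_on_def by auto
  obtain R where R: "0 < R" "\<And>x. R < norm x \<Longrightarrow> \<phi> x = 0" using compact_support_bound[OF \<phi>(2)] by metis
  obtain B where B: "\<And>x v. norm v \<le> 1 \<Longrightarrow> norm (\<phi> x - \<phi> (x - v)) \<le> B * norm v"
    using C1_compact_support_difference_bound[OF \<phi>(1) R(2)] by metis
  have c\<phi>: "continuous_on UNIV \<phi>" using \<phi>(1) by (rule C1_on_imp_continuous_on)
  note wc = continuous_on_compose2[OF w]
  note \<phi>c = continuous_on_compose2[OF c\<phi>]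
  define a where "a i = (axis i 1 :: real^'n)" for i
  have na: "norm (h n *\<^sub>R a i) \<le> 1" "norm (h n *\<^sub>R a i) = h n" for n i
    using h(2,3)[of n] by (auto simp: a_def)
  have far: "R < norm (x - h n *\<^sub>R a i)" if "R + 1 < norm x" for x n i
    using norm_triangle_ineq2[of x "h n *\<^sub>R a i"] na(1)[of n i] that by linarith
  have hne: "h n \<noteq> 0" for n using h(2)[of n] by simp
  define q where "q n i x = w x * ((\<phi> x $ i - \<phi> (x - h n *\<^sub>R a i) $ i) / h n)" for n i x
  have int1: "integrable lborel (\<lambda>x. \<phi> x $ i * w x)" for i
    by (rule integrable_continuous_compact_support[where R = R]) (auto intro!: continuous_intros c\<phi> w simp: R)
  have int2: "integrable lborel (\<lambda>x. \<phi> x $ i * w (x + h n *\<^sub>R a i))" for i n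
    by (rule integrable_continuous_compact_support[where R = R]) (auto intro!: continuous_intros c\<phi> wc simp: R)
  have int3: "integrable lborel (\<lambda>x. \<phi> (x - h n *\<^sub>R a i) $ i * w x)" for i n
    by (rule integrable_continuous_compact_support[where R = "R + 1"])
      (auto intro!: continuous_intros \<phi>c w simp: R(2)[OF far])
  have shift: "(\<integral>x. \<phi> x $ i * ((w x - w (x + h n *\<^sub>R a i)) / h n) \<partial>lborel) = (\<integral>x. q n i x \<partial>lborel)" for i n
  proof -
    have eq: "(\<integral>x. \<phi> x $ i * w (x + h n *\<^sub>R a i) \<partial>lborel) = (\<integral>x. \<phi> (x - h n *\<^sub>R a i) $ i * w x \<partial>lborel)"
      using lborel_integral_translation[of "\<lambda>x. \<phi> (x - h n *\<^sub>R a i) $ i * w x" "h n *\<^sub>R a i"]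
      by (simp add: borel_measurable_continuous_onI continuous_intros \<phi>c w)
    have "(\<integral>x. \<phi> x $ i * ((w x - w (x + h n *\<^sub>R a i)) / h n) \<partial>lborel)
      = (\<integral>x. (\<phi> x $ i * w x - \<phi> x $ i * w (x + h n *\<^sub>R a i)) / h n \<partial>lborel)"
      by (simp add: algebra_simps)
    also have "\<dots> = ((\<integral>x. \<phi> x $ i * w x \<partial>lborel) - (\<integral>x. \<phi> x $ i * w (x + h n *\<^sub>R a i) \<partial>lborel)) / h n"
      using int1 int2 by simp
    also have "\<dots> = (\<integral>x. (\<phi> x $ i * w x - \<phi> (x - h n *\<^sub>R a i) $ i * w x) / h n \<partial>lborel)"
      unfolding eq using int1 int3 by simp
    also have "\<dots> = (\<integral>x. q n i x \<partial>lborel)"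
      unfolding q_def by (simp add: algebra_simps)
    finally show ?thesis .
  qed
  have qint: "integrable lborel (q n i)" for n i
    unfolding q_def
    by (rule integrable_continuous_compact_support[where R = "R + 1"])
      (auto intro!: continuous_intros c\<phi> \<phi>c w simp: R(2)[OF far] R(2) hne)
  have "compact (w ` cball 0 (R + 1))"
    by (intro compact_continuous_image continuous_on_subset[OF w]) auto
  then obtain W where W: "\<And>x. norm x \<le> R + 1 \<Longrightarrow> \<bar>w x\<bar> \<le> W"
    using compact_imp_bounded bounded_iff by (metis imageI mem_cball_0 real_norm_def)
  have W0: "0 \<le> W" using W[of 0] R(1) by simp
  \<comment> \<open>\<open>undefined\<close> is an arbitrary coordinate index; any displacement of
    positive length would do.\<close>
  have B0: "0 \<le> B"
  proof -
    have "0 \<le> B * h 0"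
      using B[of "h 0 *\<^sub>R a undefined" 0] na[of 0 undefined] order_trans[OF norm_ge_zero] by metis
    then show ?thesis using h(2)[of 0] by (simp add: zero_le_mult_iff)
  qed
  have iD: "integrable lborel (\<lambda>x. w x * (D x (a i) $ i))" for i
  proof (rule integrable_continuous_compact_support[where R = R])
    show "continuous_on UNIV (\<lambda>x. w x * (D x (a i) $ i))" by (intro continuous_intros w D(2))
    show "w x * (D x (a i) $ i) = 0" if "R < norm x" for x
      using has_derivative_unique[OF D(1) has_derivative_outside_support[of R \<phi>, OF R(2) that]] by simp
  qed
  have lim: "(\<lambda>n. \<integral>x. q n i x \<partial>lborel) \<longlonglongrightarrow> (\<integral>x. w x * (D x (a i) $ i) \<partial>lborel)" for i
  proof (rule integral_dominated_convergence)
    show "integrable lborel (\<lambda>x. W * B * indicator (cball (0::real^'n) (R + 1)) x)"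
      by (intro integrable_mult_right integrable_real_indicator)
        (use emeasure_bounded_finite[OF bounded_cball, of "0::real^'n" "R + 1"] in auto)
    show "AE x in lborel. norm (q n i x) \<le> W * B * indicator (cball 0 (R + 1)) x" for n
    proof (rule AE_I2)
      fix x
      show "norm (q n i x) \<le> W * B * indicator (cball 0 (R + 1)) x"
      proof (cases "norm x \<le> R + 1")
        case True
        have "\<bar>\<phi> x $ i - \<phi> (x - h n *\<^sub>R a i) $ i\<bar> \<le> norm (\<phi> x - \<phi> (x - h n *\<^sub>R a i))"
          by (metis component_le_norm_cart vector_minus_component)
        also have "\<dots> \<le> B * h n" using B[OF na(1), of x n i] na(2)[of n i] by simp
        finally have "\<bar>(\<phi> x $ i - \<phi> (x - h n *\<^sub>R a i) $ i) / h n\<bar> \<le> B"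
          using h(2)[of n] by (simp add: field_simps)
        then have "\<bar>w x\<bar> * \<bar>(\<phi> x $ i - \<phi> (x - h n *\<^sub>R a i) $ i) / h n\<bar> \<le> W * B"
          using W[OF True] W0 B0 by (intro mult_mono) auto
        then show ?thesis using True by (simp add: q_def abs_mult)
      next
        case False
        then show ?thesis using R(2) far[of x n i] unfolding q_def by simp
      qed
    qed
    show "AE x in lborel. (\<lambda>n. q n i x) \<longlonglongrightarrow> w x * (D x (a i) $ i)"
    proof (rule AE_I2)
      fix x
      have "((\<lambda>t. \<phi> (x + t *\<^sub>R a i)) has_vector_derivative D x (a i)) (at 0)"
      proof -
        have "((\<lambda>t. \<phi> (x + t *\<^sub>R a i)) has_derivative (\<lambda>t. D x (t *\<^sub>R a i))) (at 0)"
          by (rule has_derivative_compose[where g = \<phi> and f = "\<lambda>t. x + t *\<^sub>R a i", simplified])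
            (auto intro!: derivative_eq_intros D(1)[of x])
        then show ?thesis by (simp add: has_vector_derivative_def blinfun.scaleR_right)
      qed
      then have "((\<lambda>t. \<phi> (x + t *\<^sub>R a i) $ i) has_real_derivative D x (a i) $ i) (at 0)"
        unfolding has_real_derivative_iff_has_vector_derivative
        by (rule bounded_linear.has_vector_derivative[OF bounded_linear_vec_nth])
      then have lim0: "((\<lambda>t. (\<phi> (x + t *\<^sub>R a i) $ i - \<phi> x $ i) / t) \<longlongrightarrow> D x (a i) $ i) (at 0)"
        by (simp add: DERIV_def)
      have lim': "filterlim (\<lambda>n. - h n) (at 0) sequentially"
        unfolding filterlim_at using tendsto_minus[OF h(1)] hne by simp
      have eq: "(\<phi> (x + - h n *\<^sub>R a i) $ i - \<phi> x $ i) / - h n = (\<phi> x $ i - \<phi> (x - h n *\<^sub>R a i) $ i) / h n" for n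
        using minus_divide_divide[of "\<phi> x $ i - \<phi> (x - h n *\<^sub>R a i) $ i" "h n"] by simp
      from filterlim_compose[OF lim0 lim']
      have "(\<lambda>n. (\<phi> x $ i - \<phi> (x - h n *\<^sub>R a i) $ i) / h n) \<longlonglongrightarrow> D x (a i) $ i"
        unfolding eq .
      then show "(\<lambda>n. q n i x) \<longlonglongrightarrow> w x * (D x (a i) $ i)"
        unfolding q_def by (intro tendsto_intros)
    qed
    show "(\<lambda>x. w x * (D x (a i) $ i)) \<in> borel_measurable lborel"
      using iD by (rule borel_measurable_integrable)
    show "q n i \<in> borel_measurable lborel" for n using qint by auto
  qed
  have "(\<lambda>n. \<Sum>i\<in>UNIV. \<integral>x. q n i x \<partial>lborel) \<longlonglongrightarrow> (\<Sum>i\<in>UNIV. \<integral>x. w x * (D x (a i) $ i) \<partial>lborel)"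
    by (intro tendsto_sum lim)
  moreover have "(\<Sum>i\<in>UNIV. \<integral>x. w x * (D x (a i) $ i) \<partial>lborel) = (\<integral>x. w x * divergence \<phi> x \<partial>lborel)"
    using iD by (simp add: divergence_eq[OF D(1)] sum_distrib_left a_def)
  moreover have "(\<Sum>i\<in>UNIV. \<integral>x. q n i x \<partial>lborel)
    = (\<integral>x. (\<Sum>i\<in>UNIV. \<phi> x $ i * ((w x - w (x + h n *\<^sub>R axis i 1)) / h n)) \<partial>lborel)" for n
  proof -
    have "integrable lborel (\<lambda>x. \<phi> x $ i * ((w x - w (x + h n *\<^sub>R a i)) / h n))" for i
      by (rule integrable_continuous_compact_support[where R = R])
       (auto intro!: continuous_intros c\<phi> w wc simp: R hne)
    then show ?thesis
      unfolding shift[symmetric] a_def by (simp add: Bochner_Integration.integral_sum)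
  qed
  ultimately show ?thesis by simp
qed

section \<open>Volume of a one-sided layer\<close>

text \<open>Layer cake: min(d, s) is the integral over 0 < r < s of the indicator of {d > r}.
  Riemann sums replace that integral, so the bounds for single values of \<open>r\<close> can be
  added directly. The error is at most the mesh times the integral of the absolute
  divergence.\<close>

lemma integral_min_divergence_le:
  fixes d :: "real^'n \<Rightarrow> real"
  assumes d: "continuous_on UNIV d" "\<And>x. 0 \<le> d x" and \<phi>: "C1_on UNIV \<phi>" "compact (closure {x. \<phi> x \<noteq> 0})"
    and s: "0 < s"
    and le: "\<And>r. 0 < r \<Longrightarrow> r \<le> s \<Longrightarrow> (\<integral>x. indicator {x. r < d x} x * divergence \<phi> x \<partial>lborel) \<le> C"
  shows "(\<integral>x. min (d x) s * divergence \<phi> x \<partial>lborel) \<le> C * s"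
proof -
  obtain R where R: "0 < R" "\<And>x. R < norm x \<Longrightarrow> \<phi> x = 0" using compact_support_bound[OF \<phi>(2)] by metis
  define g where "g = divergence \<phi>"
  have cg: "continuous_on UNIV g" unfolding g_def by (rule continuous_divergence[OF \<phi>(1)])
  have g0: "g x = 0" if "R < norm x" for x
    unfolding g_def using divergence_outside_support R(2) that by blast
  have ig: "integrable lborel g" by (rule integrable_continuous_compact_support[OF cg g0])
  have dB [measurable]: "d \<in> borel_measurable borel" using d(1) by (rule borel_measurable_continuous_onI)
  have ind: "integrable lborel (\<lambda>x. indicator {x. r < d x} x * g x)" for r
    using integrable_mult_indicator[OF _ ig, of "{x. r < d x}"] by simp
  have imin: "integrable lborel (\<lambda>x. min (d x) s * g x)"
    by (rule integrable_continuous_compact_support[where R = R]) (auto intro!: continuous_intros d cg simp: g0)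
  have step: "(\<integral>x. min (d x) s * g x \<partial>lborel) - C * s \<le> (s * (\<integral>x. \<bar>g x\<bar> \<partial>lborel)) / real (Suc k)" for k
  proof -
    define m where "m = Suc k"
    define e where "e = s / real m"
    have m: "0 < m" "0 < e" "real m * e = s" using s by (auto simp: m_def e_def)
    \<comment> \<open>The indicator of {d > r} decreases in \<open>r\<close>, so right endpoints
      give a lower sum, less than \<open>min (d x) s\<close> by at most one mesh width. These
      endpoints also stay in (0, s], where the hypothesis \<open>le\<close> is available.\<close>
    define W where "W x = (\<Sum>j<m. e * indicator {x. real (Suc j) * e < d x} x)" for x
    have tel: "min (d x) s = (\<Sum>j<m. min (d x) (real (Suc j) * e) - min (d x) (real j * e))" for x
      using sum_lessThan_telescope[of "\<lambda>j. min (d x) (real j * e)" m] d(2)[of x] m(3) by simp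
    have lower: "W x \<le> min (d x) s" for x
      unfolding tel W_def
      by (intro sum_mono) (use m(2) in \<open>auto simp: indicator_def algebra_simps min_def\<close>)
    have upper: "min (d x) s \<le> W x + e" for x
    proof -
      have "min (d x) s \<le> (\<Sum>j<m. e * indicator {x. real j * e < d x} x)"
        unfolding tel
        by (intro sum_mono) (use m(2) in \<open>auto simp: indicator_def algebra_simps min_def\<close>)
      also have "\<dots> = W x + (e * indicator {x. 0 < d x} x - e * indicator {x. real m * e < d x} x)"
        using sum_lessThan_telescope[of "\<lambda>j. e * indicator {x. real j * e < d x} x :: real" m]
        unfolding W_def sum_subtractf by simp
      also have "\<dots> \<le> W x + e"
        using m(2) by (auto simp: indicator_def)
      finally show ?thesis .
    qed
    have iW: "integrable lborel (\<lambda>x. W x * g x)"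
      unfolding W_def sum_distrib_right mult.assoc by (intro Bochner_Integration.integrable_sum integrable_mult_right ind)
    have "(\<integral>x. min (d x) s * g x \<partial>lborel) \<le> (\<integral>x. W x * g x + e * \<bar>g x\<bar> \<partial>lborel)"
    proof (rule integral_mono)
      show "integrable lborel (\<lambda>x. W x * g x + e * \<bar>g x\<bar>)" using iW ig by auto
      fix x
      have "(min (d x) s - W x) * g x \<le> e * \<bar>g x\<bar>"
        using lower[of x] upper[of x] by (smt (verit) abs_ge_self mult_mono abs_ge_zero mult_left_mono)
      then show "min (d x) s * g x \<le> W x * g x + e * \<bar>g x\<bar>" by (simp add: algebra_simps)
    qed (rule imin)
    also have "\<dots> = (\<integral>x. W x * g x \<partial>lborel) + e * (\<integral>x. \<bar>g x\<bar> \<partial>lborel)"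
      using iW ig by simp
    also have "(\<integral>x. W x * g x \<partial>lborel) = (\<Sum>j<m. e * (\<integral>x. indicator {x. real (Suc j) * e < d x} x * g x \<partial>lborel))"
      unfolding W_def sum_distrib_right mult.assoc
      using ind by (subst Bochner_Integration.integral_sum) (auto simp del: of_nat_Suc)
    also have "\<dots> \<le> (\<Sum>j<m. e * C)"
    proof (rule sum_mono)
      fix j assume j: "j \<in> {..<m}"
      then have "real (Suc j) * e \<le> real m * e" using m by (intro mult_right_mono) auto
      then show "e * (\<integral>x. indicator {x. real (Suc j) * e < d x} x * g x \<partial>lborel) \<le> e * C"
        using m le[of "real (Suc j) * e"] unfolding g_def by (auto intro!: mult_left_mono simp del: of_nat_Suc)
    qed
    also have "\<dots> = C * s" using m(3) by (simp add: mult.commute)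
    finally show ?thesis unfolding e_def m_def by simp
  qed
  have "(\<lambda>k. (s * (\<integral>x. \<bar>g x\<bar> \<partial>lborel)) / real (Suc k)) \<longlonglongrightarrow> 0"
    by (rule LIMSEQ_Suc[OF lim_const_over_n])
  then have "(\<integral>x. min (d x) s * g x \<partial>lborel) - C * s \<le> 0"
    by (rule tendsto_lowerbound) (use step in auto)
  then show ?thesis unfolding g_def by simp
qed

text \<open>A polynomial approximates \<open>q\<close> uniformly on the ball that carries the
  cutoff. Its norm may exceed 1 slightly, and dividing by 1 + \<epsilon> repairs this at the cost of
  another \<epsilon>; hence the choice \<epsilon> = e / 2.\<close>

lemma approximate_by_test_field:
  fixes q :: "real^'n \<Rightarrow> real^'n" and \<eta> :: "real^'n \<Rightarrow> real"
  assumes q: "continuous_on UNIV q" "\<And>x. norm (q x) \<le> 1"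
    and \<eta>: "C1_on UNIV \<eta>" "\<And>x. 0 \<le> \<eta> x" "\<And>x. \<eta> x \<le> 1" "\<And>x. R < norm x \<Longrightarrow> \<eta> x = 0" and e: "0 < e"
  obtains \<phi> where "test_field \<phi>" "\<And>x. norm (\<phi> x - \<eta> x *\<^sub>R q x) \<le> e" "\<And>x. R < norm x \<Longrightarrow> \<phi> x = 0"
proof -
  define \<epsilon> where "\<epsilon> = e / 2"
  have \<epsilon>: "0 < \<epsilon>" using e by (simp add: \<epsilon>_def)
  obtain P where P: "polynomial_function P" "\<And>x. x \<in> cball 0 R \<Longrightarrow> norm (q x - P x) < \<epsilon>"
    using Stone_Weierstrass_polynomial_function[OF compact_cball[of 0 R] continuous_on_subset[OF q(1) subset_UNIV] \<epsilon>]
    by auto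
  define \<phi> where "\<phi> x = \<eta> x *\<^sub>R (P x /\<^sub>R (1 + \<epsilon>))" for x
  have Pn: "norm (P x) \<le> 1 + \<epsilon>" if "norm x \<le> R" for x
  proof -
    have "norm (P x) \<le> norm (q x) + norm (q x - P x)"
      by (metis norm_minus_commute norm_triangle_sub)
    then show ?thesis using P(2)[of x] q(2)[of x] that by simp
  qed
  have supp: "\<phi> x = 0" if "R < norm x" for x using \<eta>(4)[OF that] by (simp add: \<phi>_def)
  show ?thesis
  proof (rule that)
    show "\<phi> x = 0" if "R < norm x" for x by (rule supp[OF that])
    show "norm (\<phi> x - \<eta> x *\<^sub>R q x) \<le> e" for x
    proof (cases "norm x \<le> R")
      case True
      have eq: "P x /\<^sub>R (1 + \<epsilon>) - q x = (P x - q x) - (\<epsilon> / (1 + \<epsilon>)) *\<^sub>R P x"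
        using \<epsilon> by (simp add: algebra_simps divide_simps) (simp add: scaleR_add_left[symmetric] divide_simps)
      have "norm (P x /\<^sub>R (1 + \<epsilon>) - q x) \<le> norm (P x - q x) + (\<epsilon> / (1 + \<epsilon>)) * norm (P x)"
        unfolding eq using norm_triangle_ineq4[of "P x - q x" "(\<epsilon> / (1 + \<epsilon>)) *\<^sub>R P x"] \<epsilon> by simp
      also have "\<dots> \<le> \<epsilon> + (\<epsilon> / (1 + \<epsilon>)) * (1 + \<epsilon>)"
        using P(2)[of x] Pn[OF True] True \<epsilon> by (intro add_mono mult_left_mono) (auto simp: norm_minus_commute)
      also have "\<dots> = \<epsilon> + \<epsilon>" using \<epsilon> by simp
      also have "\<dots> = e" by (simp add: \<epsilon>_def)
      finally have *: "norm (P x /\<^sub>R (1 + \<epsilon>) - q x) \<le> e" .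
      have "norm (\<phi> x - \<eta> x *\<^sub>R q x) = \<eta> x * norm (P x /\<^sub>R (1 + \<epsilon>) - q x)"
        unfolding \<phi>_def scaleR_diff_right[symmetric] using \<eta>(2) by simp
      also have "\<dots> \<le> 1 * e" using * \<eta>(2,3) by (intro mult_mono) auto
      finally show ?thesis by simp
    next
      case False
      then show ?thesis using supp[of x] \<eta>(4)[of x] e by simp
    qed
    have "C1_on UNIV \<phi>"
      unfolding \<phi>_def
      by (intro C1_on_scaleR \<eta>(1) C1_on_const C1_on_polynomial_function[OF P(1)])
    moreover have "compact (closure {x. \<phi> x \<noteq> 0})"
    proof -
      have "{x. \<phi> x \<noteq> 0} \<subseteq> cball 0 R" using supp by force
      then show ?thesis unfolding compact_closure by (rule bounded_subset[OF bounded_cball])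
    qed
    moreover have "norm (\<phi> x) \<le> 1" for x
    proof (cases "norm x \<le> R")
      case True
      have "norm (\<phi> x) = \<eta> x * (norm (P x) / (1 + \<epsilon>))"
        using \<epsilon> \<eta>(2) by (simp add: \<phi>_def divide_inverse mult.commute)
      also have "\<dots> \<le> 1 * 1" using Pn[OF True] \<epsilon> \<eta>(2,3) by (intro mult_mono) auto
      finally show ?thesis by simp
    qed (use supp in simp)
    ultimately show "test_field \<phi>" unfolding test_field_def by blast
  qed
qed

text \<open>Squaring the positive part removes its kink at 0: the derivative 2 max(0, t) is
  continuous.\<close>

lemma C1_cutoff:
  fixes k :: real
  assumes "0 < k"
  defines "\<eta> \<equiv> \<lambda>x::'a::real_inner. (max 0 (1 - (x \<bullet> x) / k\<^sup>2))\<^sup>2"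
  shows "C1_on UNIV \<eta>" "0 \<le> \<eta> x" "\<eta> x \<le> 1" "k < norm x \<Longrightarrow> \<eta> x = 0"
proof -
  have sq: "((\<lambda>t::real. (max 0 t)\<^sup>2) has_real_derivative 2 * max 0 t) (at t)" for t
  proof (cases "t = 0")
    case True
    have "((\<lambda>h::real. ((max 0 h)\<^sup>2) / h) \<longlongrightarrow> 0) (at 0)"
    proof (rule tendsto_rabs_zero_cancel, rule tendsto_sandwich[OF _ _ tendsto_const])
      show "\<forall>\<^sub>F h::real in at 0. 0 \<le> \<bar>(max 0 h)\<^sup>2 / h\<bar>" by simp
      have "\<bar>(max 0 h)\<^sup>2 / h\<bar> \<le> \<bar>h\<bar>" for h :: real
        by (cases "h > 0") (auto simp: power2_eq_square)
      then show "\<forall>\<^sub>F h::real in at 0. \<bar>(max 0 h)\<^sup>2 / h\<bar> \<le> \<bar>h\<bar>" by simp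
      show "((\<lambda>h::real. \<bar>h\<bar>) \<longlongrightarrow> 0) (at 0)" by (auto intro!: tendsto_eq_intros)
    qed
    then show ?thesis using True by (simp add: DERIV_def)
  next
    case False
    show ?thesis
    proof (cases "t > 0")
      case True
      have "((\<lambda>t::real. t\<^sup>2) has_real_derivative 2 * max 0 t) (at t)"
        using True by (auto intro!: derivative_eq_intros)
      then show ?thesis
        by (rule has_field_derivative_transform_within_open[of _ _ _ "{0<..}"]) (use True in auto)
    next
      case False': False
      have "((\<lambda>t::real. 0) has_real_derivative 2 * max 0 t) (at t)"
        using False' by (auto intro!: derivative_eq_intros)
      then show ?thesis
        by (rule has_field_derivative_transform_within_open[of _ _ _ "{..<0}"]) (use False False' in auto)
    qed
  qed
  have "C1_on UNIV (\<lambda>x::'a. 1 + (- 1 / k\<^sup>2) * (x \<bullet> x))"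
    by (intro C1_on_add C1_on_mult C1_on_const C1_on_bilinear[OF bounded_bilinear_inner]
        C1_on_bounded_linear bounded_linear_ident)
  then show "C1_on UNIV \<eta>"
    unfolding \<eta>_def
    by (intro C1_on_compose_real[where f = "\<lambda>t. (max 0 t)\<^sup>2", OF _ sq] continuous_intros) simp
  show "0 \<le> \<eta> x" "\<eta> x \<le> 1" unfolding \<eta>_def by (auto intro!: power_le_one)
  show "\<eta> x = 0" if "k < norm x"
  proof -
    have "k\<^sup>2 \<le> x \<bullet> x" using that assms(1) by (metis less_eq_real_def norm_ge_zero power2_norm_eq_inner power_mono)
    then show ?thesis unfolding \<eta>_def using assms(1) by (simp add: field_simps)
  qed
qed

lemma infdist_lipschitz: "\<bar>infdist x F - infdist (x + v) F\<bar> \<le> norm v"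
  for x :: "'a::real_normed_vector"
  using infdist_triangle_abs[of x F "x + v"] by (simp add: dist_norm)

text \<open>The ideal field is minus the gradient of d, times \<eta> \<theta>(d), but this gradient
  need not be continuous. Difference quotients of d are, and they converge to it wherever the
  nearest point is unique and d > 0, thus almost everywhere on the layer. There the gradient has
  length 1, so the limit of the integrands is \<eta> \<theta>(d) itself. The function \<theta>
  vanishes outside 0 < d < s, where the quotients are not controlled.\<close>

lemma cutoff_layer_integral_le:
  fixes F :: "(real^'n) set" and \<eta> :: "real^'n \<Rightarrow> real" and \<theta> :: "real \<Rightarrow> real"
  assumes F: "closed F" "F \<noteq> {}" and s: "0 < s"
    and le: "\<And>\<phi> r. test_field \<phi> \<Longrightarrow> 0 < r \<Longrightarrow> r \<le> s \<Longrightarrow>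
      (\<integral>x. indicator {x. r < infdist x F} x * divergence \<phi> x \<partial>lborel) \<le> C"
    and \<eta>: "C1_on UNIV \<eta>" "\<And>x. 0 \<le> \<eta> x" "\<And>x. \<eta> x \<le> 1" "\<And>x. R < norm x \<Longrightarrow> \<eta> x = 0"
    and \<theta>: "continuous_on UNIV \<theta>" "\<And>r. 0 \<le> \<theta> r" "\<And>r. \<theta> r \<le> 1" "\<And>r. r \<le> 0 \<or> s \<le> r \<Longrightarrow> \<theta> r = 0"
  shows "(\<integral>x. \<eta> x * \<theta> (infdist x F) \<partial>lborel) \<le> C * s"
proof -
  define d where "d x = infdist x F" for x
  define w where "w x = min (d x) s" for x
  define a where "a i = (axis i 1 :: real^'n)" for i
  define hn where "hn n = 1 / real (Suc n)" for n
  have hn: "hn \<longlonglongrightarrow> 0" "0 < hn n" "hn n \<le> 1" for n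
    unfolding hn_def by (rule lim_1_over_n[THEN LIMSEQ_Suc], auto)
  have dl: "\<bar>d x - d (x + v)\<bar> \<le> norm v" for x v
    unfolding d_def by (rule infdist_lipschitz)
  have cd: "continuous_on UNIV d" unfolding d_def by (intro continuous_intros)
  note dc = continuous_on_compose2[OF cd]
  have d0: "0 \<le> d x" for x unfolding d_def by (rule infdist_nonneg)
  have cw: "continuous_on UNIV w" unfolding w_def by (intro continuous_intros cd)
  note wc = continuous_on_compose2[OF cw]
  have wl: "\<bar>w x - w (x + v)\<bar> \<le> norm v" for x v
    using dl[of x v] unfolding w_def by (auto simp: min_def)
  define v where "v n x = (\<chi> i. (d (x + hn n *\<^sub>R a i) - d x) / hn n)" for n x
  \<comment> \<open>The vector of quotients may be longer than 1. The divisor enforces the norm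
    bound and tends to 1 at the points of the layer that count, since the limiting gradient is a
    unit vector.\<close>
  define q where "q n x = (- \<theta> (d x) / max 1 (norm (v n x))) *\<^sub>R v n x" for n x
  have cv: "continuous_on UNIV (v n)" for n
    unfolding v_def by (intro continuous_intros dc) (use hn(2)[of n] in auto)
  have cq: "continuous_on UNIV (q n)" for n
    unfolding q_def by (intro continuous_intros cv continuous_on_compose2[OF \<theta>(1)] cd) auto
  have nq: "norm (q n x) \<le> 1" for n x
  proof -
    have "norm (q n x) = \<theta> (d x) * (norm (v n x) / max 1 (norm (v n x)))"
      unfolding q_def using \<theta>(2) by simp
    also have "\<dots> \<le> 1 * 1" by (intro mult_mono \<theta>) (auto simp: divide_simps)
    finally show ?thesis by simp
  qed
  have "\<exists>\<phi>. test_field \<phi> \<and> (\<forall>x. norm (\<phi> x - \<eta> x *\<^sub>R q n x) \<le> hn n) \<and> (\<forall>x. R < norm x \<longrightarrow> \<phi> x = 0)" for n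
    using approximate_by_test_field[OF cq nq \<eta> hn(2)] by metis
  then obtain \<phi> where \<phi>: "test_field (\<phi> n)" "norm (\<phi> n x - \<eta> x *\<^sub>R q n x) \<le> hn n"
    "R < norm x \<Longrightarrow> \<phi> n x = 0" for n x by metis
  have \<phi>1: "C1_on UNIV (\<phi> n)" "compact (closure {x. \<phi> n x \<noteq> 0})" "norm (\<phi> n x) \<le> 1" for n x
    using \<phi>(1)[of n] unfolding test_field_def by auto
  have c\<phi>: "continuous_on UNIV (\<phi> n)" for n using \<phi>1(1) by (rule C1_on_imp_continuous_on)
  \<comment> \<open>A second step size, for the quotients of \<open>w\<close>, is chosen after the
    field \<open>\<phi> n\<close> is fixed; a single limit in \<open>n\<close> then serves both
    approximations.\<close>
  have "\<exists>t. 0 < t \<and> t \<le> hn n \<and>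
    (\<integral>x. (\<Sum>i\<in>UNIV. \<phi> n x $ i * ((w x - w (x + t *\<^sub>R a i)) / t)) \<partial>lborel) < C * s + hn n" for n
  proof -
    have "(\<integral>x. w x * divergence (\<phi> n) x \<partial>lborel) \<le> C * s"
      unfolding w_def d_def
    proof (rule integral_min_divergence_le[OF _ _ \<phi>1(1,2) s])
      show "(\<integral>x. indicator {x. r < infdist x F} x * divergence (\<phi> n) x \<partial>lborel) \<le> C" if "0 < r" "r \<le> s" for r
        by (rule le[OF \<phi>(1) that])
    qed (auto intro!: continuous_intros infdist_nonneg)
    then have "(\<integral>x. w x * divergence (\<phi> n) x \<partial>lborel) < C * s + hn n" using hn(2)[of n] by simp
    from order_tendstoD(2)[OF divergence_integral_limit[OF \<phi>1(1,2) cw hn] this]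
    have "\<forall>\<^sub>F m in sequentially. (\<integral>x. (\<Sum>i\<in>UNIV. \<phi> n x $ i * ((w x - w (x + hn m *\<^sub>R a i)) / hn m)) \<partial>lborel) < C * s + hn n"
      unfolding a_def .
    moreover have "\<forall>\<^sub>F m in sequentially. hn m < hn n"
      using order_tendstoD(2)[OF hn(1) hn(2)] .
    ultimately have "\<forall>\<^sub>F m in sequentially. hn m < hn n \<and> (\<integral>x. (\<Sum>i\<in>UNIV. \<phi> n x $ i * ((w x - w (x + hn m *\<^sub>R a i)) / hn m)) \<partial>lborel) < C * s + hn n"
      by eventually_elim auto
    then obtain m where "hn m < hn n" "(\<integral>x. (\<Sum>i\<in>UNIV. \<phi> n x $ i * ((w x - w (x + hn m *\<^sub>R a i)) / hn m)) \<partial>lborel) < C * s + hn n"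
      using eventually_happens'[OF sequentially_bot] by blast
    then show ?thesis using hn(2) by (intro exI[of _ "hn m"]) auto
  qed
  then have "\<forall>n. \<exists>t. 0 < t \<and> t \<le> hn n \<and>
    (\<integral>x. (\<Sum>i\<in>UNIV. \<phi> n x $ i * ((w x - w (x + t *\<^sub>R a i)) / t)) \<partial>lborel) < C * s + hn n" ..
  from choice[OF this] obtain t where t_all: "\<forall>n. 0 < t n \<and> t n \<le> hn n \<and>
    (\<integral>x. (\<Sum>i\<in>UNIV. \<phi> n x $ i * ((w x - w (x + t n *\<^sub>R a i)) / t n)) \<partial>lborel) < C * s + hn n" ..
  have t: "0 < t n" "t n \<le> hn n"
    "(\<integral>x. (\<Sum>i\<in>UNIV. \<phi> n x $ i * ((w x - w (x + t n *\<^sub>R a i)) / t n)) \<partial>lborel) < C * s + hn n" for n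
    using t_all by auto
  have t0: "t \<longlonglongrightarrow> 0"
    by (rule tendsto_sandwich[OF _ _ tendsto_const hn(1)]) (use t in \<open>auto simp: less_imp_le\<close>)
  have tne: "t n \<noteq> 0" for n using t(1)[of n] by simp
  define g where "g n x = (\<Sum>i\<in>UNIV. \<phi> n x $ i * ((w x - w (x + t n *\<^sub>R a i)) / t n))" for n x
  have quot: "\<bar>(w x - w (x + t n *\<^sub>R a i)) / t n\<bar> \<le> 1" for x n i
    using wl[of x "t n *\<^sub>R a i"] t(1)[of n] by (simp add: a_def)
  have g_le: "\<bar>g n x\<bar> \<le> real CARD('n) * norm (\<phi> n x)" for n x
  proof -
    have "\<bar>g n x\<bar> \<le> (\<Sum>i\<in>(UNIV::'n set). norm (\<phi> n x) * 1)"
      unfolding g_def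
      by (rule order_trans[OF sum_abs], intro sum_mono, unfold abs_mult, intro mult_mono quot component_le_norm_cart) auto
    then show ?thesis by simp
  qed
  have cg: "continuous_on UNIV (g n)" for n
    unfolding g_def by (intro continuous_intros c\<phi> cw wc) (auto simp: tne)
  have "(\<lambda>n. \<integral>x. g n x \<partial>lborel) \<longlonglongrightarrow> (\<integral>x. \<eta> x * \<theta> (d x) \<partial>lborel)"
  proof (rule integral_dominated_convergence)
    show "(\<lambda>x. \<eta> x * \<theta> (d x)) \<in> borel_measurable lborel"
      by (simp, intro borel_measurable_continuous_onI continuous_intros C1_on_imp_continuous_on \<eta>
          continuous_on_compose2[OF \<theta>(1)] cd) auto
    show "g n \<in> borel_measurable lborel" for n
      using cg by (simp add: borel_measurable_continuous_onI)
    show "integrable lborel (\<lambda>x. real CARD('n) * indicator (cball (0::real^'n) R) x)"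
      by (intro integrable_mult_right integrable_real_indicator)
        (use emeasure_bounded_finite[OF bounded_cball, of "0::real^'n" R] in auto)
    show "AE x in lborel. norm (g n x) \<le> real CARD('n) * indicator (cball 0 R) x" for n
    proof (rule AE_I2)
      fix x show "norm (g n x) \<le> real CARD('n) * indicator (cball 0 R) x"
        using order_trans[OF g_le[of n x] mult_left_mono[OF \<phi>1(3)[of n x], of "real CARD('n)"]] \<phi>(3)[of x n]
        by (cases "norm x \<le> R") (auto simp: g_def)
    qed
    let ?N = "{x. \<exists>y\<in>F. \<exists>z\<in>F. y \<noteq> z \<and> dist x y = infdist x F \<and> dist x z = infdist x F}"
    have "AE x in lebesgue. x \<notin> ?N"
      using negligible_nonunique_nearest[OF F(1)] unfolding negligible_iff_null_sets by (rule AE_not_in)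
    then have "AE x in lborel. x \<notin> ?N" by (simp only: AE_completion_iff)
    then show "AE x in lborel. (\<lambda>n. g n x) \<longlonglongrightarrow> \<eta> x * \<theta> (d x)"
    proof eventually_elim
      case (elim x)
      show ?case
      proof (cases "\<eta> x = 0 \<or> \<theta> (d x) = 0")
        \<comment> \<open>Here the quotients of d may fail to converge. It is enough that those of
          \<open>w\<close> are bounded by 1 while the field itself tends to 0.\<close>
        case True
        then have z: "\<eta> x *\<^sub>R q n x = 0" for n unfolding q_def by auto
        have "norm (\<phi> n x) \<le> hn n" for n using \<phi>(2)[of n x] unfolding z by simp
        then have gb: "\<bar>g n x\<bar> \<le> real CARD('n) * hn n" for n
          using order_trans[OF g_le[of n x] mult_left_mono] by simp
        have "(\<lambda>n. g n x) \<longlonglongrightarrow> 0"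
        proof (rule tendsto_rabs_zero_cancel, rule tendsto_sandwich[OF _ _ tendsto_const])
          show "(\<lambda>n. real CARD('n) * hn n) \<longlonglongrightarrow> 0" using tendsto_mult_right_zero[OF hn(1)] by simp
        qed (use gb in auto)
        then show ?thesis using True by auto
      next
        case False
        then have dx: "0 < d x" "d x < s" using \<theta>(4)[of "d x"] by force+
        obtain y where y: "y \<in> F" "infdist x F = dist x y" using infdist_attains[OF F] .
        define u where "u = (x - y) /\<^sub>R d x"
        have nu: "norm u = 1" using y dx by (simp add: u_def d_def dist_norm)
        have lim: "(\<lambda>n. (d (x + h n *\<^sub>R a i) - d x) / h n) \<longlonglongrightarrow> u $ i"
          if "h \<longlonglongrightarrow> 0" "\<And>n. 0 < h n" for h i
          using infdist_directional_derivative[OF F(1) y(1) y(2)[symmetric] _ _ that, of "a i"] elim y dx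
          by (auto simp: d_def u_def a_def inner_axis')
        have vu: "(\<lambda>n. v n x) \<longlonglongrightarrow> u"
          unfolding v_def by (rule vec_tendstoI) (simp add: lim[OF hn(1,2)])
        have "(\<lambda>n. q n x) \<longlonglongrightarrow> (- \<theta> (d x) / max 1 (norm u)) *\<^sub>R u"
          unfolding q_def by (intro tendsto_intros vu) auto
        then have qu: "(\<lambda>n. \<eta> x *\<^sub>R q n x) \<longlonglongrightarrow> \<eta> x *\<^sub>R (- \<theta> (d x)) *\<^sub>R u"
          using nu by (intro tendsto_intros) simp
        have "(\<lambda>n. \<phi> n x - \<eta> x *\<^sub>R q n x) \<longlonglongrightarrow> 0"
          by (rule Lim_null_comparison[OF _ hn(1)]) (use \<phi>(2) in auto)
        from tendsto_add[OF this qu]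
        have \<phi>u: "(\<lambda>n. \<phi> n x) \<longlonglongrightarrow> \<eta> x *\<^sub>R (- \<theta> (d x)) *\<^sub>R u" by simp
        \<comment> \<open>Since d(x) < s, the truncation in \<open>w\<close> is inactive at
          \<open>x\<close> and, for small steps, at the displaced points.\<close>
        have wu: "(\<lambda>n. (w x - w (x + t n *\<^sub>R a i)) / t n) \<longlonglongrightarrow> - u $ i" for i
        proof (rule Lim_transform_eventually[OF tendsto_minus[OF lim[OF t0 t(1)]]])
          have "\<forall>\<^sub>F n in sequentially. t n < s - d x"
            using order_tendstoD(2)[OF t0] dx by simp
          then show "\<forall>\<^sub>F n in sequentially. - ((d (x + t n *\<^sub>R a i) - d x) / t n) = (w x - w (x + t n *\<^sub>R a i)) / t n"
          proof eventually_elim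
            case (elim n)
            then have "d (x + t n *\<^sub>R a i) < s"
              using dl[of x "t n *\<^sub>R a i"] t(1)[of n] by (simp add: a_def)
            then show ?case using dx by (simp add: w_def minus_divide_left)
          qed
        qed
        have "(\<lambda>n. g n x) \<longlonglongrightarrow> (\<Sum>i\<in>UNIV. (\<eta> x *\<^sub>R (- \<theta> (d x)) *\<^sub>R u) $ i * (- u $ i))"
          unfolding g_def by (intro tendsto_sum tendsto_mult wu tendsto_vec_nth \<phi>u)
        also have "(\<Sum>i\<in>UNIV. (\<eta> x *\<^sub>R (- \<theta> (d x)) *\<^sub>R u) $ i * (- u $ i)) = \<eta> x * \<theta> (d x) * (u \<bullet> u)"
          by (simp add: inner_vec_def sum_distrib_left mult_ac)
        finally show ?thesis using nu by (simp add: power2_norm_eq_inner[symmetric])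
      qed
    qed
  qed
  moreover have "(\<lambda>n. C * s + hn n) \<longlonglongrightarrow> C * s + 0" by (intro tendsto_intros hn)
  ultimately have "(\<integral>x. \<eta> x * \<theta> (d x) \<partial>lborel) \<le> C * s + 0"
    by (rule LIMSEQ_le) (use t(3) in \<open>auto simp: g_def less_imp_le\<close>)
  then show ?thesis unfolding d_def by simp
qed

text \<open>Cutoffs in space and in the distance tend to 1 at every point of the layer; Fatou's
  lemma carries the uniform bound to the limit.\<close>

lemma emeasure_layer_le:
  fixes F :: "(real^'n) set"
  assumes F: "closed F" "F \<noteq> {}" and s: "0 < s"
    and le: "\<And>\<phi> r. test_field \<phi> \<Longrightarrow> 0 < r \<Longrightarrow> r \<le> s \<Longrightarrow>
      (\<integral>x. indicator {x. r < infdist x F} x * divergence \<phi> x \<partial>lborel) \<le> C"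
  shows "emeasure lborel {x. 0 < infdist x F \<and> infdist x F < s} \<le> ennreal (C * s)"
proof -
  let ?L = "{x. 0 < infdist x F \<and> infdist x F < s}"
  define \<eta> where "\<eta> k x = (max 0 (1 - (x \<bullet> x) / (real (Suc k))\<^sup>2))\<^sup>2" for k and x :: "real^'n"
  define \<theta> where "\<theta> k r = min 1 (real k * max 0 (min r (s - r)))" for k r
  have \<eta>: "C1_on UNIV (\<eta> k)" "0 \<le> \<eta> k x" "\<eta> k x \<le> 1" "real (Suc k) < norm x \<Longrightarrow> \<eta> k x = 0" for k x
    unfolding \<eta>_def by (rule C1_cutoff; simp)+
  have \<theta>: "continuous_on UNIV (\<theta> k)" "0 \<le> \<theta> k r" "\<theta> k r \<le> 1" "r \<le> 0 \<or> s \<le> r \<Longrightarrow> \<theta> k r = 0" for k r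
    unfolding \<theta>_def by (auto intro!: continuous_intros)
  define G where "G k x = \<eta> k x * \<theta> k (infdist x F)" for k x
  have cG: "continuous_on UNIV (G k)" for k
    unfolding G_def by (intro continuous_intros C1_on_imp_continuous_on \<eta> continuous_on_compose2[OF \<theta>(1)]) auto
  have G0: "0 \<le> G k x" for k x unfolding G_def using \<eta> \<theta> by simp
  have iG: "integrable lborel (G k)" for k
    by (rule integrable_continuous_compact_support[OF cG, of "real (Suc k)"]) (simp add: G_def \<eta>)
  have Gle: "(\<integral>\<^sup>+x. ennreal (G k x) \<partial>lborel) \<le> ennreal (C * s)" for k
  proof -
    have "(\<integral>x. G k x \<partial>lborel) \<le> C * s"
      unfolding G_def
      by (rule cutoff_layer_integral_le[OF F s _ \<eta> \<theta>]) (rule le)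
    then show ?thesis
      by (subst nn_integral_eq_integral[OF iG]) (auto simp: G0 ennreal_leI)
  qed
  have lim: "(\<lambda>k. ennreal (G k x)) \<longlonglongrightarrow> 1" if "x \<in> ?L" for x
  proof -
    have "(\<lambda>k. 1 / real (Suc k)) \<longlonglongrightarrow> 0" by (rule lim_1_over_n[THEN LIMSEQ_Suc])
    then have "(\<lambda>k. (max 0 (1 - (x \<bullet> x) * (1 / real (Suc k))\<^sup>2))\<^sup>2) \<longlonglongrightarrow> (max 0 (1 - (x \<bullet> x) * 0\<^sup>2))\<^sup>2"
      by (intro tendsto_intros)
    then have \<eta>l: "(\<lambda>k. \<eta> k x) \<longlonglongrightarrow> 1" unfolding \<eta>_def by (simp add: power_divide)
    define m where "m = min (infdist x F) (s - infdist x F)"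
    have m: "0 < m" using that unfolding m_def by auto
    obtain K where K: "1 < real K * m" using m reals_Archimedean3 by blast
    have "\<forall>\<^sub>F k in sequentially. \<theta> k (infdist x F) = 1"
      using eventually_ge_at_top[of K]
    proof eventually_elim
      case (elim k)
      then have "real K * m \<le> real k * m" using m by (intro mult_right_mono) auto
      then have "1 \<le> real k * m" using K by linarith
      then show ?case using m unfolding \<theta>_def m_def[symmetric] by simp
    qed
    then have "(\<lambda>k. \<theta> k (infdist x F)) \<longlonglongrightarrow> 1" by (rule tendsto_eventually)
    from tendsto_mult[OF \<eta>l this] show ?thesis unfolding G_def by (intro tendsto_ennrealI[where x = 1, simplified]) simp
  qed
  have [measurable]: "(\<lambda>x. infdist x F) \<in> borel_measurable borel"
    by (intro borel_measurable_continuous_onI continuous_intros)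
  have LB: "?L \<in> sets borel" by measurable
  have "emeasure lborel ?L = (\<integral>\<^sup>+x. indicator ?L x \<partial>lborel)" using LB by simp
  also have "\<dots> \<le> (\<integral>\<^sup>+x. liminf (\<lambda>k. ennreal (G k x)) \<partial>lborel)"
  proof (rule nn_integral_mono)
    fix x
    show "indicator ?L x \<le> liminf (\<lambda>k. ennreal (G k x))"
      using lim_imp_Liminf[OF sequentially_bot lim[of x]] by (cases "x \<in> ?L") auto
  qed
  also have "\<dots> \<le> liminf (\<lambda>k. \<integral>\<^sup>+x. ennreal (G k x) \<partial>lborel)"
    by (rule nn_integral_liminf) (use iG in auto)
  also have "\<dots> \<le> liminf (\<lambda>k. ennreal (C * s))" by (intro Liminf_mono always_eventually allI Gle)
  also have "\<dots> = ennreal (C * s)" by (simp add: Liminf_const)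
  finally show ?thesis .
qed

section \<open>Perimeter bounds and the measure of layers\<close>

lemma test_field_divergence_integrable:
  assumes "test_field \<phi>"
  shows "integrable lborel (divergence \<phi>)"
proof -
  have \<phi>: "C1_on UNIV \<phi>" "compact (closure {x. \<phi> x \<noteq> 0})" using assms unfolding test_field_def by auto
  obtain R where R: "\<And>x. R < norm x \<Longrightarrow> \<phi> x = 0" using compact_support_bound[OF \<phi>(2)] by metis
  show ?thesis
    by (rule integrable_continuous_compact_support[OF continuous_divergence[OF \<phi>(1)]])
      (rule divergence_outside_support[OF R])
qed

lemma set_integral_divergence_eq:
  assumes "test_field \<phi>" "A \<in> sets borel"
  shows "set_lebesgue_integral lebesgue A (divergence \<phi>) = (\<integral>x. indicator A x * divergence \<phi> x \<partial>lborel)"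
proof -
  have "divergence \<phi> \<in> borel_measurable borel"
    using test_field_divergence_integrable[OF assms(1)] by auto
  then show ?thesis
    unfolding set_lebesgue_integral_def using assms(2) by (subst integral_completion) auto
qed

lemma integral_divergence_le_perimeter:
  assumes "test_field \<phi>" "A \<in> sets borel" "perimeter A \<le> ereal C"
  shows "(\<integral>x. indicator A x * divergence \<phi> x \<partial>lborel) \<le> C"
proof -
  have "ereal (set_lebesgue_integral lebesgue A (divergence \<phi>)) \<le> perimeter A"
    unfolding perimeter_def using assms(1) unfolding test_field_def by (intro SUP_upper) auto
  then show ?thesis
    using assms(3) unfolding set_integral_divergence_eq[OF assms(1,2)] by (metis ereal_less_eq(3) order_trans)
qed

lemma test_field_zero: "test_field (\<lambda>x. 0)"
  unfolding test_field_def using C1_on_const by auto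

lemma perimeter_nonneg: "0 \<le> perimeter (A :: (real^'n) set)"
proof -
  have "divergence (\<lambda>x::real^'n. 0) x = 0" for x
    using divergence_eq[of "\<lambda>x. 0" "\<lambda>x. 0" x] by simp
  then have "ereal (set_lebesgue_integral lebesgue A (divergence (\<lambda>x. 0))) = 0"
    by (simp add: set_lebesgue_integral_def zero_ereal_def)
  moreover have "ereal (set_lebesgue_integral lebesgue A (divergence (\<lambda>x. 0))) \<le> perimeter A"
    unfolding perimeter_def using test_field_zero unfolding test_field_def by (intro SUP_upper) auto
  ultimately show ?thesis by (simp add: zero_ereal_def)
qed

lemma test_field_uminus: "test_field \<phi> \<Longrightarrow> test_field (\<lambda>x. - \<phi> x)"
  unfolding test_field_def using C1_on_scaleR[OF C1_on_const[of UNIV "-1"], of \<phi>] by simp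

lemma divergence_uminus:
  assumes "test_field \<phi>"
  shows "divergence (\<lambda>x. - \<phi> x) x = - divergence \<phi> x"
proof -
  obtain D where "(\<phi> has_derivative blinfun_apply D) (at x)"
    using assms unfolding test_field_def C1_on_def by blast
  then show ?thesis
    using divergence_eq[OF has_derivative_minus] divergence_eq by (fastforce simp: sum_negf)
qed

text \<open>Integration by parts against the constant weight 1, whose difference quotients
  vanish.\<close>

lemma integral_divergence_eq_0:
  assumes "test_field \<phi>"
  shows "(\<integral>x. divergence \<phi> x \<partial>lborel) = 0"
proof -
  have \<phi>: "C1_on UNIV \<phi>" "compact (closure {x. \<phi> x \<noteq> 0})" using assms unfolding test_field_def by auto
  have "(\<lambda>n. 0 :: real) \<longlonglongrightarrow> (\<integral>x. 1 * divergence \<phi> x \<partial>lborel)"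
    using divergence_integral_limit[OF \<phi>, of "\<lambda>x. 1" "\<lambda>n. 1 / real (Suc n)"]
      lim_1_over_n[THEN LIMSEQ_Suc] by simp
  from LIMSEQ_unique[OF this tendsto_const] show ?thesis by simp
qed

text \<open>The divergence has total integral 0, so passing to the complement only changes the sign,
  which the field \<open>- \<phi>\<close> absorbs. It is used for E, where the perimeter bound
  concerns complements of erosions.\<close>

lemma integral_divergence_le_perimeter_compl:
  assumes "test_field \<phi>" "A \<in> sets borel" "perimeter (- A) \<le> ereal C"
  shows "(\<integral>x. indicator A x * divergence \<phi> x \<partial>lborel) \<le> C"
proof -
  have int: "integrable lborel (\<lambda>x. indicator B x * divergence \<phi> x)" if "B \<in> sets borel" for B
    using integrable_mult_indicator[OF _ test_field_divergence_integrable[OF assms(1)], of B] that by simp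
  have "- A \<in> sets borel" using assms(2) by auto
  have "(\<integral>x. indicator (- A) x * divergence \<phi> x \<partial>lborel) + (\<integral>x. indicator A x * divergence \<phi> x \<partial>lborel)
     = (\<integral>x. indicator (- A) x * divergence \<phi> x + indicator A x * divergence \<phi> x \<partial>lborel)"
    using int assms(2) by (intro Bochner_Integration.integral_add[symmetric]) auto
  also have "\<dots> = (\<integral>x. divergence \<phi> x \<partial>lborel)"
    by (intro Bochner_Integration.integral_cong) (auto simp: indicator_def)
  also have "\<dots> = 0" by (rule integral_divergence_eq_0[OF assms(1)])
  finally have "(\<integral>x. indicator A x * divergence \<phi> x \<partial>lborel) = - (\<integral>x. indicator (- A) x * divergence \<phi> x \<partial>lborel)"
    by simp
  also have "\<dots> = (\<integral>x. indicator (- A) x * divergence (\<lambda>x. - \<phi> x) x \<partial>lborel)"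
    using divergence_uminus[OF assms(1)] by simp
  also have "\<dots> \<le> C"
    by (rule integral_divergence_le_perimeter[OF test_field_uminus[OF assms(1)] _ assms(3)]) (use assms(2) in auto)
  finally show ?thesis .
qed

text \<open>The removed set is {0 < d \<le> \<rho>}, with a non-strict upper bound; enclosing it in
  the open layer of width 2 \<rho> costs the factor 2. The alternative in \<open>per\<close> lets
  one statement serve D and E.\<close>

lemma emeasure_erosion_layer_le:
  fixes U :: "(real^'n) set"
  assumes U: "open U" and \<rho>: "0 \<le> \<rho>" "2 * \<rho> \<le> s"
    and per: "\<And>r. 0 < r \<Longrightarrow> r \<le> s \<Longrightarrow> perimeter (erosion U r) \<le> ereal C \<or> perimeter (- erosion U r) \<le> ereal C"
  shows "emeasure lborel (U - erosion U \<rho>) \<le> ennreal (C * (2 * \<rho>))"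
proof (cases "\<rho> = 0 \<or> - U = {}")
  case True
  then consider "\<rho> = 0" | "U = UNIV" by blast
  then have "U - erosion U \<rho> = {}" by cases (simp_all add: erosion_0[OF U])
  then show ?thesis by (simp only: emeasure_empty zero_le)
next
  case False
  then have F: "closed (- U)" "- U \<noteq> {}" and \<rho>: "0 < 2 * \<rho>" using U \<rho> by auto
  note er = erosion_eq_infdist[OF F(2)]
  have "x \<in> U \<Longrightarrow> 0 < infdist x (- U)" for x
    using infdist_pos_not_in_closed[OF F(1,2)] by simp
  then have "U - erosion U \<rho> \<subseteq> {x. 0 < infdist x (- U) \<and> infdist x (- U) < 2 * \<rho>}"
    unfolding er using \<rho> by force
  moreover have "{x. 0 < infdist x (- U) \<and> infdist x (- U) < 2 * \<rho>} \<in> sets lborel"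
  proof -
    have [measurable]: "(\<lambda>x. infdist x (- U)) \<in> borel_measurable borel"
      by (intro borel_measurable_continuous_onI continuous_intros)
    show ?thesis by measurable
  qed
  ultimately have "emeasure lborel (U - erosion U \<rho>) \<le> emeasure lborel {x. 0 < infdist x (- U) \<and> infdist x (- U) < 2 * \<rho>}"
    by (rule emeasure_mono)
  also have "\<dots> \<le> ennreal (C * (2 * \<rho>))"
  proof (rule emeasure_layer_le[OF F \<rho>])
    fix \<phi> :: "real^'n \<Rightarrow> real^'n" and r assume "test_field \<phi>" "0 < r" "r \<le> 2 * \<rho>"
    then show "(\<integral>x. indicator {x. r < infdist x (- U)} x * divergence \<phi> x \<partial>lborel) \<le> C"
      unfolding er[symmetric] using per[of r] assms(3)
        integral_divergence_le_perimeter[of \<phi> "erosion U r" C] integral_divergence_le_perimeter_compl[of \<phi> "erosion U r" C]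
      by (auto simp: borel_open)
  qed
  finally show ?thesis .
qed

section \<open>The weighted measure \<open>mu\<close> of layers\<close>

lemma A3_set_integrable:
  assumes "A3 \<Theta> mu" "A \<in> sets lebesgue"
  shows "set_integrable lebesgue A \<Theta>"
  using assms unfolding A3_def set_integrable_def by (intro integrable_mult_indicator) auto

lemma A3_Un_disjoint:
  assumes "A3 \<Theta> mu" "A \<in> sets lebesgue" "B \<in> sets lebesgue" "A \<inter> B = {}"
  shows "mu (A \<union> B) = mu A + mu B"
  using assms set_integral_Un[OF assms(4) A3_set_integrable[OF assms(1,2)] A3_set_integrable[OF assms(1,3)]]
  unfolding A3_def by auto

lemma A3_nonneg:
  assumes "A3 \<Theta> mu" "A \<in> sets lebesgue"
  shows "0 \<le> mu A"
proof -
  have "mu A = (\<integral>x. indicator A x *\<^sub>R \<Theta> x \<partial>lebesgue)"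
    using assms unfolding A3_def set_lebesgue_integral_def by auto
  also have "0 \<le> \<dots>" using assms unfolding A3_def by (intro Bochner_Integration.integral_nonneg) (auto simp: less_imp_le)
  finally show ?thesis .
qed

lemma A3_Diff:
  assumes "A3 \<Theta> mu" "A \<in> sets lebesgue" "B \<in> sets lebesgue" "A \<subseteq> B"
  shows "mu (B - A) = mu B - mu A"
  using A3_Un_disjoint[of \<Theta> mu A "B - A"] assms by (auto simp: Un_absorb1)

lemma A3_mono:
  assumes "A3 \<Theta> mu" "A \<in> sets lebesgue" "B \<in> sets lebesgue" "A \<subseteq> B"
  shows "mu A \<le> mu B"
  using A3_Diff[OF assms] A3_nonneg[OF assms(1), of "B - A"] assms by auto

lemma A3_Compl:
  assumes "A3 \<Theta> mu" "A \<in> sets lebesgue"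
  shows "mu (- A) = mu UNIV - mu A"
  using A3_Diff[OF assms, of UNIV] by (simp add: Compl_eq_Diff_UNIV)

lemma A3_bounded_le:
  assumes "A3 \<Theta> mu" "A \<in> sets lebesgue" "\<And>x. \<Theta> x \<le> B" "emeasure lebesgue A \<le> ennreal c" "0 \<le> c"
  shows "mu A \<le> B * c"
proof -
  have B: "0 \<le> B" using assms(1,3) unfolding A3_def by (meson less_imp_le order_trans)
  have Am: "emeasure lebesgue A < \<infinity>" using assms(4) by (metis ennreal_less_top infinity_ennreal_def le_less_trans)
  have "mu A = (\<integral>x. indicator A x *\<^sub>R \<Theta> x \<partial>lebesgue)"
    using assms unfolding A3_def set_lebesgue_integral_def by auto
  also have "\<dots> \<le> (\<integral>x. B * indicator A x \<partial>lebesgue)"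
  proof (rule integral_mono)
    show "integrable lebesgue (\<lambda>x. indicator A x *\<^sub>R \<Theta> x)"
      using A3_set_integrable[OF assms(1,2)] unfolding set_integrable_def .
    show "integrable lebesgue (\<lambda>x. B * indicator A x)"
      using assms(2) Am by (intro integrable_mult_right integrable_real_indicator) auto
  qed (auto simp: indicator_def assms(3))
  also have "\<dots> = B * measure lebesgue A" using assms(2) by simp
  also have "\<dots> \<le> B * c"
    using B assms(4,5) Am by (intro mult_left_mono) (auto simp: measure_def enn2real_leI)
  finally show ?thesis .
qed

lemma A3_erosion_layer:
  fixes U :: "(real^'n) set"
  assumes "A3 \<Theta> mu" "\<And>x. \<Theta> x \<le> B" "0 \<le> C" and U: "open U" and \<rho>: "0 \<le> \<rho>" "2 * \<rho> \<le> s"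
    and per: "\<And>r. 0 < r \<Longrightarrow> r \<le> s \<Longrightarrow> perimeter (erosion U r) \<le> ereal C \<or> perimeter (- erosion U r) \<le> ereal C"
  shows "mu U - mu (erosion U \<rho>) \<le> (2 * B * C) * \<rho>"
proof -
  have m: "U \<in> sets lebesgue" "erosion U \<rho> \<in> sets lebesgue" using U by (auto simp: borel_open)
  have "mu (U - erosion U \<rho>) \<le> B * (C * (2 * \<rho>))"
    using emeasure_erosion_layer_le[OF U \<rho> per] assms m U
    by (intro A3_bounded_le[OF assms(1)]) (auto simp: borel_open)
  then show ?thesis
    unfolding A3_Diff[OF assms(1) m(2,1) erosion_subset[OF \<rho>(1)]] by (simp add: mult_ac)
qed

text \<open>If the increment were too small, subtracting a suitable linear function would leave a
  Lipschitz \<open>k\<close> with \<open>k b < k a\<close> but positive derivative almost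
  everywhere. Such a \<open>k\<close> maps the exceptional null set to a null set, so some value
  between \<open>k b\<close> and \<open>k a\<close> is not taken there. At the last time this value
  is reached, \<open>k\<close> cannot have a positive derivative.\<close>

lemma lipschitz_derivative_ge_AE:
  fixes g :: "real \<Rightarrow> real"
  assumes lip: "L-lipschitz_on {a..b} g" and ab: "a \<le> b"
    and der: "AE t in lebesgue. a < t \<longrightarrow> t < b \<longrightarrow> (\<exists>d\<ge>c. (g has_real_derivative d) (at t))"
  shows "c * (b - a) \<le> g b - g a"
proof (rule ccontr)
  assume neg: "\<not> c * (b - a) \<le> g b - g a"
  then have ab': "a < b" using ab by (cases "a = b") auto
  define \<sigma> where "\<sigma> = (g b - g a) / (b - a)"
  \<comment> \<open>Midway between the actual mean slope and \<open>c\<close>: \<open>k\<close>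
    still decreases overall, while its derivative at good times is strictly positive.\<close>
  define c' where "c' = (c + \<sigma>) / 2"
  have \<sigma>: "\<sigma> < c" "g b - g a = \<sigma> * (b - a)"
    using neg ab' unfolding \<sigma>_def by (auto simp: divide_less_eq)
  have c': "c' < c" "g b - g a < c' * (b - a)"
    using \<sigma> ab' unfolding c'_def by auto
  define k where "k t = g t - c' * t" for t
  have kl: "\<bar>k x - k y\<bar> \<le> (L + \<bar>c'\<bar>) * \<bar>x - y\<bar>" if "x \<in> {a..b}" "y \<in> {a..b}" for x y
  proof -
    have "\<bar>k x - k y\<bar> \<le> \<bar>g x - g y\<bar> + \<bar>c' * (x - y)\<bar>" unfolding k_def right_diff_distrib by linarith
    moreover have "\<bar>g x - g y\<bar> \<le> L * \<bar>x - y\<bar>" using lipschitz_onD[OF lip that] by (simp add: dist_real_def)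
    ultimately show ?thesis unfolding abs_mult distrib_right by linarith
  qed
  have ck: "continuous_on {a..b} k"
    unfolding k_def by (intro continuous_intros lipschitz_on_continuous_on[OF lip])
  have kab: "k b < k a" using c'(2) unfolding k_def by (simp add: algebra_simps)
  from der obtain N where N: "N \<in> null_sets lebesgue"
    "{t. \<not> (a < t \<longrightarrow> t < b \<longrightarrow> (\<exists>d\<ge>c. (g has_real_derivative d) (at t)))} \<subseteq> N"
    by (auto simp: eventually_ae_filter)
  have "negligible (k ` (N \<inter> {a..b}))"
  proof (rule negligible_locally_Lipschitz_image)
    show "negligible (N \<inter> {a..b})" using N(1) negligible_iff_null_sets negligible_Int by blast
    show "\<exists>T B. open T \<and> x \<in> T \<and> (\<forall>y\<in>(N \<inter> {a..b}) \<inter> T. norm (k y - k x) \<le> B * norm (y - x))"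
      if "x \<in> N \<inter> {a..b}" for x
      using kl that by (intro exI[of _ UNIV] exI[of _ "L + \<bar>c'\<bar>"]) auto
  qed simp
  moreover have "\<not> negligible {k b<..<k a}" using kab by (simp add: negligible_interval(2)[of "k b" "k a", simplified])
  ultimately have "\<not> {k b<..<k a} \<subseteq> k ` (N \<inter> {a..b})" using negligible_subset by blast
  then obtain v where v: "k b < v" "v < k a" "v \<notin> k ` (N \<inter> {a..b})"
    by (metis greaterThanLessThan_iff subsetI)
  define S where "S = {t\<in>{a..b}. v \<le> k t}"
  have "S = {a..b} \<inter> k -` {v..}" unfolding S_def by auto
  moreover have "closed ({a..b} \<inter> k -` {v..})"
    by (rule continuous_closed_preimage[OF ck]) auto
  ultimately have "compact S" by (metis bounded_Int bounded_closed_interval compact_eq_bounded_closed)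
  moreover have "S \<noteq> {}" using v ab unfolding S_def by force
  ultimately obtain t where t: "t \<in> S" "\<And>u. u \<in> S \<Longrightarrow> u \<le> t"
    using compact_attains_sup by metis
  have tb: "a \<le> t" "t \<le> b" "v \<le> k t" using t(1) unfolding S_def by auto
  have after: "k u < v" if "t < u" "u \<le> b" for u
    using t(2)[of u] that tb unfolding S_def by force
  have "t < b" using tb v by (cases "t = b") auto
  have kt: "k t = v"
  proof (rule ccontr)
    assume "k t \<noteq> v"
    then have "v < k t" using tb by simp
    moreover have "k b < v" using v by simp
    ultimately obtain u where "t \<le> u" "u \<le> b" "k u = v"
      using IVT2'[of k b v t] tb continuous_on_subset[OF ck, of "{t..b}"] by force
    then show False using after[of u] \<open>v < k t\<close> by (cases "u = t") auto
  qed
  have "a < t" using tb kt v by (cases "a = t") auto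
  have "t \<notin> N" using kt v(3) tb by auto
  then obtain d where d: "c \<le> d" "(g has_real_derivative d) (at t)"
    using N(2) \<open>a < t\<close> \<open>t < b\<close> by blast
  have "(k has_real_derivative d - c') (at t)"
    unfolding k_def by (auto intro!: derivative_eq_intros d(2))
  moreover have "0 < d - c'" using d(1) c'(1) by simp
  ultimately obtain e where e: "0 < e" "\<And>h. 0 < h \<Longrightarrow> h < e \<Longrightarrow> k t < k (t + h)"
    using DERIV_pos_inc_right by blast
  define h where "h = min (e / 2) (b - t)"
  have "0 < h" "h < e" "t + h \<le> b" using e(1) \<open>t < b\<close> unfolding h_def by auto
  then show False using e(2)[of h] after[of "t + h"] kt by simp
qed

text \<open>On an interval of length less than \<open>1 / K\<close> after the last nonnegative time, the minimum \<open>m < 0\<close>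
  of \<open>\<delta>\<close> would satisfy \<open>m \<ge> K * m * (length) > m\<close>.\<close>

lemma lipschitz_ode_nonneg:
  fixes \<delta> :: "real \<Rightarrow> real"
  assumes lip: "L-lipschitz_on {0..} \<delta>" and \<delta>0: "0 \<le> \<delta> 0" and s: "0 < s" and K: "0 \<le> K"
    and der: "AE t in lebesgue. 0 < t \<longrightarrow> \<delta> t < 0 \<longrightarrow> - s \<le> \<delta> t \<longrightarrow> (\<exists>d\<ge>K * \<delta> t. (\<delta> has_real_derivative d) (at t))"
    and T: "0 \<le> T"
  shows "0 \<le> \<delta> T"
proof (rule ccontr)
  assume neg: "\<not> 0 \<le> \<delta> T"
  have c\<delta>: "continuous_on {0..} \<delta>" using lip by (rule lipschitz_on_continuous_on)
  have L: "0 \<le> L" using lip by (rule lipschitz_on_nonneg)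
  define S where "S = {t\<in>{0..T}. 0 \<le> \<delta> t}"
  have "S = {0..T} \<inter> \<delta> -` {0..}" unfolding S_def by auto
  moreover have "closed ({0..T} \<inter> \<delta> -` {0..})"
    by (rule continuous_closed_preimage[OF continuous_on_subset[OF c\<delta>]]) auto
  ultimately have "compact S" by (metis bounded_Int bounded_closed_interval compact_eq_bounded_closed)
  moreover have "S \<noteq> {}" using \<delta>0 T unfolding S_def by force
  ultimately obtain a where a: "a \<in> S" "\<And>u. u \<in> S \<Longrightarrow> u \<le> a" using compact_attains_sup by metis
  have a0: "0 \<le> a" "a \<le> T" "0 \<le> \<delta> a" using a(1) unfolding S_def by auto
  have after: "\<delta> u < 0" if "a < u" "u \<le> T" for u
    using a(2)[of u] that a0 unfolding S_def by force
  have "a < T" using a0 neg by (cases "a = T") auto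
  \<comment> \<open>The first length keeps \<delta> above -s, where the derivative bound is
    available; the second makes K times the length less than 1. Adding 1 to \<open>L\<close> and
    \<open>K\<close> allows these to be 0.\<close>
  define b where "b = min T (a + min (s / (L + 1)) (1 / (2 * (K + 1))))"
  have b: "a < b" "b \<le> T" "(b - a) * (L + 1) \<le> s" "(b - a) * K < 1"
  proof -
    show "a < b" "b \<le> T" using \<open>a < T\<close> s L K unfolding b_def by auto
    have "b - a \<le> s / (L + 1)" "b - a \<le> 1 / (2 * (K + 1))" unfolding b_def by auto
    then have 1: "(b - a) * (L + 1) \<le> s" "(b - a) * (2 * (K + 1)) \<le> 1" using L K by (auto simp: field_simps)
    then show "(b - a) * (L + 1) \<le> s" by simp
    have "(b - a) * K < (b - a) * (2 * (K + 1))" using \<open>a < b\<close> K by (intro mult_strict_left_mono) auto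
    then show "(b - a) * K < 1" using 1 by simp
  qed
  have low: "- s \<le> \<delta> t" if "a \<le> t" "t \<le> b" for t
  proof -
    have "\<bar>\<delta> t - \<delta> a\<bar> \<le> L * \<bar>t - a\<bar>"
      using lipschitz_onD[OF lip, of t a] that a0 by (simp add: dist_real_def)
    also have "\<dots> \<le> (L + 1) * (b - a)" using that L by (intro mult_mono) auto
    finally show ?thesis using b(3) a0(3) by (simp add: mult.commute)
  qed
  have "continuous_on {a..b} \<delta>" using a0 by (intro continuous_on_subset[OF c\<delta>]) auto
  then obtain m where m: "m \<in> {a..b}" "\<And>u. u \<in> {a..b} \<Longrightarrow> \<delta> m \<le> \<delta> u"
    using continuous_attains_inf[of "{a..b}" \<delta>] b(1) by force
  have "\<delta> b < 0" using after b by simp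
  then have \<delta>m: "\<delta> m < 0" using m(2)[of b] b(1) by simp
  have "K * \<delta> m * (m - a) \<le> \<delta> m - \<delta> a"
  proof (rule lipschitz_derivative_ge_AE)
    show "L-lipschitz_on {a..m} \<delta>" using a0 by (intro lipschitz_on_subset[OF lip]) auto
    show "a \<le> m" using m by simp
    from der show "AE t in lebesgue. a < t \<longrightarrow> t < m \<longrightarrow> (\<exists>d\<ge>K * \<delta> m. (\<delta> has_real_derivative d) (at t))"
    proof eventually_elim
      case (elim t)
      show ?case
      proof (intro impI)
        assume t: "a < t" "t < m"
        then have "\<delta> t < 0" "- s \<le> \<delta> t" "0 < t" using after[of t] low[of t] m b a0 by auto
        with elim obtain d where "K * \<delta> t \<le> d" "(\<delta> has_real_derivative d) (at t)" by blast
        moreover have "K * \<delta> m \<le> K * \<delta> t" using m t K by (intro mult_left_mono) auto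
        ultimately show "\<exists>d\<ge>K * \<delta> m. (\<delta> has_real_derivative d) (at t)" using order_trans by blast
      qed
    qed
  qed
  then have "K * \<delta> m * (m - a) \<le> \<delta> m" using a0(3) by simp
  moreover have "(m - a) * K \<le> (b - a) * K" using m K by (intro mult_right_mono) auto
  then have "\<delta> m * 1 < \<delta> m * ((m - a) * K)"
    using b(4) \<delta>m by (intro mult_strict_left_mono_neg) auto
  ultimately show False by (simp add: mult_ac)
qed

section \<open>The functions \<open>\<delta>\<^sub>D\<close> and \<open>\<delta>\<^sub>E\<close>\<close>

lemma A2_mono_q: "A2 f \<Longrightarrow> 0 \<le> q1 \<Longrightarrow> q1 \<le> q2 \<Longrightarrow> f r q1 \<le> f r q2"
  unfolding A2_def by (metis less_eq_real_def)

lemma A2_mono_r: "A2 f \<Longrightarrow> 0 \<le> q \<Longrightarrow> r1 \<le> r2 \<Longrightarrow> f r1 q \<le> f r2 q"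
  unfolding A2_def by (metis less_eq_real_def)

lemma perimeter_add_le_imp:
  assumes "perimeter A + perimeter B \<le> ereal C"
  shows "perimeter A \<le> ereal C" "perimeter B \<le> ereal C"
  using assms perimeter_nonneg[of A] perimeter_nonneg[of B]
  by (meson add_increasing2 add_increasing order_refl order_trans)+

text \<open>An erosion by \<rho> loses measure at most 2 B C \<rho>, and the Lipschitz constant of
  \<open>f h\<close> turns this into a loss of speed from 0. A larger \<open>q\<close> only helps,
  by monotonicity. The form with a free \<open>q\<close> serves both \<delta> and viscosity
  solutions.\<close>

lemma speed_lower_bound:
  fixes U :: "(real^'n) set"
  assumes "A2 f" "A3 \<Theta> mu" and \<Theta>: "\<And>x. \<Theta> x \<le> B" and C: "0 \<le> C" and s: "0 < s" and U: "open U"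
    and per: "\<And>r. 0 < r \<Longrightarrow> r \<le> s \<Longrightarrow> perimeter (erosion U r) \<le> ereal C"
    and f0: "f h (mu U) = 0" and lip: "L-lipschitz_on (cball (mu U) e \<inter> {0..}) (f h)" and e: "0 < e"
  obtains K \<rho>1 where "0 \<le> K" "0 < \<rho>1"
    "\<And>\<rho> q. 0 \<le> \<rho> \<Longrightarrow> \<rho> \<le> \<rho>1 \<Longrightarrow> mu (erosion U \<rho>) \<le> q \<Longrightarrow> - K * \<rho> \<le> f h q"
proof -
  have B: "0 \<le> B" using \<open>A3 \<Theta> mu\<close> \<Theta> unfolding A3_def by (meson less_imp_le order_trans)
  have L: "0 \<le> L" using lip by (rule lipschitz_on_nonneg)
  have Um: "U \<in> sets lebesgue" using U by (auto simp: borel_open)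
  have m0: "0 \<le> mu U" by (rule A3_nonneg[OF \<open>A3 \<Theta> mu\<close> Um])
  define K0 where "K0 = 2 * B * C"
  have K0: "0 \<le> K0" using B C by (simp add: K0_def)
  show ?thesis
  proof (rule that)
    show "0 \<le> L * K0" using L K0 by simp
    \<comment> \<open>\<open>s / 2\<close> comes from the doubled layer width;
      \<open>e / (K0 + 1)\<close> keeps \<open>q\<close> in the ball where \<open>f h\<close> is
      Lipschitz.\<close>
    show "0 < min (s / 2) (e / (K0 + 1))" using s e K0 by simp
    fix \<rho> q assume \<rho>: "0 \<le> \<rho>" "\<rho> \<le> min (s / 2) (e / (K0 + 1))" and q: "mu (erosion U \<rho>) \<le> q"
    have q0: "0 \<le> q"
      using q A3_nonneg[OF \<open>A3 \<Theta> mu\<close>, of "erosion U \<rho>"] by (auto simp: borel_open)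
    have "mu U - mu (erosion U \<rho>) \<le> K0 * \<rho>"
      unfolding K0_def using A3_erosion_layer[OF \<open>A3 \<Theta> mu\<close> \<Theta> C U \<rho>(1), of s] per \<rho>(2) by auto
    then have mq: "mu U - q \<le> K0 * \<rho>" using q by simp
    show "- (L * K0) * \<rho> \<le> f h q"
    proof (cases "mu U \<le> q")
      case True
      then have "0 \<le> f h q" using A2_mono_q[OF \<open>A2 f\<close> m0 True, of h] f0 by simp
      then show ?thesis using L K0 \<rho>(1) by (smt (verit) mult_minus_left mult_nonneg_nonneg)
    next
      case False
      have "K0 * \<rho> \<le> (K0 + 1) * \<rho>" using \<rho> by (intro mult_right_mono) auto
      also have "\<dots> \<le> e" using \<rho>(2) K0 by (simp add: field_simps)
      finally have "q \<in> cball (mu U) e \<inter> {0..}" using mq False q0 by (simp add: dist_real_def)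
      moreover have "mu U \<in> cball (mu U) e \<inter> {0..}" using m0 e by simp
      ultimately have "\<bar>f h q - f h (mu U)\<bar> \<le> L * \<bar>q - mu U\<bar>"
        using lipschitz_onD[OF lip] by (auto simp: dist_real_def)
      also have "\<dots> \<le> L * (K0 * \<rho>)" using False mq L by (intro mult_left_mono) auto
      finally show ?thesis using f0 by simp
    qed
  qed
qed

text \<open>The counterpart for complements, whose measure grows by the same layer. Here
  \<open>0 \<le> q\<close> must be asked, because \<open>q\<close> is bounded only from
  above.\<close>

lemma speed_upper_bound:
  fixes U :: "(real^'n) set"
  assumes "A2 f" "A3 \<Theta> mu" and \<Theta>: "\<And>x. \<Theta> x \<le> B" and C: "0 \<le> C" and s: "0 < s" and U: "open U"
    and per: "\<And>r. 0 < r \<Longrightarrow> r \<le> s \<Longrightarrow> perimeter (- erosion U r) \<le> ereal C"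
    and f0: "f h (mu (- U)) = 0" and lip: "L-lipschitz_on (cball (mu (- U)) e \<inter> {0..}) (f h)" and e: "0 < e"
  obtains K \<rho>1 where "0 \<le> K" "0 < \<rho>1"
    "\<And>\<rho> q. 0 \<le> \<rho> \<Longrightarrow> \<rho> \<le> \<rho>1 \<Longrightarrow> 0 \<le> q \<Longrightarrow> q \<le> mu (- erosion U \<rho>) \<Longrightarrow> f h q \<le> K * \<rho>"
proof -
  have B: "0 \<le> B" using \<open>A3 \<Theta> mu\<close> \<Theta> unfolding A3_def by (meson less_imp_le order_trans)
  have L: "0 \<le> L" using lip by (rule lipschitz_on_nonneg)
  have Um: "U \<in> sets lebesgue" using U by (auto simp: borel_open)
  have m0: "0 \<le> mu (- U)"
    using U by (intro A3_nonneg[OF \<open>A3 \<Theta> mu\<close>]) (auto simp: borel_closed)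
  define K0 where "K0 = 2 * B * C"
  have K0: "0 \<le> K0" using B C by (simp add: K0_def)
  show ?thesis
  proof (rule that)
    show "0 \<le> L * K0" using L K0 by simp
    show "0 < min (s / 2) (e / (K0 + 1))" using s e K0 by simp
    fix \<rho> q assume \<rho>: "0 \<le> \<rho>" "\<rho> \<le> min (s / 2) (e / (K0 + 1))" and q0: "0 \<le> q" and q: "q \<le> mu (- erosion U \<rho>)"
    have "mu (- erosion U \<rho>) = mu UNIV - mu (erosion U \<rho>)" "mu (- U) = mu UNIV - mu U"
      using A3_Compl[OF \<open>A3 \<Theta> mu\<close>] Um by (auto simp: borel_open)
    moreover have "mu U - mu (erosion U \<rho>) \<le> K0 * \<rho>"
      unfolding K0_def using A3_erosion_layer[OF \<open>A3 \<Theta> mu\<close> \<Theta> C U \<rho>(1), of s] per \<rho>(2) by auto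
    ultimately have mq: "q - mu (- U) \<le> K0 * \<rho>" using q by simp
    show "f h q \<le> (L * K0) * \<rho>"
    proof (cases "q \<le> mu (- U)")
      case True
      then have "f h q \<le> 0" using A2_mono_q[OF \<open>A2 f\<close> q0 True, of h] f0 by simp
      then show ?thesis using L K0 \<rho>(1) by (smt (verit) mult_nonneg_nonneg)
    next
      case False
      have "K0 * \<rho> \<le> (K0 + 1) * \<rho>" using \<rho> by (intro mult_right_mono) auto
      also have "\<dots> \<le> e" using \<rho>(2) K0 by (simp add: field_simps)
      finally have "q \<in> cball (mu (- U)) e \<inter> {0..}" using mq False q0 by (simp add: dist_real_def)
      moreover have "mu (- U) \<in> cball (mu (- U)) e \<inter> {0..}" using m0 e by simp
      ultimately have "\<bar>f h q - f h (mu (- U))\<bar> \<le> L * \<bar>q - mu (- U)\<bar>"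
        using lipschitz_onD[OF lip] by (auto simp: dist_real_def)
      also have "\<dots> \<le> L * (K0 * \<rho>)" using False mq L by (intro mult_left_mono) auto
      finally show ?thesis using f0 by simp
    qed
  qed
qed

section \<open>Extremality of the zero function\<close>

lemma delta_admissible_0:
  assumes "f h (mu (interior (W 0))) \<le> 0" "0 \<le> f h (mu (closure (W 0)))"
  shows "delta_admissible f mu h W (\<lambda>t. 0)"
  unfolding delta_admissible_def
proof (intro conjI)
  show "\<exists>L. L-lipschitz_on {0..} (\<lambda>t::real. 0::real)" by (intro exI[of _ 0] lipschitz_on_constant)
  show "AE t in lebesgue. 0 \<le> t \<longrightarrow> (\<exists>d. ((\<lambda>t. 0) has_real_derivative d) (at t within {0..}) \<and>
      f h (mu (interior (W 0))) \<le> d \<and> d \<le> f h (mu (closure (W 0))))"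
    using assms by (intro AE_I2 impI exI[of _ 0]) auto
qed simp

lemma has_real_derivative_at_interior:
  assumes "(g has_real_derivative d) (at t within {0..})" "0 < t"
  shows "(g has_real_derivative d) (at t)"
proof -
  have "at t within {0..} = at t" by (rule at_within_open_subset[of t "{0<..}"]) (use assms(2) in auto)
  with assms(1) show ?thesis by simp
qed

text \<open>Zero is admissible: the speed is 0 for the open set itself and not smaller for its
  closure. While a competitor is negative and close to 0, its parallel set is an erosion of width
  -\<delta>, whence \<delta>' \<ge> K \<delta>; this inequality prevents \<delta> from leaving 0
  downwards.\<close>

lemma is_delta_D_0:
  fixes u0 :: "real^'n \<Rightarrow> real"
  assumes "A2 f" "A3 \<Theta> mu" and cont: "continuous_on UNIV u0" and f0: "f h (mu {x. u0 x < h}) = 0"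
    and K: "0 \<le> K" and \<rho>1: "0 < \<rho>1"
    and speed: "\<And>\<rho> q. 0 \<le> \<rho> \<Longrightarrow> \<rho> \<le> \<rho>1 \<Longrightarrow> mu (erosion {x. u0 x < h} \<rho>) \<le> q \<Longrightarrow> - K * \<rho> \<le> f h q"
  shows "is_delta_D f mu u0 h (\<lambda>t. 0)"
  unfolding is_delta_D_def
proof (intro conjI allI impI)
  let ?U = "{x. u0 x < h}"
  have U: "open ?U" using cont by (intro open_Collect_less continuous_intros)
  have W0: "parD u0 h 0 = ?U" by (rule parD_0[OF cont])
  have "mu ?U \<le> mu (closure ?U)"
    by (rule A3_mono[OF \<open>A3 \<Theta> mu\<close> _ _ closure_subset]) (use U in \<open>auto simp: borel_open borel_closed\<close>)
  then have "0 \<le> f h (mu (closure ?U))"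
    using A2_mono_q[OF \<open>A2 f\<close> A3_nonneg[OF \<open>A3 \<Theta> mu\<close>], of ?U "mu (closure ?U)" h] U f0
    by (auto simp: borel_open)
  then show "delta_admissible f mu h (parD u0 h) (\<lambda>t. 0)"
    using f0 U by (intro delta_admissible_0) (auto simp: W0 interior_open)
  fix \<delta> and T :: real assume \<delta>: "delta_admissible f mu h (parD u0 h) \<delta>" and T: "0 \<le> T"
  obtain L where L: "L-lipschitz_on {0..} \<delta>" using \<delta> unfolding delta_admissible_def by blast
  have \<delta>0: "0 \<le> \<delta> 0" using \<delta> unfolding delta_admissible_def by simp
  have "AE t in lebesgue. 0 \<le> t \<longrightarrow>
       (\<exists>d. (\<delta> has_real_derivative d) (at t within {0..}) \<and>
            f h (mu (interior (parD u0 h (\<delta> t)))) \<le> d \<and> d \<le> f h (mu (closure (parD u0 h (\<delta> t)))))"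
    using \<delta> unfolding delta_admissible_def by simp
  then have "AE t in lebesgue. 0 < t \<longrightarrow> \<delta> t < 0 \<longrightarrow> - \<rho>1 \<le> \<delta> t \<longrightarrow> (\<exists>d\<ge>K * \<delta> t. (\<delta> has_real_derivative d) (at t))"
  proof eventually_elim
    case (elim t)
    show ?case
    proof (intro impI)
      assume t: "0 < t" "\<delta> t < 0" "- \<rho>1 \<le> \<delta> t"
      then obtain d where d: "(\<delta> has_real_derivative d) (at t within {0..})"
        "f h (mu (interior (parD u0 h (\<delta> t)))) \<le> d" using elim by auto
      have "parD u0 h (\<delta> t) = erosion ?U (- \<delta> t)"
        using parD_eq_erosion[of "- \<delta> t" u0 h] t(2) by simp
      then have "- K * (- \<delta> t) \<le> d"
        using speed[of "- \<delta> t" "mu (erosion ?U (- \<delta> t))"] t d(2) by (simp add: interior_open)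
      then show "\<exists>d\<ge>K * \<delta> t. (\<delta> has_real_derivative d) (at t)"
        using has_real_derivative_at_interior[OF d(1) t(1)] by auto
    qed
  qed
  then show "0 \<le> \<delta> T" by (rule lipschitz_ode_nonneg[OF L \<delta>0 \<rho>1 K _ T])
qed

lemma is_delta_E_0:
  fixes u0 :: "real^'n \<Rightarrow> real"
  assumes "A2 f" "A3 \<Theta> mu" and cont: "continuous_on UNIV u0" and f0: "f h (mu {x. u0 x \<le> h}) = 0"
    and K: "0 \<le> K" and \<rho>1: "0 < \<rho>1"
    and speed: "\<And>\<rho> q. 0 \<le> \<rho> \<Longrightarrow> \<rho> \<le> \<rho>1 \<Longrightarrow> 0 \<le> q \<Longrightarrow> q \<le> mu (- erosion {x. h < u0 x} \<rho>) \<Longrightarrow> f h q \<le> K * \<rho>"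
  shows "is_delta_E f mu u0 h (\<lambda>t. 0)"
  unfolding is_delta_E_def
proof (intro conjI allI impI)
  let ?E = "{x. u0 x \<le> h}"
  have E: "closed ?E" using cont by (intro closed_Collect_le continuous_intros)
  have W0: "parE u0 h 0 = ?E" by (rule parE_0[OF cont])
  have "mu (interior ?E) \<le> mu ?E"
    by (rule A3_mono[OF \<open>A3 \<Theta> mu\<close> _ _ interior_subset]) (use E in \<open>auto simp: borel_open borel_closed\<close>)
  then have "f h (mu (interior ?E)) \<le> 0"
    using A2_mono_q[OF \<open>A2 f\<close> A3_nonneg[OF \<open>A3 \<Theta> mu\<close>], of "interior ?E" "mu ?E" h] f0
    by (auto simp: borel_open)
  then show "delta_admissible f mu h (parE u0 h) (\<lambda>t. 0)"
    using f0 E by (intro delta_admissible_0) (auto simp: W0)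
  fix \<delta> and T :: real assume \<delta>: "delta_admissible f mu h (parE u0 h) \<delta>" and T: "0 \<le> T"
  obtain L where L: "L-lipschitz_on {0..} \<delta>" using \<delta> unfolding delta_admissible_def by blast
  have L': "L-lipschitz_on {0..} (\<lambda>t. - \<delta> t)" using L by (simp add: lipschitz_on_minus)
  have \<delta>0: "0 \<le> - \<delta> 0" using \<delta> unfolding delta_admissible_def by simp
  have "AE t in lebesgue. 0 \<le> t \<longrightarrow>
       (\<exists>d. (\<delta> has_real_derivative d) (at t within {0..}) \<and>
            f h (mu (interior (parE u0 h (\<delta> t)))) \<le> d \<and> d \<le> f h (mu (closure (parE u0 h (\<delta> t)))))"
    using \<delta> unfolding delta_admissible_def by simp
  then have "AE t in lebesgue. 0 < t \<longrightarrow> - \<delta> t < 0 \<longrightarrow> - \<rho>1 \<le> - \<delta> t \<longrightarrow>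
      (\<exists>d\<ge>K * - \<delta> t. ((\<lambda>t. - \<delta> t) has_real_derivative d) (at t))"
  proof eventually_elim
    case (elim t)
    show ?case
    proof (intro impI)
      assume t: "0 < t" "- \<delta> t < 0" "- \<rho>1 \<le> - \<delta> t"
      then obtain d where d: "(\<delta> has_real_derivative d) (at t within {0..})"
        "d \<le> f h (mu (closure (parE u0 h (\<delta> t))))" using elim by auto
      let ?er = "erosion {x. h < u0 x} (\<delta> t)"
      have "closed (- ?er)" by (simp add: closed_Compl)
      moreover have "parE u0 h (\<delta> t) = - ?er"
        using parE_eq_erosion[of "\<delta> t" u0 h] t(2) by simp
      moreover have "0 \<le> mu (- ?er)" by (rule A3_nonneg[OF \<open>A3 \<Theta> mu\<close>]) (auto simp: borel_open)
      ultimately have "d \<le> K * \<delta> t"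
        using speed[of "\<delta> t" "mu (- ?er)"] t d(2) by simp
      then show "\<exists>d\<ge>K * - \<delta> t. ((\<lambda>t. - \<delta> t) has_real_derivative d) (at t)"
        using DERIV_minus[OF has_real_derivative_at_interior[OF d(1) t(1)]] by (intro exI[of _ "- d"]) auto
    qed
  qed
  then have "0 \<le> - \<delta> T" by (rule lipschitz_ode_nonneg[OF L' \<delta>0 \<rho>1 K _ T])
  then show "\<delta> T \<le> 0" by simp
qed

section \<open>Barriers for viscosity solutions\<close>

text \<open>Both a solution and its negative are subsolutions in this sense, with the nonlocal speed
  frozen into \<open>S\<close>.\<close>

locale front_subsolution =
  fixes u :: "real^'n \<Rightarrow> real \<Rightarrow> real" and S :: "real^'n \<Rightarrow> real \<Rightarrow> real"
  assumes cont: "continuous_on (UNIV \<times> {0..}) (\<lambda>(x, t). u x t)"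
    and test: "\<And>\<phi> x0 t0 p a. C1_on (UNIV \<times> {0<..}) \<phi> \<Longrightarrow> 0 < t0 \<Longrightarrow>
      \<forall>\<^sub>F (x, t) in nhds (x0, t0). u x t - \<phi> (x, t) \<le> u x0 t0 - \<phi> (x0, t0) \<Longrightarrow>
      GDERIV \<phi> (x0, t0) :> (p, a) \<Longrightarrow> a + norm p * S x0 t0 \<le> 0"
    and lsc: "\<And>x t r. 0 < t \<Longrightarrow> r < S x t \<Longrightarrow> \<forall>\<^sub>F (y, s) in nhds (x, t). r < S y s"

text \<open>\<zeta> is the distance to \<open>x0\<close>, smoothed at its vertex. As
  \<open>n\<close> grows, the barrier tends to 0 where \<zeta> + V (t - \<tau>) < \<xi> and t < T,
  and blows up where either inequality is strictly reversed. It thus encodes a ball shrinking at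
  speed \<open>V\<close>.\<close>

lemma GDERIV_front_barrier:
  fixes x0 :: "'a::real_inner" and n V \<tau> \<xi> \<epsilon> T :: real
  assumes "0 < \<epsilon>"
  defines "\<zeta> \<equiv> \<lambda>x. sqrt ((x - x0) \<bullet> (x - x0) + \<epsilon>\<^sup>2)"
  defines "\<phi> \<equiv> \<lambda>(x, t). exp (n * (\<zeta> x + V * (t - \<tau>) - \<xi>)) + exp (n * (t - T))"
  defines "e \<equiv> \<lambda>x t. n * exp (n * (\<zeta> x + V * (t - \<tau>) - \<xi>))"
  shows "GDERIV \<phi> (x, t) :> (e x t *\<^sub>R ((x - x0) /\<^sub>R \<zeta> x), e x t * V + n * exp (n * (t - T)))"
    and "C1_on S \<phi>"
proof -
  have pos: "0 < (y - x0) \<bullet> (y - x0) + \<epsilon>\<^sup>2" for y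
    using assms(1) by (simp add: add_nonneg_pos)
  have \<zeta>0: "0 < \<zeta> y" for y using pos unfolding \<zeta>_def by simp
  have *: "GDERIV \<phi> z :> (e (fst z) (snd z) *\<^sub>R ((fst z - x0) /\<^sub>R \<zeta> (fst z)), e (fst z) (snd z) * V + n * exp (n * (snd z - T)))" for z
  proof -
    have d\<zeta>: "((\<lambda>z. \<zeta> (fst z)) has_derivative (\<lambda>h. fst h \<bullet> ((fst z - x0) /\<^sub>R \<zeta> (fst z)))) (at z)"
      unfolding \<zeta>_def using pos[of "fst z"]
      by (auto intro!: derivative_eq_intros simp: divide_simps inner_commute fun_eq_iff inner_diff_left inner_diff_right)
    show ?thesis
      unfolding gderiv_def \<phi>_def case_prod_beta e_def
      by (auto intro!: derivative_eq_intros d\<zeta> simp: inner_prod_def algebra_simps fun_eq_iff)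
  qed
  show "GDERIV \<phi> (x, t) :> (e x t *\<^sub>R ((x - x0) /\<^sub>R \<zeta> x), e x t * V + n * exp (n * (t - T)))"
    using *[of "(x, t)"] by simp
  have c\<zeta>: "continuous_on S (\<lambda>z. \<zeta> (fst z))"
    unfolding \<zeta>_def by (intro continuous_intros)
  have ne: "\<forall>z\<in>S. \<zeta> (fst z) \<noteq> 0" using \<zeta>0 by (metis less_irrefl)
  show "C1_on S \<phi>"
    by (rule C1_on_gradient[OF *]) (unfold e_def, intro continuous_intros c\<zeta> ne)
qed

context front_subsolution
begin

text \<open>A maximum of \<open>u - \<phi> n\<close> over the compact set \<open>Q\<close> is nearly
  at level \<open>c\<close> or above. For large \<open>n\<close> the penalties keep it off the
  lateral and the final boundary, and the initial bound keeps it off the bottom. The test inequality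
  at this interior maximum forces the speed below -V. Letting \<open>n\<close> tend to infinity
  gives a point exactly at level \<open>c\<close> or above; lower semicontinuity preserves the
  non-strict speed bound.\<close>

lemma contact_point:
  fixes x0 :: "real^'n"
  assumes \<tau>: "0 \<le> \<tau>" and V: "0 < V" and \<epsilon>: "0 < \<epsilon>" and \<xi>: "\<epsilon> + V * (t1 - \<tau>) < \<xi>" "\<xi> < r"
    and t1: "\<tau> < t1" "t1 < T'" "T' < T"
    and init: "\<And>x. norm (x - x0) \<le> r \<Longrightarrow> u x \<tau> < c" and hit: "c \<le> u x0 t1"
  obtains x t where "\<tau> < t" "t \<le> T" "c \<le> u x t" "S x t \<le> - V"
proof -
  define \<zeta> where "\<zeta> x = sqrt ((x - x0) \<bullet> (x - x0) + \<epsilon>\<^sup>2)" for x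
  have \<zeta>_ge: "norm (x - x0) \<le> \<zeta> x" for x
    unfolding \<zeta>_def power2_norm_eq_inner[symmetric] by (rule real_le_rsqrt) simp
  have \<zeta>_pos: "0 < \<zeta> x" for x
    unfolding \<zeta>_def using \<epsilon> by (simp add: add_nonneg_pos)
  have \<zeta>0: "\<zeta> x0 = \<epsilon>" unfolding \<zeta>_def using \<epsilon> by simp
  define G where "G = (\<lambda>z. \<zeta> (fst z) + V * (snd z - \<tau>))"
  have cG: "continuous_on A G" for A unfolding G_def \<zeta>_def by (intro continuous_intros)
  define Q where "Q = (cball x0 r \<times> {\<tau>..T}) \<inter> {z. G z \<le> r}"
  have Qc: "compact Q"
    unfolding Q_def by (intro compact_Int_closed compact_Times closed_Collect_le cG) auto
  have QI: "(x, t) \<in> Q" if "\<tau> \<le> t" "t \<le> T" "G (x, t) \<le> r" for x t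
  proof -
    have "norm (x - x0) \<le> r" using \<zeta>_ge[of x] that V unfolding G_def
      by (smt (verit) fst_conv snd_conv mult_nonneg_nonneg)
    then show ?thesis using that unfolding Q_def by (simp add: dist_norm norm_minus_commute)
  qed
  have Q0: "Q \<subseteq> UNIV \<times> {0..}" using \<tau> unfolding Q_def by auto
  have cuQ: "continuous_on Q (\<lambda>(x, t). u x t)" using cont Q0 continuous_on_subset by blast
  have z1: "(x0, t1) \<in> Q" using t1 \<xi> by (intro QI) (auto simp: G_def \<zeta>0)
  obtain W where W: "\<And>x t. (x, t) \<in> Q \<Longrightarrow> u x t \<le> W"
  proof -
    obtain z where "\<forall>y\<in>Q. (\<lambda>(x, t). u x t) y \<le> (\<lambda>(x, t). u x t) z"
      using continuous_attains_sup[OF Qc _ cuQ] z1 by blast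
    then show ?thesis using that[of "(\<lambda>(x, t). u x t) z"] by fastforce
  qed
  obtain \<eta> where \<eta>: "0 < \<eta>" "\<And>x. norm (x - x0) \<le> r \<Longrightarrow> u x \<tau> \<le> c - \<eta>"
  proof -
    have "continuous_on (cball x0 r) (\<lambda>x. u x \<tau>)"
      using continuous_on_compose2[OF cont, of "cball x0 r" "\<lambda>x. (x, \<tau>)"] \<tau>
      by (simp add: continuous_intros image_subset_iff)
    moreover have "0 \<le> r" using \<epsilon> V t1 \<xi> by (smt (verit) mult_pos_pos)
    ultimately obtain y where y: "y \<in> cball x0 r" "\<And>x. x \<in> cball x0 r \<Longrightarrow> u x \<tau> \<le> u y \<tau>"
      using continuous_attains_sup[OF compact_cball, of x0 r "\<lambda>x. u x \<tau>"] by fastforce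
    show ?thesis
      using that[of "c - u y \<tau>"] init[of y] y by (simp add: dist_norm norm_minus_commute)
  qed
  define \<phi> where "\<phi> n = (\<lambda>(x, t). exp (n * (\<zeta> x + V * (t - \<tau>) - \<xi>)) + exp (n * (t - T')))" for n
  have \<phi>c: "continuous_on A (\<phi> n)" for A n
    unfolding \<phi>_def \<zeta>_def case_prod_beta by (intro continuous_intros)
  have \<phi>lim: "(\<lambda>k. \<phi> (real k) (x0, t1)) \<longlonglongrightarrow> 0"
  proof -
    have "(\<lambda>k. exp (real k * a)) \<longlonglongrightarrow> 0" if "a < 0" for a :: real
      using LIMSEQ_realpow_zero[of "exp a"] that by (simp add: exp_of_nat_mult)
    from tendsto_add[OF this this, of "\<epsilon> + V * (t1 - \<tau>) - \<xi>" "t1 - T'"]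
    show ?thesis using \<xi> t1 unfolding \<phi>_def by (simp add: \<zeta>0)
  qed
  \<comment> \<open>The added 1 dominates the barrier's value at \<open>(x0, t1)\<close>, which is
    eventually below 1. On the boundary the penalty then exceeds everything \<open>u\<close> can
    gain there.\<close>
  have large: "\<forall>\<^sub>F k in sequentially. W - c + 1 < exp (real k * a)" if "0 < a" for a
  proof -
    have "filterlim (\<lambda>k. exp (a * real k)) at_top sequentially"
      by (rule filterlim_compose[OF exp_at_top])
        (rule filterlim_tendsto_pos_mult_at_top[OF tendsto_const that filterlim_real_sequentially])
    then show ?thesis by (auto simp: filterlim_at_top_dense mult.commute)
  qed
  have ev: "\<forall>\<^sub>F k in sequentially. \<exists>x t. (x, t) \<in> Q \<and> c - \<phi> (real k) (x0, t1) \<le> u x t \<and> S x t < - V"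
    using order_tendstoD(2)[OF \<phi>lim zero_less_one] order_tendstoD(2)[OF \<phi>lim \<eta>(1)]
      large[of "r - \<xi>", unfolded diff_gt_0_iff_gt, OF \<xi>(2)]
      large[of "T - T'", unfolded diff_gt_0_iff_gt, OF t1(3)] eventually_gt_at_top[of 0]
  proof eventually_elim
    case (elim k)
    have cd: "continuous_on Q (\<lambda>z. (\<lambda>(x, t). u x t) z - \<phi> (real k) z)"
      by (intro continuous_intros cuQ \<phi>c)
    have "Q \<noteq> {}" using z1 by blast
    from continuous_attains_sup[OF Qc this cd] obtain z where z: "z \<in> Q" "\<And>y. y \<in> Q \<Longrightarrow>
        (\<lambda>(x, t). u x t) y - \<phi> (real k) y \<le> (\<lambda>(x, t). u x t) z - \<phi> (real k) z"
      by blast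
    obtain x t where xt: "z = (x, t)" by (cases z)
    have mx: "c - \<phi> (real k) (x0, t1) \<le> u x t - \<phi> (real k) (x, t)"
      using z(2)[OF z1] hit unfolding xt by simp
    have \<phi>0: "0 \<le> \<phi> (real k) (x, t)" unfolding \<phi>_def by simp
    have inQ: "(x, t) \<in> Q" using z(1) xt by simp
    then have Qxt: "\<tau> \<le> t" "t \<le> T" "G (x, t) \<le> r" "norm (x - x0) \<le> r"
      unfolding Q_def by (auto simp: dist_norm norm_minus_commute)
    have Wxt: "u x t \<le> W" by (rule W[OF inQ])
    have "G (x, t) \<noteq> r"
    proof
      assume "G (x, t) = r"
      then have "exp (real k * (r - \<xi>)) \<le> \<phi> (real k) (x, t)" unfolding \<phi>_def G_def by simp
      then show False using elim(3) Wxt mx elim(1) by linarith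
    qed
    moreover have "t \<noteq> T"
    proof
      assume "t = T"
      then have "exp (real k * (T - T')) \<le> \<phi> (real k) (x, t)" unfolding \<phi>_def by simp
      then show False using elim(4) t1 Wxt mx elim(1) by simp
    qed
    moreover have "t \<noteq> \<tau>"
      using \<eta>(2)[OF Qxt(4)] mx \<phi>0 elim(2) by auto
    ultimately have int: "\<tau> < t" "t < T" "G (x, t) < r" using Qxt by auto
    define O' where "O' = (UNIV \<times> {\<tau><..<T}) \<inter> {z. G z < r}"
    have "open O'" unfolding O'_def by (intro open_Int open_Times open_Collect_less cG continuous_intros) auto
    moreover have "(x, t) \<in> O'" using int unfolding O'_def by simp
    ultimately have "\<forall>\<^sub>F y in nhds (x, t). y \<in> O'" by (rule eventually_nhds_in_open)
    then have loc: "\<forall>\<^sub>F (y, s) in nhds (x, t). u y s - \<phi> (real k) (y, s) \<le> u x t - \<phi> (real k) (x, t)"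
    proof eventually_elim
      case (elim y)
      obtain y1 y2 where y: "y = (y1, y2)" by (cases y)
      have "y \<in> Q" using elim unfolding y O'_def by (intro QI) auto
      then show ?case using z(2)[of y] unfolding xt y by simp
    qed
    define e where "e = real k * exp (real k * (\<zeta> x + V * (t - \<tau>) - \<xi>))"
    have e0: "0 < e" unfolding e_def using elim(5) by simp
    have "C1_on (UNIV \<times> {0<..}) (\<phi> (real k))"
      unfolding \<phi>_def \<zeta>_def by (rule GDERIV_front_barrier(2)[OF \<epsilon>])
    moreover have "GDERIV (\<phi> (real k)) (x, t) :>
        (e *\<^sub>R ((x - x0) /\<^sub>R \<zeta> x), e * V + real k * exp (real k * (t - T')))"
      unfolding \<phi>_def \<zeta>_def e_def by (rule GDERIV_front_barrier(1)[OF \<epsilon>])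
    ultimately have "e * V + real k * exp (real k * (t - T')) + norm (e *\<^sub>R ((x - x0) /\<^sub>R \<zeta> x)) * S x t \<le> 0"
      using test[OF _ le_less_trans[OF \<tau> int(1)] loc] by blast
    moreover have "0 < real k * exp (real k * (t - T'))" using elim(5) by simp
    \<comment> \<open>Smoothing shortens the spatial gradient by a factor \<nu> \<le> 1. Since
      \<open>S\<close> must be negative here, S \<le> \<nu> S, so the factor does no harm. The
      second exponential has a positive time derivative and makes the inequality strict.\<close>
    moreover define \<nu> where "\<nu> = norm (x - x0) / \<zeta> x"
    moreover have "norm (e *\<^sub>R ((x - x0) /\<^sub>R \<zeta> x)) = e * \<nu>"
      using e0 \<zeta>_pos[of x] unfolding \<nu>_def by (simp add: divide_inverse)
    ultimately have "e * (V + \<nu> * S x t) < 0" by (simp add: algebra_simps)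
    then have neg: "V + \<nu> * S x t < 0" using e0 by (simp add: mult_less_0_iff)
    have \<nu>: "0 \<le> \<nu>" "\<nu> \<le> 1" unfolding \<nu>_def using \<zeta>_ge[of x] \<zeta>_pos[of x] by (auto simp: divide_simps)
    have "S x t < 0" using neg V \<nu> by (smt (verit) mult_nonneg_nonneg)
    then have "S x t \<le> \<nu> * S x t" using \<nu> by (smt (verit) mult_left_le_one_le mult_minus_right)
    then have "S x t < - V" using neg by simp
    moreover have "c - \<phi> (real k) (x0, t1) \<le> u x t" using mx \<phi>0 by simp
    ultimately show ?case using inQ by blast
  qed
  then obtain N where N: "\<And>k. N \<le> k \<Longrightarrow> \<exists>x t. (x, t) \<in> Q \<and> c - \<phi> (real k) (x0, t1) \<le> u x t \<and> S x t < - V"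
    unfolding eventually_sequentially by blast
  have "\<forall>k. \<exists>z. z \<in> Q \<and> c - \<phi> (real (k + N)) (x0, t1) \<le> u (fst z) (snd z) \<and> S (fst z) (snd z) < - V"
    using N by (metis fst_conv le_add2 snd_conv)
  from choice[OF this] obtain Z where Z: "\<And>k. Z k \<in> Q"
    "\<And>k. c - \<phi> (real (k + N)) (x0, t1) \<le> u (fst (Z k)) (snd (Z k))" "\<And>k. S (fst (Z k)) (snd (Z k)) < - V"
    by auto
  obtain z j where zj: "z \<in> Q" "strict_mono j" "(Z \<circ> j) \<longlonglongrightarrow> z"
    using Qc[unfolded compact_def] Z(1) by metis
  obtain x t where xt: "z = (x, t)" by (cases z)
  have "(\<lambda>k. (\<lambda>(x, t). u x t) ((Z \<circ> j) k)) \<longlonglongrightarrow> (\<lambda>(x, t). u x t) z"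
    by (rule continuous_on_tendsto_compose[OF cuQ zj(3,1)]) (use Z(1) in auto)
  then have ul: "(\<lambda>k. u (fst (Z (j k))) (snd (Z (j k)))) \<longlonglongrightarrow> u x t"
    unfolding xt by (simp add: case_prod_beta)
  have "(\<lambda>k. \<phi> (real (k + N)) (x0, t1)) \<longlonglongrightarrow> 0" using LIMSEQ_ignore_initial_segment[OF \<phi>lim] .
  from LIMSEQ_subseq_LIMSEQ[OF this zj(2)]
  have "(\<lambda>k. c - \<phi> (real (j k + N)) (x0, t1)) \<longlonglongrightarrow> c - 0" by (intro tendsto_intros) (simp add: o_def)
  then have c_le: "c \<le> u x t" using LIMSEQ_le[OF _ ul] Z(2) by auto
  have Qxt: "\<tau> \<le> t" "t \<le> T" "norm (x - x0) \<le> r"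
    using zj(1) unfolding xt Q_def by (auto simp: dist_norm norm_minus_commute)
  have "t \<noteq> \<tau>" using \<eta>(2)[OF Qxt(3)] \<eta>(1) c_le by auto
  then have "\<tau> < t" using Qxt by simp
  moreover have "S x t \<le> - V"
  proof (rule ccontr)
    assume "\<not> S x t \<le> - V"
    then have "\<forall>\<^sub>F (y, s) in nhds (x, t). - V < S y s" using \<tau> \<open>\<tau> < t\<close> by (intro lsc) auto
    then have "\<forall>\<^sub>F y in nhds z. - V < S (fst y) (snd y)" unfolding xt by (simp add: case_prod_unfold)
    from eventually_compose_filterlim[OF this zj(3)]
    have "\<forall>\<^sub>F k in sequentially. - V < S (fst (Z (j k))) (snd (Z (j k)))" by simp
    then obtain k where "- V < S (fst (Z (j k))) (snd (Z (j k)))"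
      using eventually_happens'[OF sequentially_bot] by blast
    then show False using Z(3)[of "j k"] by simp
  qed
  ultimately show ?thesis using that Qxt(2) c_le by blast
qed

text \<open>A ball inside the sublevel set shrinks at speed at most \<open>V\<close>. Contact is
  tested with a slightly larger speed, which contradicts the bound on \<open>S\<close> strictly and
  also covers \<open>V = 0\<close>.\<close>

lemma ball_persists:
  assumes \<tau>: "0 \<le> \<tau>" and V: "0 \<le> V"
    and speed: "\<And>x t. \<tau> < t \<Longrightarrow> t < \<tau> + h \<Longrightarrow> c \<le> u x t \<Longrightarrow> - V \<le> S x t"
    and init: "\<And>x. x \<in> ball x0 r \<Longrightarrow> u x \<tau> < c"
    and t1: "\<tau> \<le> t1" "t1 < \<tau> + h" "V * (t1 - \<tau>) < r"
  shows "u x0 t1 < c"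
proof (rule ccontr)
  assume "\<not> u x0 t1 < c"
  then have hit: "c \<le> u x0 t1" by simp
  have r: "0 < r" using t1 V by (smt (verit) mult_nonneg_nonneg)
  have "t1 \<noteq> \<tau>" using init[of x0] r hit by auto
  then have \<tau>t1: "\<tau> < t1" using t1 by simp
  define gap where "gap = r - V * (t1 - \<tau>)"
  have gap: "0 < gap" and r_eq: "r = V * (t1 - \<tau>) + gap" using t1 unfolding gap_def by simp_all
  \<comment> \<open>The spare radius \<open>gap\<close> is shared out: a quarter to the extra speed,
    a quarter to the smoothing, a quarter to the distance of \<xi> from \<open>r\<close>. The tested
    radius \<open>r - gap / 8\<close> lies above \<xi>, and its closed ball is inside the given open
    one.\<close>
  define V' where "V' = V + gap / (4 * (t1 - \<tau>))"
  have V': "V < V'" "V' * (t1 - \<tau>) = V * (t1 - \<tau>) + gap / 4"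
    unfolding V'_def using gap \<tau>t1 by (auto simp: field_simps)
  obtain x t where "\<tau> < t" "t \<le> (t1 + 2 * (\<tau> + h)) / 3" "c \<le> u x t" "S x t \<le> - V'"
  proof (rule contact_point[where \<tau> = \<tau> and V = V' and \<epsilon> = "gap / 4" and ?t1.0 = t1 and \<xi> = "r - gap / 4"
        and r = "r - gap / 8" and c = c and ?x0.0 = x0 and T' = "(2 * t1 + (\<tau> + h)) / 3"
        and T = "(t1 + 2 * (\<tau> + h)) / 3"])
    show "u x \<tau> < c" if "norm (x - x0) \<le> r - gap / 8" for x
      using that gap by (intro init) (simp add: dist_norm norm_minus_commute)
    show "gap / 4 + V' * (t1 - \<tau>) < r - gap / 4" unfolding V'(2) using gap r_eq by linarith
  qed (use \<tau> V V' gap \<tau>t1 t1 hit in auto)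
  moreover have "(t1 + 2 * (\<tau> + h)) / 3 < \<tau> + h" using t1 by simp
  ultimately have "- V \<le> S x t" using speed by fastforce
  then show False using \<open>S x t \<le> - V'\<close> V'(1) by simp
qed

text \<open>On a short time interval a speed bound \<open>V\<close> improves to \<open>V / 2\<close>: the front moves by at most
  \<open>V * h\<close>, so the speed is at most \<open>K * V * h \<le> V / 2\<close>.\<close>

lemma sublevel_persists:
  assumes M: "0 < M" "\<And>x t. 0 < t \<Longrightarrow> - M \<le> S x t" and K: "0 \<le> K" and \<rho>1: "0 < \<rho>1"
    and speed: "\<And>x t \<rho>. 0 < t \<Longrightarrow> 0 \<le> \<rho> \<Longrightarrow> \<rho> \<le> \<rho>1 \<Longrightarrow>
      erosion {x. u x 0 < c} \<rho> \<subseteq> {x. u x t < c} \<Longrightarrow> c \<le> u x t \<Longrightarrow> - K * \<rho> \<le> S x t"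
    and t: "0 \<le> t" and x: "u x 0 < c"
  shows "u x t < c"
proof -
  define U where "U = {x. u x 0 < c}"
  have U: "open U"
    unfolding U_def
    using continuous_on_compose2[OF cont, of UNIV "\<lambda>x. (x, 0)"]
    by (intro open_Collect_less continuous_intros) (simp add: continuous_intros image_subset_iff)
  \<comment> \<open>The first bound makes K h \<le> 1/2, so each round halves the speed; the second
    keeps the displacement within \<rho>1 already for the crude speed \<open>M\<close>.\<close>
  define h where "h = min (1 / (2 * (K + 1))) (\<rho>1 / M)"
  have h: "0 < h" "K * h \<le> 1 / 2" "M * h \<le> \<rho>1"
  proof -
    show h0: "0 < h" unfolding h_def using K M \<rho>1 by simp
    have "h \<le> 1 / (2 * (K + 1))" "h \<le> \<rho>1 / M" unfolding h_def by auto
    then have "h * (2 * (K + 1)) \<le> 1" "M * h \<le> \<rho>1" using K M by (auto simp: field_simps)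
    then show "K * h \<le> 1 / 2" "M * h \<le> \<rho>1" using h0 by (auto simp: algebra_simps)
  qed
  have step: "U \<subseteq> {x. u x t < c}" if \<tau>: "0 \<le> \<tau>" "U \<subseteq> {x. u x \<tau> < c}" and t: "\<tau> \<le> t" "t < \<tau> + h" for \<tau> t
  proof -
    \<comment> \<open>Each round restarts at time \<tau> on the same interval; only the speed bound
      improves. In the limit every point of the open set \<open>U\<close> survives.\<close>
    have claim: "erosion U (M / 2 ^ k * (t - \<tau>)) \<subseteq> {x. u x t < c}" if "\<tau> \<le> t" "t < \<tau> + h" for k t
      using that
    proof (induction k arbitrary: t)
      case 0
      show ?case
      proof
        fix x assume "x \<in> erosion U (M / 2 ^ 0 * (t - \<tau>))"
        then obtain s where s: "M * (t - \<tau>) < s" "ball x s \<subseteq> U" unfolding erosion_def by auto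
        have "u x t < c"
          by (rule ball_persists[OF \<tau>(1), of M h c x s t]) (use M \<tau> s 0 in auto)
        then show "x \<in> {x. u x t < c}" by simp
      qed
    next
      case (Suc k)
      define Vk where "Vk = M / 2 ^ k"
      have Vk: "0 < Vk" "Vk \<le> M" using M unfolding Vk_def by (auto simp: divide_simps)
      have sp: "- (Vk / 2) \<le> S y s" if "\<tau> < s" "s < \<tau> + h" "c \<le> u y s" for y s
      proof -
        have "erosion U (Vk * h) \<subseteq> erosion U (Vk * (s - \<tau>))"
          using that Vk by (intro erosion_antimono mult_left_mono) auto
        also have "\<dots> \<subseteq> {x. u x s < c}" using Suc.IH[of s] that unfolding Vk_def by simp
        finally have "- K * (Vk * h) \<le> S y s"
          using speed[of s "Vk * h" y] that \<tau>(1) Vk h order_trans[OF mult_right_mono[OF Vk(2), of h] h(3)]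
          unfolding U_def by simp
        moreover have "K * h * Vk \<le> 1 / 2 * Vk" using h(2) Vk by (intro mult_right_mono) auto
        ultimately show ?thesis by (simp add: mult_ac)
      qed
      show ?case
      proof
        fix x assume "x \<in> erosion U (M / 2 ^ Suc k * (t - \<tau>))"
        then obtain s where s: "Vk / 2 * (t - \<tau>) < s" "ball x s \<subseteq> U"
          unfolding erosion_def Vk_def by (auto simp: mult.commute)
        have "u x t < c"
          by (rule ball_persists[OF \<tau>(1), of "Vk / 2" h c x s t]) (use Vk sp \<tau> s Suc.prems in auto)
        then show "x \<in> {x. u x t < c}" by simp
      qed
    qed
    show ?thesis
    proof
      fix x assume "x \<in> U"
      then obtain s where s: "0 < s" "ball x s \<subseteq> U" using U open_contains_ball by blast
      have "(\<lambda>k. M / 2 ^ k * (t - \<tau>)) \<longlonglongrightarrow> 0 * (t - \<tau>)"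
        by (intro tendsto_intros LIMSEQ_divide_realpow_zero) simp
      then have "\<forall>\<^sub>F k in sequentially. M / 2 ^ k * (t - \<tau>) < s"
        using order_tendstoD(2) s(1) by fastforce
      then obtain k where "M / 2 ^ k * (t - \<tau>) < s"
        using eventually_happens'[OF sequentially_bot] by blast
      then have "x \<in> erosion U (M / 2 ^ k * (t - \<tau>))" using s unfolding erosion_def by blast
      then show "x \<in> {x. u x t < c}" using claim[OF t] by blast
    qed
  qed
  \<comment> \<open>A step recovers all of the initial set \<open>U\<close>, so no displacement
    accumulates from one interval to the next. Steps of length \<open>h / 2\<close> stay within the
    strict bound on the interval.\<close>
  have all: "U \<subseteq> {x. u x t < c}" if "0 \<le> t" "t \<le> real n * (h / 2)" for n t
    using that
  proof (induction n arbitrary: t)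
    case 0
    then show ?case by (simp add: U_def)
  next
    case (Suc n)
    show ?case
    proof (cases "t \<le> real n * (h / 2)")
      case False
      show ?thesis
        by (rule step[of "real n * (h / 2)"]) (use False Suc h in \<open>auto simp: algebra_simps\<close>)
    qed (use Suc in auto)
  qed
  obtain n where "t < real n * (h / 2)" using h(1) reals_Archimedean3[of "h / 2"] by auto
  then show ?thesis using all[of t n] t x unfolding U_def by auto
qed

end

section \<open>Stationarity of the level set\<close>

lemma A3_tendsto:
  assumes A3: "A3 \<Theta> mu" and sets: "\<And>n. X n \<in> sets lebesgue" "Y \<in> sets lebesgue"
    and ev: "\<And>x. \<forall>\<^sub>F n in sequentially. x \<in> X n \<longleftrightarrow> x \<in> Y"
  shows "(\<lambda>n. mu (X n)) \<longlonglongrightarrow> mu Y"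
proof -
  have mu: "mu A = (\<integral>x. indicator A x *\<^sub>R \<Theta> x \<partial>lebesgue)" if "A \<in> sets lebesgue" for A
    using A3 that unfolding A3_def set_lebesgue_integral_def by auto
  have int: "integrable lebesgue \<Theta>" and pos: "\<And>x. 0 < \<Theta> x" using A3 unfolding A3_def by auto
  have "(\<lambda>n. \<integral>x. indicator (X n) x *\<^sub>R \<Theta> x \<partial>lebesgue) \<longlonglongrightarrow> (\<integral>x. indicator Y x *\<^sub>R \<Theta> x \<partial>lebesgue)"
  proof (rule integral_dominated_convergence[OF _ _ int])
    show "(\<lambda>x. indicator Y x *\<^sub>R \<Theta> x) \<in> borel_measurable lebesgue"
      "(\<lambda>x. indicator (X n) x *\<^sub>R \<Theta> x) \<in> borel_measurable lebesgue" for n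
      using int sets by auto
    show "AE x in lebesgue. (\<lambda>n. indicator (X n) x *\<^sub>R \<Theta> x) \<longlonglongrightarrow> indicator Y x *\<^sub>R \<Theta> x"
    proof (rule AE_I2)
      fix x
      from ev[of x] have "\<forall>\<^sub>F n in sequentially. indicator (X n) x *\<^sub>R \<Theta> x = indicator Y x *\<^sub>R \<Theta> x"
        by eventually_elim (auto simp: indicator_def)
      then show "(\<lambda>n. indicator (X n) x *\<^sub>R \<Theta> x) \<longlonglongrightarrow> indicator Y x *\<^sub>R \<Theta> x"
        by (rule tendsto_eventually)
    qed
    show "AE x in lebesgue. norm (indicator (X n) x *\<^sub>R \<Theta> x) \<le> \<Theta> x" for n
      using pos by (intro AE_I2) (auto simp: indicator_def less_imp_le)
  qed
  then show ?thesis using mu sets by simp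
qed

lemma A1_tendsto:
  assumes "A1 f" "c \<longlonglongrightarrow> c0" "q \<longlonglongrightarrow> q0" "\<And>n. 0 \<le> q n" "0 \<le> q0"
  shows "(\<lambda>n. f (c n) (q n)) \<longlonglongrightarrow> f c0 q0"
proof -
  have "(\<lambda>n. (\<lambda>(r, q). f r q) (c n, q n)) \<longlonglongrightarrow> (\<lambda>(r, q). f r q) (c0, q0)"
    by (rule continuous_on_tendsto_compose[where s = "UNIV \<times> {0..}"])
      (use assms in \<open>auto simp: A1_def intro: tendsto_Pair\<close>)
  then show ?thesis by simp
qed

text \<open>Reduces semicontinuity of the speed to sequences, for which dominated convergence is
  available. Near a positive time only positive times occur, so \<open>u\<close> is evaluated only
  where it is continuous.\<close>

lemma eventually_nhds_positive_time:
  fixes P :: "'a::first_countable_topology \<times> real \<Rightarrow> bool"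
  assumes t: "0 < t"
    and seq: "\<And>X T. X \<longlonglongrightarrow> x \<Longrightarrow> T \<longlonglongrightarrow> t \<Longrightarrow> (\<And>n. 0 < T n) \<Longrightarrow> \<forall>\<^sub>F n in sequentially. P (X n, T n)"
  shows "\<forall>\<^sub>F z in nhds (x, t). P z"
proof -
  have "eventually P (inf (nhds (x, t)) (principal (UNIV \<times> {0<..})))"
  proof (rule sequentially_imp_eventually_nhds_within, intro allI impI)
    fix Z :: "nat \<Rightarrow> 'a \<times> real" assume Z: "(\<forall>n. Z n \<in> UNIV \<times> {0<..}) \<and> Z \<longlonglongrightarrow> (x, t)"
    have "\<forall>\<^sub>F n in sequentially. P (fst (Z n), snd (Z n))"
    proof (rule seq)
      show "(\<lambda>n. fst (Z n)) \<longlonglongrightarrow> x" "(\<lambda>n. snd (Z n)) \<longlonglongrightarrow> t"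
        using tendsto_fst tendsto_snd Z by fastforce+
      show "0 < snd (Z n)" for n using Z by (metis greaterThan_iff mem_Times_iff)
    qed
    then show "\<forall>\<^sub>F n in sequentially. P (Z n)" by simp
  qed
  moreover have "\<forall>\<^sub>F z in nhds (x, t). z \<in> UNIV \<times> {0<..}"
    by (rule eventually_nhds_in_open) (use t in \<open>auto intro: open_Times\<close>)
  ultimately show ?thesis
    unfolding eventually_inf_principal by eventually_elim blast
qed

section \<open>Viscosity solutions as front subsolutions\<close>

context
  fixes f :: "real \<Rightarrow> real \<Rightarrow> real" and \<Theta> :: "real^'n \<Rightarrow> real" and mu :: "(real^'n) set \<Rightarrow> real"
    and u :: "real^'n \<Rightarrow> real \<Rightarrow> real"
  assumes A1: "A1 f" and A2: "A2 f" and A3: "A3 \<Theta> mu"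
    and cont: "continuous_on (UNIV \<times> {0..}) (\<lambda>(x, t). u x t)"
begin

lemma slice_continuous: "0 \<le> t \<Longrightarrow> continuous_on UNIV (\<lambda>x. u x t)"
  using continuous_on_compose2[OF cont, of UNIV "\<lambda>x. (x, t)"]
  by (simp add: continuous_intros image_subset_iff)

lemma slice_sets:
  assumes "0 \<le> t"
  shows "{x. u x t < c} \<in> sets lebesgue" "{x. u x t \<le> c} \<in> sets lebesgue"
  using open_Collect_less[OF slice_continuous[OF assms] continuous_on_const[of _ c]]
    closed_Collect_le[OF slice_continuous[OF assms] continuous_on_const[of _ c]]
  by (auto simp: borel_open borel_closed)

lemma slice_tendsto:
  assumes "0 < t" "X \<longlonglongrightarrow> x" "T \<longlonglongrightarrow> t" "\<And>n. 0 < T n"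
  shows "(\<lambda>n. u (X n) (T n)) \<longlonglongrightarrow> u x t"
proof -
  have "(\<lambda>n. (\<lambda>(x, t). u x t) (X n, T n)) \<longlonglongrightarrow> (\<lambda>(x, t). u x t) (x, t)"
    by (rule continuous_on_tendsto_compose[OF cont])
      (use assms in \<open>auto intro: tendsto_Pair simp: less_imp_le\<close>)
  then show ?thesis by simp
qed

text \<open>Strict sublevel sets can only gain measure abruptly in the limit: a point strictly below
  the limit level is eventually strictly below the nearby levels. Intersecting with the limit set
  therefore gives a convergent lower bound for the measures, and monotonicity passes it to
  \<open>f\<close>.\<close>

lemma front_subsolution_of_viscosity:
  assumes "viscosity_subsolution f mu u"
  shows "front_subsolution u (\<lambda>x t. f (u x t) (mu {y. u y t < u x t}))"
proof
  show "a + norm p * f (u x0 t0) (mu {y. u y t0 < u x0 t0}) \<le> 0"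
    if "C1_on (UNIV \<times> {0<..}) \<phi>" "0 < t0"
      "\<forall>\<^sub>F (x, t) in nhds (x0, t0). u x t - \<phi> (x, t) \<le> u x0 t0 - \<phi> (x0, t0)"
      "GDERIV \<phi> (x0, t0) :> (p, a)" for \<phi> x0 t0 p a
    using assms that unfolding viscosity_subsolution_def by blast
  fix x t r assume t: "0 < t" and r: "r < f (u x t) (mu {y. u y t < u x t})"
  show "\<forall>\<^sub>F (y, s) in nhds (x, t). r < f (u y s) (mu {z. u z s < u y s})"
  proof (rule eventually_nhds_positive_time[OF t])
    fix X T assume XT: "X \<longlonglongrightarrow> x" "T \<longlonglongrightarrow> t" "\<And>n. 0 < (T n :: real)"
    let ?A = "{y. u y t < u x t}" and ?B = "\<lambda>n. {y. u y (T n) < u (X n) (T n)}"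
    have sets: "?A \<in> sets lebesgue" "?B n \<in> sets lebesgue" for n
      using slice_sets t XT(3) less_imp_le by blast+
    have cl: "(\<lambda>n. u (X n) (T n)) \<longlonglongrightarrow> u x t" by (rule slice_tendsto[OF t XT])
    have ql: "(\<lambda>n. mu (?A \<inter> ?B n)) \<longlonglongrightarrow> mu ?A"
    proof (rule A3_tendsto[OF A3])
      fix y
      show "\<forall>\<^sub>F n in sequentially. y \<in> ?A \<inter> ?B n \<longleftrightarrow> y \<in> ?A"
      proof (cases "y \<in> ?A")
        case True
        have "(\<lambda>n. u y (T n) - u (X n) (T n)) \<longlonglongrightarrow> u y t - u x t"
          by (intro tendsto_intros cl slice_tendsto[OF t] XT)
        then have "\<forall>\<^sub>F n in sequentially. u y (T n) - u (X n) (T n) < 0"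
          using True by (intro order_tendstoD(2)) auto
        then show ?thesis by eventually_elim (use True in auto)
      qed auto
    qed (use sets in auto)
    have q0: "0 \<le> mu ?A" "0 \<le> mu (?A \<inter> ?B n)" for n using sets by (auto intro!: A3_nonneg[OF A3])
    have "\<forall>\<^sub>F n in sequentially. r < f (u (X n) (T n)) (mu (?A \<inter> ?B n))"
      using order_tendstoD(1)[OF A1_tendsto[OF A1 cl ql q0(2,1)] r] .
    then show "\<forall>\<^sub>F n in sequentially. case (X n, T n) of (y, s) \<Rightarrow> r < f (u y s) (mu {z. u z s < u y s})"
    proof eventually_elim
      case (elim n)
      have "mu (?A \<inter> ?B n) \<le> mu (?B n)" by (rule A3_mono[OF A3]) (use sets in auto)
      then have "f (u (X n) (T n)) (mu (?A \<inter> ?B n)) \<le> f (u (X n) (T n)) (mu (?B n))"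
        by (rule A2_mono_q[OF A2 q0(2)])
      with elim show ?case by simp
    qed
  qed
qed (rule cont)

text \<open>Dually, a point strictly above the limit level is eventually above the nearby levels, so
  unions with the limit set bound the non-strict sublevel sets from above. Changing the sign of
  \<open>u\<close> and of the test function turns the supersolution inequality into the required
  one.\<close>

lemma front_subsolution_of_viscosity_uminus:
  assumes "viscosity_supersolution f mu u"
  shows "front_subsolution (\<lambda>x t. - u x t) (\<lambda>x t. - f (u x t) (mu {y. u y t \<le> u x t}))"
proof
  show "continuous_on (UNIV \<times> {0..}) (\<lambda>(x, t). - u x t)"
    using continuous_on_minus[OF cont] by (simp add: case_prod_unfold)
  show "a + norm p * - f (u x0 t0) (mu {y. u y t0 \<le> u x0 t0}) \<le> 0"
    if \<phi>: "C1_on (UNIV \<times> {0<..}) \<phi>" and t0: "0 < t0"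
      and loc: "\<forall>\<^sub>F (x, t) in nhds (x0, t0). - u x t - \<phi> (x, t) \<le> - u x0 t0 - \<phi> (x0, t0)"
      and der: "GDERIV \<phi> (x0, t0) :> (p, a)" for \<phi> x0 t0 p a
  proof -
    have "C1_on (UNIV \<times> {0<..}) (\<lambda>z. - \<phi> z)"
      using C1_on_scaleR[OF C1_on_const[of _ "-1"] \<phi>] by simp
    moreover have "GDERIV (\<lambda>z. - \<phi> z) (x0, t0) :> (- p, - a)"
      using GDERIV_minus[OF der] by simp
    moreover have "\<forall>\<^sub>F (x, t) in nhds (x0, t0). u x t - - \<phi> (x, t) \<ge> u x0 t0 - - \<phi> (x0, t0)"
      using loc by eventually_elim auto
    ultimately have "- a + norm (- p) * f (u x0 t0) (mu {y. u y t0 \<le> u x0 t0}) \<ge> 0"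
      using assms t0 unfolding viscosity_supersolution_def by blast
    then show ?thesis by simp
  qed
  fix x t r assume t: "0 < t" and r: "r < - f (u x t) (mu {y. u y t \<le> u x t})"
  show "\<forall>\<^sub>F (y, s) in nhds (x, t). r < - f (u y s) (mu {z. u z s \<le> u y s})"
  proof (rule eventually_nhds_positive_time[OF t])
    fix X T assume XT: "X \<longlonglongrightarrow> x" "T \<longlonglongrightarrow> t" "\<And>n. 0 < (T n :: real)"
    let ?A = "{y. u y t \<le> u x t}" and ?B = "\<lambda>n. {y. u y (T n) \<le> u (X n) (T n)}"
    have sets: "?A \<in> sets lebesgue" "?B n \<in> sets lebesgue" for n
      using slice_sets t XT(3) less_imp_le by blast+
    have cl: "(\<lambda>n. u (X n) (T n)) \<longlonglongrightarrow> u x t" by (rule slice_tendsto[OF t XT])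
    have ql: "(\<lambda>n. mu (?A \<union> ?B n)) \<longlonglongrightarrow> mu ?A"
    proof (rule A3_tendsto[OF A3])
      fix y
      show "\<forall>\<^sub>F n in sequentially. y \<in> ?A \<union> ?B n \<longleftrightarrow> y \<in> ?A"
      proof (cases "y \<in> ?A")
        case False
        have "(\<lambda>n. u y (T n) - u (X n) (T n)) \<longlonglongrightarrow> u y t - u x t"
          by (intro tendsto_intros cl slice_tendsto[OF t] XT)
        then have "\<forall>\<^sub>F n in sequentially. 0 < u y (T n) - u (X n) (T n)"
          using False by (intro order_tendstoD(1)) auto
        then show ?thesis by eventually_elim (use False in auto)
      qed auto
    qed (use sets in auto)
    have q0: "0 \<le> mu ?A" "0 \<le> mu (?B n)" "0 \<le> mu (?A \<union> ?B n)" for n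
      using sets by (auto intro!: A3_nonneg[OF A3])
    have "\<forall>\<^sub>F n in sequentially. f (u (X n) (T n)) (mu (?A \<union> ?B n)) < - r"
      using order_tendstoD(2)[OF A1_tendsto[OF A1 cl ql q0(3,1)], of "- r"] r by simp
    then show "\<forall>\<^sub>F n in sequentially. case (X n, T n) of (y, s) \<Rightarrow> r < - f (u y s) (mu {z. u z s \<le> u y s})"
    proof eventually_elim
      case (elim n)
      have "mu (?B n) \<le> mu (?A \<union> ?B n)" by (rule A3_mono[OF A3]) (use sets in auto)
      then have "f (u (X n) (T n)) (mu (?B n)) \<le> f (u (X n) (T n)) (mu (?A \<union> ?B n))"
        by (rule A2_mono_q[OF A2 q0(2)])
      with elim show ?case by simp
    qed
  qed
qed

lemma level_set_stationary:
  fixes h :: real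
  defines "m \<equiv> mu {x. u x 0 < h}"
  assumes sub: "viscosity_subsolution f mu u" and super: "viscosity_supersolution f mu u"
    and m: "f h m = 0" "mu {x. u x 0 \<le> h} = m"
    and K: "0 \<le> K" "0 < \<rho>1" "\<And>\<rho> q. 0 \<le> \<rho> \<Longrightarrow> \<rho> \<le> \<rho>1 \<Longrightarrow> mu (erosion {x. u x 0 < h} \<rho>) \<le> q \<Longrightarrow> - K * \<rho> \<le> f h q"
    and K': "0 \<le> K'" "0 < \<rho>1'" "\<And>\<rho> q. 0 \<le> \<rho> \<Longrightarrow> \<rho> \<le> \<rho>1' \<Longrightarrow> 0 \<le> q \<Longrightarrow>
      q \<le> mu (- erosion {x. h < u x 0} \<rho>) \<Longrightarrow> f h q \<le> K' * \<rho>"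
    and t: "0 \<le> t"
  shows "{x. u x t < h} = {x. u x 0 < h}" "{x. u x t \<le> h} = {x. u x 0 \<le> h}"
proof -
  interpret sub: front_subsolution u "\<lambda>x t. f (u x t) (mu {y. u y t < u x t})"
    by (rule front_subsolution_of_viscosity[OF sub])
  interpret super: front_subsolution "\<lambda>x t. - u x t" "\<lambda>x t. - f (u x t) (mu {y. u y t \<le> u x t})"
    by (rule front_subsolution_of_viscosity_uminus[OF super])
  have nn: "0 \<le> mu {y. u y s < c}" "0 \<le> mu {y. u y s \<le> c}" if "0 \<le> s" for s c
    using A3_nonneg[OF A3] slice_sets[OF that] by auto
  obtain M where M: "0 < M" "\<And>r q. 0 \<le> q \<Longrightarrow> \<bar>f r q\<bar> \<le> M"
  proof -
    obtain M where "0 < M" "\<And>z. z \<in> (\<lambda>(r, q). f r q) ` (UNIV \<times> {0..}) \<Longrightarrow> norm z \<le> M"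
      using A1 unfolding A1_def bounded_pos by blast
    then show ?thesis using that[of M] by force
  qed
  \<comment> \<open>Freezes the nonlocal speed at level \<open>h\<close>: above \<open>h\<close>
    both the level and the enclosed measure are at least as large, and \<open>f\<close> increases in
    each.\<close>
  have f_ge: "f h q \<le> f (u x s) (mu {y. u y s < u x s})"
    if "0 \<le> s" "h \<le> u x s" "0 \<le> q" "q \<le> mu {y. u y s < h}" for x s q
  proof -
    have "mu {y. u y s < h} \<le> mu {y. u y s < u x s}"
      by (rule A3_mono[OF A3]) (use that slice_sets in auto)
    then have "f h q \<le> f h (mu {y. u y s < u x s})"
      using that by (intro A2_mono_q[OF A2]) auto
    also have "\<dots> \<le> f (u x s) (mu {y. u y s < u x s})"
      using that nn by (intro A2_mono_r[OF A2]) auto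
    finally show ?thesis .
  qed
  have f_le: "f (u x s) (mu {y. u y s \<le> u x s}) \<le> f h q"
    if "0 \<le> s" "u x s \<le> h" "mu {y. u y s \<le> h} \<le> q" for x s q
  proof -
    have "mu {y. u y s \<le> u x s} \<le> mu {y. u y s \<le> h}"
      by (rule A3_mono[OF A3]) (use that slice_sets in auto)
    then have "f h (mu {y. u y s \<le> u x s}) \<le> f h q"
      using that nn by (intro A2_mono_q[OF A2]) auto
    moreover have "f (u x s) (mu {y. u y s \<le> u x s}) \<le> f h (mu {y. u y s \<le> u x s})"
      using that nn by (intro A2_mono_r[OF A2]) auto
    ultimately show ?thesis by simp
  qed
  have lt: "u x s < h" if s: "0 \<le> s" and "u x 0 < h" for x s
  proof (rule sub.sublevel_persists[OF M(1) _ K(1,2) _ that])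
    show "- M \<le> f (u x t) (mu {y. u y t < u x t})" if "0 < t" for x t
      using M(2)[OF nn(1)[OF less_imp_le[OF that], of "u x t"], of "u x t"] by linarith
    fix x t \<rho> assume *: "0 < t" "0 \<le> \<rho>" "\<rho> \<le> \<rho>1" "erosion {x. u x 0 < h} \<rho> \<subseteq> {x. u x t < h}" "h \<le> u x t"
    have "mu (erosion {x. u x 0 < h} \<rho>) \<le> mu {x. u x t < h}"
      by (rule A3_mono[OF A3 _ _ *(4)]) (use * slice_sets in \<open>auto simp: borel_open\<close>)
    then have "- K * \<rho> \<le> f h (mu {x. u x t < h})" using * by (intro K(3)) auto
    also have "\<dots> \<le> f (u x t) (mu {y. u y t < u x t})" using * nn by (intro f_ge) auto
    finally show "- K * \<rho> \<le> f (u x t) (mu {y. u y t < u x t})" .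
  qed
  have gt: "h < u x s" if s: "0 \<le> s" and "h < u x 0" for x s
  proof -
    have "- u x s < - h"
    proof (rule super.sublevel_persists[OF M(1) _ K'(1,2) _ s])
      show "- M \<le> - f (u x t) (mu {y. u y t \<le> u x t})" if "0 < t" for x t
        using M(2)[OF nn(2)[OF less_imp_le[OF that], of "u x t"], of "u x t"] by linarith
      fix x t \<rho> assume *: "0 < t" "0 \<le> \<rho>" "\<rho> \<le> \<rho>1'" "- h \<le> - u x t"
        "erosion {x. - u x 0 < - h} \<rho> \<subseteq> {x. - u x t < - h}"
      have "mu {x. u x t \<le> h} \<le> mu (- erosion {x. h < u x 0} \<rho>)"
        by (rule A3_mono[OF A3]) (use * slice_sets in \<open>auto simp: borel_closed closed_Compl\<close>)
      then have "f h (mu {x. u x t \<le> h}) \<le> K' * \<rho>" using * nn by (intro K'(3)) auto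
      moreover have "f (u x t) (mu {y. u y t \<le> u x t}) \<le> f h (mu {x. u x t \<le> h})"
        using * by (intro f_le) auto
      ultimately show "- K' * \<rho> \<le> - f (u x t) (mu {y. u y t \<le> u x t})" by simp
    qed (use that in auto)
    then show ?thesis by simp
  qed
  \<comment> \<open>The two inclusions squeeze: the strict set has measure at least
    \<open>m\<close>, the non-strict one at most \<open>m\<close>. Absence of fattening makes this
    the same \<open>m\<close>, at which the speed is 0.\<close>
  have m_le: "m \<le> mu {x. u x s < h}" if "0 \<le> s" for s
    unfolding m_def using lt[OF that] by (intro A3_mono[OF A3] slice_sets that order_refl) blast
  have le_m: "mu {x. u x s \<le> h} \<le> m" if "0 \<le> s" for s
    unfolding m(2)[symmetric] using gt[OF that] by (intro A3_mono[OF A3] slice_sets that order_refl) (auto simp: not_less[symmetric])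
  have m0: "0 \<le> m" unfolding m_def using nn by simp
  \<comment> \<open>A point with initial value exactly \<open>h\<close> has no ball inside the
    strict sublevel set at \<open>h\<close>. Every level \<open>c > h\<close> provides one, the
    speed there is nonnegative, and \<open>c\<close> then tends to \<open>h\<close>.\<close>
  have le: "u x t \<le> h" if "u x 0 \<le> h" for x
  proof (rule dense_ge)
    fix c assume c: "h < c"
    have op: "open {x. u x 0 < c}" by (intro open_Collect_less slice_continuous continuous_intros) simp
    have "x \<in> {x. u x 0 < c}" using that c by simp
    with op obtain r where r: "0 < r" "ball x r \<subseteq> {x. u x 0 < c}"
      unfolding open_contains_ball by blast
    have "u x t < c"
    proof (rule sub.ball_persists[of 0 0 "t + 1" c x r t])
      fix y s assume *: "0 < (s::real)" "c \<le> u y s"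
      show "- 0 \<le> f (u y s) (mu {z. u z s < u y s})"
        using f_ge[of s y m] m_le[of s] * c m0 m(1) by simp
    qed (use r t in auto)
    then show "u x t \<le> c" by simp
  qed
  have ge: "h \<le> u x t" if "h \<le> u x 0" for x
  proof (rule dense_le)
    fix c assume c: "c < h"
    have op: "open {x. c < u x 0}" by (intro open_Collect_less slice_continuous continuous_intros) simp
    have "x \<in> {x. c < u x 0}" using that c by simp
    with op obtain r where r: "0 < r" "ball x r \<subseteq> {x. c < u x 0}"
      unfolding open_contains_ball by blast
    have "- u x t < - c"
    proof (rule super.ball_persists[of 0 0 "t + 1" "- c" x r t])
      fix y s assume *: "0 < (s::real)" "- c \<le> - u y s"
      show "- 0 \<le> - f (u y s) (mu {z. u z s \<le> u y s})"
        using f_le[of s y m] le_m[of s] * c m(1) by simp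
    qed (use r t in auto)
    then show "c \<le> u x t" by simp
  qed
  show "{x. u x t < h} = {x. u x 0 < h}" using lt[OF t] ge by (auto simp: not_less[symmetric])
  show "{x. u x t \<le> h} = {x. u x 0 \<le> h}" using le gt[OF t] by (auto simp: not_less[symmetric])
qed

end

theorem theorem3p1:
  fixes f :: "real \<Rightarrow> real \<Rightarrow> real"
    and \<Theta> :: "real^'n \<Rightarrow> real"
    and mu :: "(real^'n) set \<Rightarrow> real"
    and u0 :: "real^'n \<Rightarrow> real"
    and hb C s0 :: real
  assumes "A1 f" and "A2 f" and "A3 \<Theta> mu" and "A4 u0"
    and Theta_bounded: "bounded (range \<Theta>)"
    and hb: "f hb (mu {x. u0 x < hb}) \<le> 0" "0 \<le> f hb (mu {x. u0 x \<le> hb})"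
    and loc_Lipschitz: "\<forall>q\<ge>0. \<exists>e>0. \<exists>L. L-lipschitz_on (cball q e \<inter> {0..}) (f hb)"
    and no_fattening: "mu {x. u0 x < hb} = mu {x. u0 x \<le> hb}"
    and "0 < C" and "0 < s0"
    and per: "\<forall>s. 0 < s \<and> s \<le> s0 \<longrightarrow>
                perimeter (parD u0 hb (- s)) + perimeter (parE u0 hb s) \<le> ereal C"
  shows "(\<forall>t\<ge>0. delta_D f mu u0 t hb = 0 \<and> delta_E f mu u0 t hb = 0) \<and>
         (\<forall>u. cauchy_solution f mu u0 u \<and> linear_growth u \<longrightarrow>
            (\<forall>t\<ge>0. {x. u x t < hb} = {x. u0 x < hb} \<and> {x. u x t \<le> hb} = {x. u0 x \<le> hb}))"
proof -
  let ?U = "{x. u0 x < hb}" and ?V = "{x. hb < u0 x}"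
  have cont: "continuous_on UNIV u0"
    using \<open>A4 u0\<close> unfolding A4_def by (blast intro: uniformly_continuous_imp_continuous)
  have U: "open ?U" and V: "open ?V" using cont by (auto intro!: open_Collect_less)
  have VE: "- ?V = {x. u0 x \<le> hb}" by auto
  have f0: "f hb (mu ?U) = 0" using hb no_fattening by simp
  then have f0': "f hb (mu (- ?V)) = 0" unfolding VE no_fattening .
  have m0: "0 \<le> mu ?U" using U by (intro A3_nonneg[OF \<open>A3 \<Theta> mu\<close>]) (auto simp: borel_open)
  obtain B where B: "\<And>x. \<Theta> x \<le> B"
    using Theta_bounded unfolding bounded_iff by (auto simp: abs_le_iff)
  obtain e L where e: "0 < e" "L-lipschitz_on (cball (mu ?U) e \<inter> {0..}) (f hb)"
    using loc_Lipschitz m0 by blast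
  \<comment> \<open>Both sides use the Lipschitz constant at the same measure, since the two level
    sets have equal measure.\<close>
  have e': "L-lipschitz_on (cball (mu (- ?V)) e \<inter> {0..}) (f hb)"
    using e(2) unfolding VE no_fattening .
  have "perimeter (erosion ?U s) + perimeter (- erosion ?V s) \<le> ereal C" if "0 < s" "s \<le> s0" for s
    using per that parD_eq_erosion[of s u0 hb] parE_eq_erosion[of s u0 hb] by auto
  note perD = perimeter_add_le_imp(1)[OF this] and perE = perimeter_add_le_imp(2)[OF this]
  have C: "0 \<le> C" using \<open>0 < C\<close> by simp
  obtain K \<rho>1 where K: "0 \<le> K" "0 < \<rho>1"
    "\<And>\<rho> q. 0 \<le> \<rho> \<Longrightarrow> \<rho> \<le> \<rho>1 \<Longrightarrow> mu (erosion ?U \<rho>) \<le> q \<Longrightarrow> - K * \<rho> \<le> f hb q"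
    using speed_lower_bound[OF \<open>A2 f\<close> \<open>A3 \<Theta> mu\<close> B C \<open>0 < s0\<close> U perD f0 e(2,1)] by metis
  obtain K' \<rho>1' where K': "0 \<le> K'" "0 < \<rho>1'"
    "\<And>\<rho> q. 0 \<le> \<rho> \<Longrightarrow> \<rho> \<le> \<rho>1' \<Longrightarrow> 0 \<le> q \<Longrightarrow> q \<le> mu (- erosion ?V \<rho>) \<Longrightarrow> f hb q \<le> K' * \<rho>"
    using speed_upper_bound[OF \<open>A2 f\<close> \<open>A3 \<Theta> mu\<close> B C \<open>0 < s0\<close> V perE f0' e' e(1)] by metis
  have "is_delta_D f mu u0 hb (\<lambda>t. 0)"
    by (rule is_delta_D_0[OF \<open>A2 f\<close> \<open>A3 \<Theta> mu\<close> cont f0 K])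
  moreover have "is_delta_E f mu u0 hb (\<lambda>t. 0)"
    by (rule is_delta_E_0[OF \<open>A2 f\<close> \<open>A3 \<Theta> mu\<close> cont f0'[unfolded VE] K'])
  moreover have "{x. u x t < hb} = ?U \<and> {x. u x t \<le> hb} = {x. u0 x \<le> hb}"
    if u: "cauchy_solution f mu u0 u" and t: "0 \<le> t" for u t
  proof -
    have u0: "u0 = (\<lambda>x. u x 0)" using u unfolding cauchy_solution_def by auto
    have "continuous_on (UNIV \<times> {0..}) (\<lambda>(x, t). u x t)"
      "viscosity_subsolution f mu u" "viscosity_supersolution f mu u"
      using u unfolding cauchy_solution_def by auto
    note level_set_stationary[OF \<open>A1 f\<close> \<open>A2 f\<close> \<open>A3 \<Theta> mu\<close> this
        f0[unfolded u0] no_fattening[unfolded u0, symmetric] K[unfolded u0] K'[unfolded u0] t]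
    then show ?thesis unfolding u0 by blast
  qed
  ultimately show ?thesis using delta_D_eq delta_E_eq by blast
qed

end
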